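(* Let $X=N+A$ be a local submartingale of class $(\Sigma)$, with only negative jumps and with $A_\infty=\infty$. Let $\vartheta$ be a probability measure on $\mathbb{R}_+$ without atoms; write $\vartheta(z)=\vartheta([0,z])$ and $b_\vartheta=\inf\{x\ge0:\vartheta([x,\infty))=0\}$. Define $$\overline{\psi}_\vartheta(x)=\int_{(x,\infty)}\frac{z\,d\vartheta(z)}{\vartheta(z)},\qquad \overline{\varphi}_\vartheta(x)=\inf\{z\ge0:\ \overline{\psi}_\vartheta(z)>x\}\ \text{ for } x<b_\vartheta,$$ and $\overline{\varphi}_\vartheta(x)=0$ for all $x\ge b_\vartheta$. Then the stopping time $$\overline{T}_\vartheta=\inf\{t\ge0:\ X_t\ge\overline{\varphi}_\vartheta(A_t)\}$$ embeds $\vartheta$, i.e. the law of $X_{\overline{T}_\vartheta}$ is $\vartheta$.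
   Context: All processes are defined on a filtered probability space; "increasing" means nondecreasing. A positive (i.e. nonnegative) local submartingale $X$ which decomposes as $X_t=N_t+A_t$ is of class $(\Sigma)$ if: (i) $(N_t)$ is a càdlàg local martingale with $N_0=0$; (ii) $(A_t)$ is a continuous increasing process with $A_0=0$; (iii) the measure $(dA_t)$ is carried by the set $\{t: X_t=0\}$. "Only negative jumps" means that all jumps of $X$ are negative (continuous $X$ is allowed). $A_\infty=\lim_{t\to\infty}A_t$.
   Formalization: The formal version takes φ̄(x)=inf{z≥0: ψ̄(z)≤x} instead of ψ̄(z)>x (which gives T̄=0), sets φ̄=0 from x≥ψ̄(0) on instead of x≥b_ϑ, and assumes ϑ has finite mean (otherwise ψ̄≡∞ and the claim fails). *)

theory Defs
  imports "HOL-Probability.Probability" "HOL-Probability.Stopping_Time"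
begin

text \<open>
  Processes are functions \<open>X :: real \<Rightarrow> 'a \<Rightarrow> real\<close> of which only the values at times \<open>t \<ge> 0\<close> matter.
  Random times take values in \<open>[0, \<infinity>]\<close>, that is in \<^typ>\<open>ennreal\<close>.  The filtration is indexed by
  \<^typ>\<open>ennreal\<close> as well, so that the library notion of stopping time applies to times with value
  \<open>\<infinity>\<close>.  The additional sigma-algebra \<open>F \<infinity>\<close> is no restriction: any filtration indexed by finite times
  extends by \<open>F \<infinity> = M\<close>.  The usual conditions (right-continuity, completeness) are not assumed, and
  path properties are required almost surely.
\<close>

locale filtered_prob_space = prob_space M + filtration "space M" F
  for M :: "'a measure" and F :: "ennreal \<Rightarrow> 'a measure" +
  assumes subalgebra_F: "subalgebra M (F t)"

definition usual_augmentation :: "'a measure \<Rightarrow> (ennreal \<Rightarrow> 'a measure) \<Rightarrow> ennreal \<Rightarrow> 'a measure"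
  where \<comment> \<open>Right-continuous and complete: the null sets of \<^term>\<open>completion M\<close> are all subsets of null
    sets of \<open>M\<close>.  At \<open>t = \<infinity>\<close> the intersection has the single member \<open>s = \<infinity>\<close>.\<close>
  "usual_augmentation M F t =
     sigma (space M) (\<Inter>s\<in>{s. t < s \<or> s = \<infinity>}.
       sigma_sets (space M) (sets (F s) \<union> null_sets (completion M)))"

definition adapted :: "(ennreal \<Rightarrow> 'a measure) \<Rightarrow> (real \<Rightarrow> 'a \<Rightarrow> real) \<Rightarrow> bool" where
  "adapted F X \<longleftrightarrow> (\<forall>t\<ge>0. X t \<in> borel_measurable (F (ennreal t)))"

definition martingale :: "'a measure \<Rightarrow> (ennreal \<Rightarrow> 'a measure) \<Rightarrow> (real \<Rightarrow> 'a \<Rightarrow> real) \<Rightarrow> bool" where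
  "martingale M F X \<longleftrightarrow> adapted F X \<and> (\<forall>t\<ge>0. integrable M (X t)) \<and>
     (\<forall>s t. 0 \<le> s \<and> s \<le> t \<longrightarrow> (AE \<omega> in M. real_cond_exp M (F (ennreal s)) (X t) \<omega> = X s \<omega>))"

definition submartingale :: "'a measure \<Rightarrow> (ennreal \<Rightarrow> 'a measure) \<Rightarrow> (real \<Rightarrow> 'a \<Rightarrow> real) \<Rightarrow> bool" where
  "submartingale M F X \<longleftrightarrow> adapted F X \<and> (\<forall>t\<ge>0. integrable M (X t)) \<and>
     (\<forall>s t. 0 \<le> s \<and> s \<le> t \<longrightarrow> (AE \<omega> in M. X s \<omega> \<le> real_cond_exp M (F (ennreal s)) (X t) \<omega>))"

definition value_at :: "(real \<Rightarrow> 'a \<Rightarrow> real) \<Rightarrow> ('a \<Rightarrow> ennreal) \<Rightarrow> 'a \<Rightarrow> real" where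
  "value_at X \<tau> \<omega> = X (enn2real (\<tau> \<omega>)) \<omega>"

definition stopped :: "(real \<Rightarrow> 'a \<Rightarrow> real) \<Rightarrow> ('a \<Rightarrow> ennreal) \<Rightarrow> real \<Rightarrow> 'a \<Rightarrow> real" where
  "stopped X \<tau> t = value_at X (\<lambda>\<omega>. min (ennreal t) (\<tau> \<omega>))"

definition localizing_sequence ::
    "'a measure \<Rightarrow> (ennreal \<Rightarrow> 'a measure) \<Rightarrow> (nat \<Rightarrow> 'a \<Rightarrow> ennreal) \<Rightarrow> bool" where
  "localizing_sequence M F \<tau> \<longleftrightarrow> (\<forall>n. stopping_time F (\<tau> n)) \<and>
     (AE \<omega> in M. incseq (\<lambda>n. \<tau> n \<omega>) \<and> (\<lambda>n. \<tau> n \<omega>) \<longlonglongrightarrow> \<infinity>)"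

definition local_martingale :: "'a measure \<Rightarrow> (ennreal \<Rightarrow> 'a measure) \<Rightarrow> (real \<Rightarrow> 'a \<Rightarrow> real) \<Rightarrow> bool" where
  "local_martingale M F X \<longleftrightarrow> adapted F X \<and>
     (\<exists>\<tau>. localizing_sequence M F \<tau> \<and> (\<forall>n. martingale M F (stopped X (\<tau> n))))"

definition local_submartingale :: "'a measure \<Rightarrow> (ennreal \<Rightarrow> 'a measure) \<Rightarrow> (real \<Rightarrow> 'a \<Rightarrow> real) \<Rightarrow> bool" where
  "local_submartingale M F X \<longleftrightarrow> adapted F X \<and>
     (\<exists>\<tau>. localizing_sequence M F \<tau> \<and> (\<forall>n. submartingale M F (stopped X (\<tau> n))))"

definition cadlag :: "(real \<Rightarrow> real) \<Rightarrow> bool" where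
  "cadlag f \<longleftrightarrow> (\<forall>t\<ge>0. continuous (at_right t) f) \<and> (\<forall>t>0. \<exists>l. (f \<longlongrightarrow> l) (at_left t))"

definition jump :: "(real \<Rightarrow> real) \<Rightarrow> real \<Rightarrow> real" where
  "jump f t = f t - Lim (at_left t) f"

definition class_Sigma ::
    "'a measure \<Rightarrow> (ennreal \<Rightarrow> 'a measure) \<Rightarrow> (real \<Rightarrow> 'a \<Rightarrow> real) \<Rightarrow>
      (real \<Rightarrow> 'a \<Rightarrow> real) \<Rightarrow> (real \<Rightarrow> 'a \<Rightarrow> real) \<Rightarrow> bool"
  where \<comment> \<open>The measure \<open>dA\<close> is the Lebesgue--Stieltjes measure of the path \<open>A\<close>, extended by the constant
    \<open>A 0\<close> to negative times, where it has no mass.\<close>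
  "class_Sigma M F X N A \<longleftrightarrow>
     local_submartingale M F X \<and>
     (AE \<omega> in M. \<forall>t\<ge>0. 0 \<le> X t \<omega>) \<and>
     (AE \<omega> in M. \<forall>t\<ge>0. X t \<omega> = N t \<omega> + A t \<omega>) \<and>
     local_martingale M F N \<and>
     (AE \<omega> in M. cadlag (\<lambda>t. N t \<omega>)) \<and>
     (AE \<omega> in M. N 0 \<omega> = 0) \<and>
     adapted F A \<and>
     (AE \<omega> in M. continuous_on {0..} (\<lambda>t. A t \<omega>)) \<and>
     (AE \<omega> in M. mono_on {0..} (\<lambda>t. A t \<omega>)) \<and>
     (AE \<omega> in M. A 0 \<omega> = 0) \<and>
     (AE \<omega> in M. AE t in interval_measure (\<lambda>t. A (max 0 t) \<omega>). 0 \<le> t \<longrightarrow> X t \<omega> = 0)"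

definition only_negative_jumps :: "'a measure \<Rightarrow> (real \<Rightarrow> 'a \<Rightarrow> real) \<Rightarrow> bool" where
  "only_negative_jumps M X \<longleftrightarrow> (AE \<omega> in M. \<forall>t>0. jump (\<lambda>t. X t \<omega>) t \<le> 0)"

definition psi_bar :: "real measure \<Rightarrow> real \<Rightarrow> ennreal" where
  "psi_bar \<theta> x = (\<integral>\<^sup>+z\<in>{x<..}. (ennreal z / emeasure \<theta> {0..z}) \<partial>\<theta>)"

text \<open>
  Since \<^term>\<open>psi_bar \<theta>\<close> is nonincreasing, its right-continuous inverse is the infimum of
  \<open>{z \<ge> 0. psi_bar \<theta> z \<le> x}\<close>; the set \<open>{z \<ge> 0. psi_bar \<theta> z > x}\<close> is an initial segment of
  \<open>[0, \<infinity>)\<close>, whose infimum is \<open>0\<close> or \<open>\<infinity>\<close>.  The argument \<open>x\<close> lies on the scale of the values of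
  \<^term>\<open>psi_bar \<theta>\<close>, so the inverse vanishes from \<^term>\<open>psi_bar \<theta> 0\<close> on, which is in general
  different from the right end point of the support of \<open>\<theta>\<close>.  If the support is unbounded,
  \<open>phi_bar \<theta> 0 = Inf {} = \<infinity>\<close>.
\<close>

definition phi_bar :: "real measure \<Rightarrow> real \<Rightarrow> ennreal" where
  "phi_bar \<theta> x =
     (if ennreal x < psi_bar \<theta> 0 then Inf {ennreal z |z. 0 \<le> z \<and> psi_bar \<theta> z \<le> ennreal x} else 0)"

definition T_bar :: "real measure \<Rightarrow> (real \<Rightarrow> 'a \<Rightarrow> real) \<Rightarrow> (real \<Rightarrow> 'a \<Rightarrow> real) \<Rightarrow> 'a \<Rightarrow> ennreal" where
  "T_bar \<theta> X A \<omega> = Inf {ennreal t |t. 0 \<le> t \<and> phi_bar \<theta> (A t \<omega>) \<le> ennreal (X t \<omega>)}"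

definition embeds :: "'a measure \<Rightarrow> (ennreal \<Rightarrow> 'a measure) \<Rightarrow> (real \<Rightarrow> 'a \<Rightarrow> real) \<Rightarrow>
    ('a \<Rightarrow> ennreal) \<Rightarrow> real measure \<Rightarrow> bool"
  where \<comment> \<open>As a hitting time, \<open>T\<close> need only be a stopping time of the usual augmentation, and the value of
    \<open>X\<close> at \<open>T\<close> need only be measurable for the completion of \<open>M\<close>.  Under the usual conditions these are
    \<open>F\<close> and \<open>M\<close> themselves.\<close>
  "embeds M F X T \<theta> \<longleftrightarrow>
     stopping_time (usual_augmentation M F) T \<and>
     (AE \<omega> in M. T \<omega> < \<infinity>) \<and>
     value_at X T \<in> borel_measurable (completion M) \<and>
     distr (completion M) borel (value_at X T) = \<theta>"

end

theory Submission
  imports Defs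
begin

text \<open>
  Write \<open>\<psi>\<close>, \<open>\<phi>\<close> for \<^const>\<open>psi_bar\<close>, \<^const>\<open>phi_bar\<close>.  Since \<open>\<phi> x \<le> z\<close> iff \<open>\<psi> z \<le> x\<close>, the time \<open>T\<close> is the hitting
  time of \<open>\<psi>(X) \<le> A\<close>.  It is almost surely the limit \<open>\<sigma>\<close> of the increasing times \<open>S\<^sub>n\<close> at which
  \<open>\<psi>(X) \<le> A + 1/(n+1)\<close>, all defined through rational times.  If \<open>\<tau>\<^sub>u\<close> is the time at which \<open>A\<close> exceeds \<open>u\<close>,
  then \<open>X = 0\<close> at \<open>\<tau>\<^sub>u\<close>, and \<open>N\<close> is bounded between \<open>\<tau>\<^sub>u\<close> and \<open>\<sigma> \<and> \<tau>\<^sub>b\<close> on \<open>{\<tau>\<^sub>u < \<sigma>}\<close>.  Optional stopping at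
  \<open>S\<^sub>n \<and> \<tau>\<^sub>b\<close> and at \<open>\<sigma> \<and> \<tau>\<^sub>b\<close> gives the same expectation; as the jumps are negative, \<open>X\<close> does not jump at
  \<open>\<sigma>\<close>, so that \<open>\<psi>(X) = A\<close> there.  The same identity shows that \<open>G u = P(A\<^sub>T > u)\<close> satisfies
  \<open>-\<phi> dG = G du\<close>.  The function \<open>\<theta>[0, \<phi>(u)]\<close> satisfies this equation by the definition of \<open>\<psi>\<close> and has
  the same limit \<open>1\<close> at \<open>0\<close>, so both agree, which is the law of \<open>X\<^sub>T = \<phi>(A\<^sub>T)\<close>.
\<close>

subsection \<open>Optional times and values on a grid\<close>

text \<open>The mean of \<theta> must be finite: \<open>\<Phi> \<le> 1\<close> gives \<psi>(x) at
  least the integral of z over (x, \<infinity>), so an infinite mean would make \<psi> identically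
  infinite and the time would never occur. Three obstacles shape the proof. Without the usual
  conditions an infimum over real times is not known to be adapted to \<open>F\<close>; hence
  rational times, strict inequalities, and a transfer to the real hitting time only up to null sets.
  If the support is unbounded, \<phi>(0) is infinite and X has no bound before A has grown; starting
  at a level u gives the bound \<phi>(u) on X, and stopping at a level b gives the bound b on A.
  Finally, the announcing times only control the limit of X along them. A downward jump could leave
  X below \<phi>(A) at \<sigma>, and no argument on a single path excludes this; only the comparison
  of expectations does. The equation for G is kept as a pair of inequalities over intervals, because
  G is merely monotone and \<phi> jumps across every gap in the support of \<theta>.\<close>

lemma ennreal_Rats_dense:
  fixes x y :: ennreal
  assumes "x < y"
  obtains q :: real where "q \<in> \<rat>" "0 \<le> q" "x < ennreal q" "ennreal q < y"
proof -
  obtain r :: rat where r: "x < real_of_rat r" "real_of_rat r < y"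
    using ennreal_rat_dense[OF assms] by blast
  have "0 \<le> real_of_rat r"
    using r(1) by (metis ennreal_neg linorder_not_le nle_le not_less_zero)
  with r show thesis by (intro that[of "real_of_rat r"]) auto
qed

text \<open>The event \<open>B\<close> belongs to the \<open>\<sigma>\<close>-algebra \<open>F\<^sub>T\<^sub>+\<close>.\<close>

definition pre_event :: "(ennreal \<Rightarrow> 'a measure) \<Rightarrow> ('a \<Rightarrow> ennreal) \<Rightarrow> ('a \<Rightarrow> bool) \<Rightarrow> bool" where
  "pre_event F T B \<longleftrightarrow> (\<forall>t. Measurable.pred (F t) (\<lambda>\<omega>. B \<omega> \<and> T \<omega> < t))"

text \<open>The strict inequality makes this a stopping time of the right-continuous filtration,
  which is what an infimum over rational times provides.\<close>

definition optional_time :: "(ennreal \<Rightarrow> 'a measure) \<Rightarrow> ('a \<Rightarrow> ennreal) \<Rightarrow> bool" where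
  "optional_time F T \<longleftrightarrow> pre_event F T (\<lambda>_. True)"

lemma optional_timeD: "optional_time F T \<Longrightarrow> Measurable.pred (F t) (\<lambda>\<omega>. T \<omega> < t)"
  by (simp add: optional_time_def pre_event_def)

lemma optional_timeI: "(\<And>t. Measurable.pred (F t) (\<lambda>\<omega>. T \<omega> < t)) \<Longrightarrow> optional_time F T"
  by (simp add: optional_time_def pre_event_def)

lemma pre_eventD: "pre_event F T B \<Longrightarrow> Measurable.pred (F t) (\<lambda>\<omega>. B \<omega> \<and> T \<omega> < t)"
  by (simp add: pre_event_def)

lemma optional_time_const: "optional_time F (\<lambda>_. c)"
  by (rule optional_timeI) simp

lemma optional_time_min:
  "optional_time F S \<Longrightarrow> optional_time F T \<Longrightarrow> optional_time F (\<lambda>\<omega>. min (S \<omega>) (T \<omega>))"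
  by (auto intro!: optional_timeI pred_intros_logic dest: optional_timeD simp: min_less_iff_disj)

lemma optional_time_max:
  "optional_time F S \<Longrightarrow> optional_time F T \<Longrightarrow> optional_time F (\<lambda>\<omega>. max (S \<omega>) (T \<omega>))"
  by (auto intro!: optional_timeI pred_intros_logic dest: optional_timeD)

context filtered_prob_space
begin

lemma sets_F_le: "sets (F t) \<subseteq> sets M"
  using subalgebra_F[of t] by (simp add: subalgebra_def)

lemma measurable_F_M: "f \<in> measurable (F t) K \<Longrightarrow> f \<in> measurable M K"
  using measurable_from_subalg[OF subalgebra_F] .

lemma pred_F_mono: "s \<le> t \<Longrightarrow> Measurable.pred (F s) P \<Longrightarrow> Measurable.pred (F t) P"
  unfolding pred_def space_F by (rule subsetD[OF sets_F_mono])

lemma pred_F_Rats_Ex: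
  assumes "\<And>q. q \<in> \<rat> \<Longrightarrow> 0 \<le> q \<Longrightarrow> ennreal q < t \<Longrightarrow> Measurable.pred (F t) (P q)"
  shows "Measurable.pred (F t) (\<lambda>\<omega>. \<exists>q\<in>{q\<in>\<rat>. 0 \<le> q \<and> ennreal q < t}. P q \<omega>)"
proof -
  have "countable {q::real. q \<in> \<rat> \<and> 0 \<le> q \<and> ennreal q < t}"
    by (rule countable_subset[OF _ countable_rat]) auto
  moreover have "{\<omega>\<in>space (F t). \<exists>q\<in>{q\<in>\<rat>. 0 \<le> q \<and> ennreal q < t}. P q \<omega>} =
      (\<Union>q\<in>{q\<in>\<rat>. 0 \<le> q \<and> ennreal q < t}. {\<omega>\<in>space (F t). P q \<omega>})"
    by auto
  ultimately show ?thesis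
    using assms unfolding pred_def by (simp del: UN_simps) (intro sets.countable_UN'; auto)
qed

lemma stopping_imp_optional:
  assumes "stopping_time F T"
  shows "optional_time F T"
proof (rule optional_timeI)
  fix t
  have "(T \<omega> < t) = (\<exists>q\<in>{q\<in>\<rat>. 0 \<le> q \<and> ennreal q < t}. T \<omega> \<le> ennreal q)" for \<omega>
    by (rule iffI, erule ennreal_Rats_dense) (auto intro: le_less_trans less_imp_le)
  moreover have "Measurable.pred (F t) (\<lambda>\<omega>. \<exists>q\<in>{q\<in>\<rat>. 0 \<le> q \<and> ennreal q < t}. T \<omega> \<le> ennreal q)"
    by (intro pred_F_Rats_Ex) (auto intro: pred_F_mono[OF less_imp_le] stopping_timeD[OF assms])
  ultimately show "Measurable.pred (F t) (\<lambda>\<omega>. T \<omega> < t)" by simp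
qed

text \<open>The infimum is below \<open>t\<close> exactly when some rational time before
  \<open>t\<close> qualifies, so only a countable union is involved.\<close>

lemma optional_time_rational_debut:
  assumes "\<And>q. q \<in> \<rat> \<Longrightarrow> 0 \<le> q \<Longrightarrow> Measurable.pred (F (ennreal q)) (P q)"
  shows "optional_time F (\<lambda>\<omega>. Inf {ennreal q |q. q \<in> \<rat> \<and> 0 \<le> q \<and> P q \<omega>})"
proof (rule optional_timeI)
  fix t
  have "(Inf {ennreal q |q. q \<in> \<rat> \<and> 0 \<le> q \<and> P q \<omega>} < t) = (\<exists>q\<in>{q\<in>\<rat>. 0 \<le> q \<and> ennreal q < t}. P q \<omega>)" for \<omega>
    by (auto simp: Inf_less_iff)
  moreover have "Measurable.pred (F t) (\<lambda>\<omega>. \<exists>q\<in>{q\<in>\<rat>. 0 \<le> q \<and> ennreal q < t}. P q \<omega>)"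
    by (intro pred_F_Rats_Ex) (auto intro: pred_F_mono[OF less_imp_le] assms)
  ultimately show "Measurable.pred (F t) (\<lambda>\<omega>. Inf {ennreal q |q. q \<in> \<rat> \<and> 0 \<le> q \<and> P q \<omega>} < t)" by simp
qed

lemma optional_time_SUP:
  fixes T :: "nat \<Rightarrow> 'a \<Rightarrow> ennreal"
  assumes "\<And>n. optional_time F (T n)"
  shows "optional_time F (\<lambda>\<omega>. SUP n. T n \<omega>)"
proof (rule optional_timeI)
  fix t
  \<comment> \<open>That every \<open>T n\<close> is below \<open>t\<close> does not bound the
    supremum strictly; one rational below \<open>t\<close> has to dominate all of them.\<close>
  have "((SUP n. T n \<omega>) < t) = (\<exists>q\<in>{q\<in>\<rat>. 0 \<le> q \<and> ennreal q < t}. \<forall>n. T n \<omega> < ennreal q)" (is "?l = ?r") for \<omega>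
  proof
    assume ?l
    then obtain q where "q \<in> \<rat>" "0 \<le> q" "(SUP n. T n \<omega>) < ennreal q" "ennreal q < t"
      by (rule ennreal_Rats_dense)
    then show ?r
      using le_less_trans[OF SUP_upper[of _ UNIV "\<lambda>n. T n \<omega>"], of _ "ennreal q"] by auto
  next
    assume ?r
    then obtain q where "ennreal q < t" "\<And>n. T n \<omega> < ennreal q" by auto
    then show ?l by (intro le_less_trans[OF SUP_least[of _ _ "ennreal q"]]) (auto intro: less_imp_le)
  qed
  moreover have "Measurable.pred (F t) (\<lambda>\<omega>. \<exists>q\<in>{q\<in>\<rat>. 0 \<le> q \<and> ennreal q < t}. \<forall>n. T n \<omega> < ennreal q)"
    by (intro pred_F_Rats_Ex pred_intros_countable)
      (auto intro: pred_F_mono[OF less_imp_le] optional_timeD[OF assms])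
  ultimately show "Measurable.pred (F t) (\<lambda>\<omega>. (SUP n. T n \<omega>) < t)" by simp
qed

text \<open>Whether \<rho> occurs before \<sigma> is known just after \<rho>: a rational between
  \<rho> and both \<sigma> and \<open>t\<close> witnesses it. This makes the event that \<tau>(u)
  precedes \<sigma> admissible for optional stopping from \<tau>(u) on.\<close>

lemma pre_event_less:
  assumes B: "pre_event F \<rho> B" and "optional_time F \<sigma>"
  shows "pre_event F \<rho> (\<lambda>\<omega>. B \<omega> \<and> \<rho> \<omega> < \<sigma> \<omega>)"
  unfolding pre_event_def
proof
  fix t
  have "((B \<omega> \<and> \<rho> \<omega> < \<sigma> \<omega>) \<and> \<rho> \<omega> < t) =
      (\<exists>q\<in>{q\<in>\<rat>. 0 \<le> q \<and> ennreal q < t}. (B \<omega> \<and> \<rho> \<omega> < ennreal q) \<and> \<not> \<sigma> \<omega> < ennreal q)" (is "?l = ?r") for \<omega>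
  proof
    assume l: ?l
    then have "\<rho> \<omega> < min (\<sigma> \<omega>) t" by simp
    then obtain q where "q \<in> \<rat>" "0 \<le> q" "\<rho> \<omega> < ennreal q" "ennreal q < min (\<sigma> \<omega>) t"
      by (rule ennreal_Rats_dense)
    then have "q \<in> {q \<in> \<rat>. 0 \<le> q \<and> ennreal q < t}"
      and "(B \<omega> \<and> \<rho> \<omega> < ennreal q) \<and> \<not> \<sigma> \<omega> < ennreal q"
      using l by (simp_all add: not_less less_imp_le)
    then show ?r by (rule rev_bexI)
  next
    assume ?r
    then obtain q where q: "ennreal q < t" "B \<omega>" "\<rho> \<omega> < ennreal q" "\<not> \<sigma> \<omega> < ennreal q" by blast
    then show ?l
      using less_trans[OF q(3,1)] less_le_trans[OF q(3), of "\<sigma> \<omega>"] by (simp add: not_less)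
  qed
  moreover have "Measurable.pred (F t) (\<lambda>\<omega>. \<exists>q\<in>{q\<in>\<rat>. 0 \<le> q \<and> ennreal q < t}.
      (B \<omega> \<and> \<rho> \<omega> < ennreal q) \<and> \<not> \<sigma> \<omega> < ennreal q)"
  proof (rule pred_F_Rats_Ex)
    fix q :: real assume "ennreal q < t"
    then have "Measurable.pred (F t) (\<lambda>\<omega>. B \<omega> \<and> \<rho> \<omega> < ennreal q)"
        "Measurable.pred (F t) (\<lambda>\<omega>. \<sigma> \<omega> < ennreal q)"
      using pred_F_mono[OF _ pre_eventD[OF B]] pred_F_mono[OF _ optional_timeD[OF assms(2)]]
      by (simp_all add: less_imp_le)
    then show "Measurable.pred (F t) (\<lambda>\<omega>. (B \<omega> \<and> \<rho> \<omega> < ennreal q) \<and> \<not> \<sigma> \<omega> < ennreal q)"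
      by measurable
  qed
  ultimately show "Measurable.pred (F t) (\<lambda>\<omega>. (B \<omega> \<and> \<rho> \<omega> < \<sigma> \<omega>) \<and> \<rho> \<omega> < t)" by simp
qed

text \<open>The order of the two times is demanded on \<open>B\<close> only, because a truncated
  time may precede \<rho> elsewhere.\<close>

lemma pre_event_mono:
  assumes B: "pre_event F \<rho> B" and T: "optional_time F T" and le: "\<And>\<omega>. B \<omega> \<Longrightarrow> \<rho> \<omega> \<le> T \<omega>"
  shows "pre_event F T B"
  unfolding pre_event_def
proof
  fix t
  have "(B \<omega> \<and> T \<omega> < t) = ((B \<omega> \<and> \<rho> \<omega> < t) \<and> T \<omega> < t)" for \<omega>
    using le[of \<omega>] by auto
  moreover have "Measurable.pred (F t) (\<lambda>\<omega>. (B \<omega> \<and> \<rho> \<omega> < t) \<and> T \<omega> < t)"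
    by (intro pred_intros_logic(3) pre_eventD[OF B] optional_timeD[OF T])
  ultimately show "Measurable.pred (F t) (\<lambda>\<omega>. B \<omega> \<and> T \<omega> < t)" by simp
qed

lemma optional_time_measurable:
  assumes "optional_time F T"
  shows "T \<in> borel_measurable M"
proof (rule borel_measurableI_less)
  show "{\<omega> \<in> space M. T \<omega> < t} \<in> sets M" for t
    using measurable_F_M[OF optional_timeD[OF assms, of t]] by (simp add: pred_def)
qed

section \<open>Martingale integrals over events of the past\<close>

lemma martingale_set_integral:
  assumes Y: "martingale M F Y" and st: "0 \<le> s" "s \<le> t" and E: "E \<in> sets (F (ennreal s))"
  shows "(LINT \<omega>:E|M. Y t \<omega>) = (LINT \<omega>:E|M. Y s \<omega>)"
proof -
  interpret finite_measure_subalgebra M "F (ennreal s)"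
    by unfold_locales (rule subalgebra_F)
  have "(LINT \<omega>:E|M. Y t \<omega>) = (LINT \<omega>:E|M. real_cond_exp M (F (ennreal s)) (Y t) \<omega>)"
    using Y st E by (intro real_cond_exp_intA) (auto simp: martingale_def)
  also have "\<dots> = (LINT \<omega>:E|M. Y s \<omega>)"
  proof -
    have "E \<in> sets M" using E sets_F_le by blast
    moreover have "Y s \<in> borel_measurable M" "real_cond_exp M (F (ennreal s)) (Y t) \<in> borel_measurable M"
      using Y st by (auto simp: martingale_def dest: borel_measurable_integrable)
    moreover have "AE \<omega> in M. real_cond_exp M (F (ennreal s)) (Y t) \<omega> = Y s \<omega>"
      using Y st by (auto simp: martingale_def)
    ultimately show ?thesis
      by (intro set_lebesgue_integral_cong_AE) (auto elim: eventually_mono)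
  qed
  finally show ?thesis .
qed

text \<open>This is the submartingale property of the absolute value. \<open>E\<close> is split by
  the sign of \<open>Y s\<close>; on each piece the signed integral is preserved, and at time
  \<open>t\<close> it is at most the integral of the modulus.\<close>

lemma martingale_set_integral_abs:
  assumes Y: "martingale M F Y" and st: "0 \<le> s" "s \<le> t" and E: "E \<in> sets (F (ennreal s))"
  shows "(LINT \<omega>:E|M. \<bar>Y s \<omega>\<bar>) \<le> (LINT \<omega>:E|M. \<bar>Y t \<omega>\<bar>)"
proof -
  define P where "P = E \<inter> {\<omega>\<in>space M. 0 \<le> Y s \<omega>}"
  define Q where "Q = E \<inter> {\<omega>\<in>space M. Y s \<omega> < 0}"
  have Ys: "Y s \<in> borel_measurable (F (ennreal s))"
    using Y st by (auto simp: martingale_def adapted_def)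
  have PQ: "P \<in> sets (F (ennreal s))" "Q \<in> sets (F (ennreal s))"
    unfolding P_def Q_def space_F[of "ennreal s", symmetric] using E Ys by measurable
  then have PQM: "P \<in> sets M" "Q \<in> sets M" "E \<in> sets M"
    using sets_F_le E by blast+
  have int: "integrable M (Y s)" "integrable M (Y t)"
    using Y st by (auto simp: martingale_def)
  have si: "set_integrable M S f" if "S \<in> sets M" "integrable M f" for S and f :: "'a \<Rightarrow> real"
    unfolding set_integrable_def using that integrable_mult_indicator by blast
  have dis: "P \<inter> Q = {}" and un: "P \<union> Q = E"
    using sets.sets_into_space[OF PQM(3)] by (auto simp: P_def Q_def)
  have "(LINT \<omega>:E|M. \<bar>Y s \<omega>\<bar>) = (LINT \<omega>:P|M. \<bar>Y s \<omega>\<bar>) + (LINT \<omega>:Q|M. \<bar>Y s \<omega>\<bar>)"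
    unfolding un[symmetric] using PQM int by (intro set_integral_Un dis si integrable_abs) auto
  also have "(LINT \<omega>:P|M. \<bar>Y s \<omega>\<bar>) = (LINT \<omega>:P|M. Y s \<omega>)"
    using PQM by (intro set_lebesgue_integral_cong) (auto simp: P_def)
  also have "(LINT \<omega>:Q|M. \<bar>Y s \<omega>\<bar>) = (LINT \<omega>:Q|M. - Y s \<omega>)"
    using PQM by (intro set_lebesgue_integral_cong) (auto simp: Q_def)
  also have "(LINT \<omega>:P|M. Y s \<omega>) = (LINT \<omega>:P|M. Y t \<omega>)"
    using martingale_set_integral[OF Y st PQ(1)] by simp
  also have "(LINT \<omega>:Q|M. - Y s \<omega>) = (LINT \<omega>:Q|M. - Y t \<omega>)"
    using martingale_set_integral[OF Y st PQ(2)] by (simp add: set_lebesgue_integral_def)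
  also have "(LINT \<omega>:P|M. Y t \<omega>) + (LINT \<omega>:Q|M. - Y t \<omega>) \<le> (LINT \<omega>:P|M. \<bar>Y t \<omega>\<bar>) + (LINT \<omega>:Q|M. \<bar>Y t \<omega>\<bar>)"
    using PQM int by (intro add_mono set_integral_mono si integrable_abs integrable_minus) auto
  also have "\<dots> = (LINT \<omega>:E|M. \<bar>Y t \<omega>\<bar>)"
    unfolding un[symmetric] using PQM int by (intro set_integral_Un[symmetric] dis si integrable_abs) auto
  finally show ?thesis .
qed

end

section \<open>Approximation of a random time from the right by grid times\<close>

definition grid_above :: "nat \<Rightarrow> real \<Rightarrow> real" where
  "grid_above k r = (real (nat \<lfloor>r * Suc k\<rfloor>) + 1) / Suc k"

lemma grid_above:
  assumes "0 \<le> r"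
  shows "r < grid_above k r" "grid_above k r \<le> r + 1 / Suc k"
proof -
  have "real (nat \<lfloor>r * Suc k\<rfloor>) = of_int \<lfloor>r * Suc k\<rfloor>"
    using assms by simp
  moreover have "r * Suc k < of_int \<lfloor>r * Suc k\<rfloor> + 1" "of_int \<lfloor>r * Suc k\<rfloor> \<le> r * Suc k"
    by linarith+
  ultimately show "r < grid_above k r" "grid_above k r \<le> r + 1 / Suc k"
    unfolding grid_above_def by (simp_all add: field_simps del: of_nat_Suc)
qed

lemma grid_above_at_right:
  assumes "0 \<le> r"
  shows "filterlim (\<lambda>k. grid_above k r) (at_right r) sequentially"
proof -
  have "(\<lambda>k. r + 1 / Suc k) \<longlonglongrightarrow> r"
    using LIMSEQ_inverse_real_of_nat_add[of r] by (simp add: inverse_eq_divide)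
  then have "(\<lambda>k. grid_above k r) \<longlonglongrightarrow> r"
    by (rule tendsto_sandwich[OF _ _ tendsto_const, rotated 2])
      (use grid_above[OF assms] in \<open>simp_all add: less_imp_le del: of_nat_Suc\<close>)
  then show ?thesis
    unfolding filterlim_at using grid_above(1)[OF assms] by (simp add: less_imp_neq[symmetric])
qed

text \<open>A version of \<open>Y\<close> evaluated at the random time \<open>R\<close> that is measurable even though the paths of \<open>Y\<close>
  are only almost surely right-continuous.\<close>

definition right_value :: "(real \<Rightarrow> 'a \<Rightarrow> real) \<Rightarrow> ('a \<Rightarrow> real) \<Rightarrow> 'a \<Rightarrow> real" where
  "right_value Y R \<omega> = lim (\<lambda>k. Y (grid_above k (R \<omega>)) \<omega>)"

lemma grid_value_measurable:
  assumes "\<And>t. 0 \<le> t \<Longrightarrow> Y t \<in> borel_measurable M" and [measurable]: "R \<in> borel_measurable M"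
  shows "(\<lambda>\<omega>. Y (grid_above k (R \<omega>)) \<omega>) \<in> borel_measurable M"
  unfolding grid_above_def
  by (rule measurable_compose_countable[where f="\<lambda>i. Y ((real i + 1) / Suc k)"])
    (auto intro!: assms(1) divide_nonneg_nonneg, measurable)

lemma right_value_measurable:
  assumes "\<And>t. 0 \<le> t \<Longrightarrow> Y t \<in> borel_measurable M" and "R \<in> borel_measurable M"
  shows "right_value Y R \<in> borel_measurable M"
  unfolding right_value_def[abs_def]
  using grid_value_measurable[of Y M R] assms by (intro borel_measurable_lim_metric) blast

lemma grid_value_tendsto:
  assumes "0 \<le> R \<omega>" "continuous (at_right (R \<omega>)) (\<lambda>t. Y t \<omega>)"
  shows "(\<lambda>k. Y (grid_above k (R \<omega>)) \<omega>) \<longlonglongrightarrow> Y (R \<omega>) \<omega>"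
  using assms(2) unfolding continuous_within
  by (rule filterlim_compose[OF _ grid_above_at_right[OF assms(1)]])

lemma right_value_eq:
  assumes "0 \<le> R \<omega>" "continuous (at_right (R \<omega>)) (\<lambda>t. Y t \<omega>)"
  shows "right_value Y R \<omega> = Y (R \<omega>) \<omega>"
  unfolding right_value_def by (rule limI, rule grid_value_tendsto[of R \<omega> Y]) (fact assms)+

subsection \<open>Optional stopping\<close>

context filtered_prob_space
begin

text \<open>A grid time has finitely many values, and on the cell where it equals \<open>t i\<close>
  the martingale property applies between \<open>t i\<close> and \<open>n + 1\<close>. The set
  \<open>D\<close> allows the same statement for all of \<open>B\<close> and for the part where the
  grid value is large.\<close>

lemma grid_decomposition:
  fixes k n :: nat
  assumes Y: "martingale M F Y"
    and R: "\<And>\<omega>. 0 \<le> R \<omega>" "\<And>\<omega>. R \<omega> \<le> real n"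
    and B: "pre_event F (\<lambda>\<omega>. ennreal (R \<omega>)) B"
    and D: "D \<in> sets borel"
  defines "G \<equiv> {\<omega>\<in>space M. B \<omega> \<and> Y (grid_above k (R \<omega>)) \<omega> \<in> D}"
  shows "integrable M (\<lambda>\<omega>. indicator G \<omega> * Y (grid_above k (R \<omega>)) \<omega>)"
    and "(\<integral>\<omega>. indicator G \<omega> * Y (grid_above k (R \<omega>)) \<omega> \<partial>M) = (\<integral>\<omega>. indicator G \<omega> * Y (real n + 1) \<omega> \<partial>M)"
    and "(\<integral>\<omega>. indicator G \<omega> * \<bar>Y (grid_above k (R \<omega>)) \<omega>\<bar> \<partial>M) \<le> (\<integral>\<omega>. indicator G \<omega> * \<bar>Y (real n + 1) \<omega>\<bar> \<partial>M)"
    and "G \<in> sets M"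
proof -
  define t where "t i = (real i + 1) / Suc k" for i
  define I where "I = {..n * Suc k}"
  define j where "j \<omega> = nat \<lfloor>R \<omega> * Suc k\<rfloor>" for \<omega>
  define E where "E i = {\<omega>\<in>space M. B \<omega> \<and> j \<omega> = i \<and> Y (t i) \<omega> \<in> D}" for i
  have grid: "grid_above k (R \<omega>) = t (j \<omega>)" for \<omega>
    by (simp add: grid_above_def t_def j_def)
  have j: "j \<omega> = i \<longleftrightarrow> real i / Suc k \<le> R \<omega> \<and> R \<omega> < t i" for \<omega> i
  proof -
    have "j \<omega> = i \<longleftrightarrow> \<lfloor>R \<omega> * Suc k\<rfloor> = int i"
      using R(1)[of \<omega>] unfolding j_def by (auto simp del: of_nat_Suc)
    also have "\<dots> \<longleftrightarrow> real i \<le> R \<omega> * Suc k \<and> R \<omega> * Suc k < real i + 1"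
      by (simp add: floor_eq_iff del: of_nat_Suc)
    also have "\<dots> \<longleftrightarrow> real i / Suc k \<le> R \<omega> \<and> R \<omega> < t i"
      unfolding t_def by (simp add: field_simps)
    finally show ?thesis .
  qed
  have jI: "j \<omega> \<in> I" for \<omega>
  proof -
    have "R \<omega> * Suc k \<le> real n * Suc k"
      using R(2)[of \<omega>] by (intro mult_right_mono) simp_all
    then have "R \<omega> * Suc k < of_int (int (n * Suc k) + 1)"
      by (simp add: algebra_simps)
    then have "\<lfloor>R \<omega> * Suc k\<rfloor> < int (n * Suc k) + 1"
      unfolding floor_less_iff .
    then show ?thesis
      unfolding j_def I_def atMost_iff nat_le_iff by simp
  qed
  have t: "0 \<le> t i" "t i \<le> real n + 1" if "i \<in> I" for i
  proof -
    have "real i \<le> real n * Suc k"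
      using that unfolding I_def by (metis atMost_iff of_nat_mono of_nat_mult)
    then show "0 \<le> t i" "t i \<le> real n + 1"
      unfolding t_def by (simp_all add: divide_le_eq algebra_simps)
  qed
  have EF: "E i \<in> sets (F (ennreal (t i)))" if "i \<in> I" for i
  proof -
    have [measurable]: "Y (t i) \<in> borel_measurable (F (ennreal (t i)))"
      using Y t[OF that] by (simp add: martingale_def adapted_def)
    have [measurable]: "Measurable.pred (F (ennreal (t i))) (\<lambda>\<omega>. B \<omega> \<and> ennreal (R \<omega>) < ennreal (t i))"
      by (rule pre_eventD[OF B])
    have [measurable]: "Measurable.pred (F (ennreal (t i))) (\<lambda>\<omega>. B \<omega> \<and> ennreal (R \<omega>) < ennreal (real i / Suc k))"
      by (rule pred_F_mono[OF _ pre_eventD[OF B]]) (simp add: t_def divide_right_mono ennreal_leI)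
    have [measurable]: "D \<in> sets borel" by (rule D)
    \<comment> \<open>The cell is a difference of two strict inequalities, both decided at time
      \<open>t i\<close>. The right end of the cell is the grid value because an optional time is
      known only just after it has occurred.\<close>
    have "E i = {\<omega>\<in>space (F (ennreal (t i))). (B \<omega> \<and> ennreal (R \<omega>) < ennreal (t i)) \<and>
        \<not> (B \<omega> \<and> ennreal (R \<omega>) < ennreal (real i / Suc k)) \<and> Y (t i) \<omega> \<in> D}"
      unfolding E_def j space_F using R(1) t(1)[OF that] by (auto simp: ennreal_less_iff not_less)
    also have "\<dots> \<in> sets (F (ennreal (t i)))" by measurable
    finally show ?thesis .
  qed
  have EM: "E i \<in> sets M" if "i \<in> I" for i
    using EF[OF that] sets_F_le by blast
  have dec: "indicator G \<omega> * f (j \<omega>) = (\<Sum>i\<in>I. indicator (E i) \<omega> * f i :: real)" if "\<omega> \<in> space M" for \<omega> f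
  proof -
    have "(\<Sum>i\<in>I. indicator (E i) \<omega> * f i) = (\<Sum>i\<in>{j \<omega>}. indicator (E i) \<omega> * f i)"
      using jI by (intro sum.mono_neutral_right) (auto simp: I_def E_def)
    also have "\<dots> = indicator G \<omega> * f (j \<omega>)"
      using that unfolding G_def E_def grid by (simp add: indicator_def)
    finally show ?thesis ..
  qed
  have dec1: "indicator G \<omega> * Y (t (j \<omega>)) \<omega> = (\<Sum>i\<in>I. indicator (E i) \<omega> * Y (t i) \<omega>)"
    and dec2: "indicator G \<omega> * \<bar>Y (t (j \<omega>)) \<omega>\<bar> = (\<Sum>i\<in>I. indicator (E i) \<omega> * \<bar>Y (t i) \<omega>\<bar>)"
    and dec3: "indicator G \<omega> * c = (\<Sum>i\<in>I. indicator (E i) \<omega> * c)" if "\<omega> \<in> space M" for \<omega> and c :: real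
    using dec[OF that, of "\<lambda>i. Y (t i) \<omega>"] dec[OF that, of "\<lambda>i. \<bar>Y (t i) \<omega>\<bar>"] dec[OF that, of "\<lambda>_. c"] .
  have int: "integrable M (Y (t i))" if "i \<in> I" for i
    using Y t[OF that] by (simp add: martingale_def)
  have intn: "integrable M (Y (real n + 1))"
    using Y by (simp add: martingale_def)
  have ind: "integrable M (\<lambda>\<omega>. indicator (E i) \<omega> * f \<omega>)" if "i \<in> I" "integrable M f" for i and f :: "'a \<Rightarrow> real"
    using integrable_mult_indicator[OF EM[OF that(1)] that(2)] by simp
  have "G = (\<Union>i\<in>I. E i)"
    unfolding G_def E_def grid using jI by auto
  then show "G \<in> sets M"
    using EM by (auto simp: I_def)
  have "integrable M (\<lambda>\<omega>. \<Sum>i\<in>I. indicator (E i) \<omega> * Y (t i) \<omega>)"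
    by (intro Bochner_Integration.integrable_sum ind int)
  then show "integrable M (\<lambda>\<omega>. indicator G \<omega> * Y (grid_above k (R \<omega>)) \<omega>)"
    unfolding grid using dec1 by (simp cong: Bochner_Integration.integrable_cong)
  have "(\<integral>\<omega>. indicator G \<omega> * Y (grid_above k (R \<omega>)) \<omega> \<partial>M) = (\<integral>\<omega>. (\<Sum>i\<in>I. indicator (E i) \<omega> * Y (t i) \<omega>) \<partial>M)"
    unfolding grid by (intro Bochner_Integration.integral_cong refl dec1)
  also have "\<dots> = (\<Sum>i\<in>I. \<integral>\<omega>. indicator (E i) \<omega> * Y (t i) \<omega> \<partial>M)"
    by (intro Bochner_Integration.integral_sum ind int)
  also have "\<dots> = (\<Sum>i\<in>I. \<integral>\<omega>. indicator (E i) \<omega> * Y (real n + 1) \<omega> \<partial>M)"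
    using martingale_set_integral[OF Y t EF] by (intro sum.cong refl) (simp add: set_lebesgue_integral_def)
  also have "\<dots> = (\<integral>\<omega>. (\<Sum>i\<in>I. indicator (E i) \<omega> * Y (real n + 1) \<omega>) \<partial>M)"
    by (intro Bochner_Integration.integral_sum[symmetric] ind intn)
  also have "\<dots> = (\<integral>\<omega>. indicator G \<omega> * Y (real n + 1) \<omega> \<partial>M)"
    by (intro Bochner_Integration.integral_cong refl dec3[symmetric])
  finally show "(\<integral>\<omega>. indicator G \<omega> * Y (grid_above k (R \<omega>)) \<omega> \<partial>M) = (\<integral>\<omega>. indicator G \<omega> * Y (real n + 1) \<omega> \<partial>M)" .
  have "(\<integral>\<omega>. indicator G \<omega> * \<bar>Y (grid_above k (R \<omega>)) \<omega>\<bar> \<partial>M) = (\<integral>\<omega>. (\<Sum>i\<in>I. indicator (E i) \<omega> * \<bar>Y (t i) \<omega>\<bar>) \<partial>M)"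
    unfolding grid by (intro Bochner_Integration.integral_cong refl dec2)
  also have "\<dots> = (\<Sum>i\<in>I. \<integral>\<omega>. indicator (E i) \<omega> * \<bar>Y (t i) \<omega>\<bar> \<partial>M)"
    by (intro Bochner_Integration.integral_sum ind int integrable_abs)
  also have "\<dots> \<le> (\<Sum>i\<in>I. \<integral>\<omega>. indicator (E i) \<omega> * \<bar>Y (real n + 1) \<omega>\<bar> \<partial>M)"
    using martingale_set_integral_abs[OF Y t EF] by (intro sum_mono) (simp add: set_lebesgue_integral_def)
  also have "\<dots> = (\<integral>\<omega>. (\<Sum>i\<in>I. indicator (E i) \<omega> * \<bar>Y (real n + 1) \<omega>\<bar>) \<partial>M)"
    by (intro Bochner_Integration.integral_sum[symmetric] ind intn integrable_abs)
  also have "\<dots> = (\<integral>\<omega>. indicator G \<omega> * \<bar>Y (real n + 1) \<omega>\<bar> \<partial>M)"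
    by (intro Bochner_Integration.integral_cong refl dec3[symmetric])
  finally show "(\<integral>\<omega>. indicator G \<omega> * \<bar>Y (grid_above k (R \<omega>)) \<omega>\<bar> \<partial>M) \<le> (\<integral>\<omega>. indicator G \<omega> * \<bar>Y (real n + 1) \<omega>\<bar> \<partial>M)" .
qed

text \<open>The grid times decrease to \<open>R\<close>.  Since the limit is bounded by \<open>C\<close>, the part of the approximations
  exceeding \<open>C + 1\<close> is negligible by the submartingale property of \<open>\<bar>Y\<bar>\<close>, so no uniform integrability is needed.\<close>

lemma optional_stopping_bounded:
  fixes n :: nat
  assumes Y: "martingale M F Y"
    and Rm: "R \<in> borel_measurable M"
    and R: "\<And>\<omega>. 0 \<le> R \<omega>" "\<And>\<omega>. R \<omega> \<le> real n"
    and B: "pre_event F (\<lambda>\<omega>. ennreal (R \<omega>)) B"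
    and cont: "AE \<omega> in M. B \<omega> \<longrightarrow> continuous (at_right (R \<omega>)) (\<lambda>t. Y t \<omega>)"
    and bound: "AE \<omega> in M. B \<omega> \<longrightarrow> \<bar>Y (R \<omega>) \<omega>\<bar> \<le> C"
  shows "(\<integral>\<omega>. indicator {\<omega>\<in>space M. B \<omega>} \<omega> * right_value Y R \<omega> \<partial>M) =
    (\<integral>\<omega>. indicator {\<omega>\<in>space M. B \<omega>} \<omega> * Y (real n + 1) \<omega> \<partial>M)"
proof -
  define B' where "B' = {\<omega>\<in>space M. B \<omega>}"
  define y where "y k \<omega> = Y (grid_above k (R \<omega>)) \<omega>" for k \<omega>
  \<comment> \<open>The margin 1 makes every path leave \<open>H k\<close> for good, since on
    \<open>B\<close> the limit of the grid values has modulus at most \<open>C\<close>.\<close>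
  define H where "H k = {\<omega>\<in>space M. B \<omega> \<and> y k \<omega> \<in> {x. C + 1 < \<bar>x\<bar>}}" for k
  note dec = grid_decomposition[OF Y R B]
  have B'M [measurable]: "B' \<in> sets M"
    using dec(4)[of UNIV] by (simp add: B'_def)
  have D: "{x::real. C + 1 < \<bar>x\<bar>} \<in> sets borel" by measurable
  have HM [measurable]: "H k \<in> sets M" for k
    using dec(4)[OF D] by (simp add: H_def y_def)
  have Ym: "Y t \<in> borel_measurable M" if "0 \<le> t" for t
    using Y that by (auto simp: martingale_def)
  have ym [measurable]: "y k \<in> borel_measurable M" for k
    unfolding y_def[abs_def] by (rule grid_value_measurable[OF Ym Rm])
  have rm [measurable]: "right_value Y R \<in> borel_measurable M"
    by (rule right_value_measurable[OF Ym Rm])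
  have intn: "integrable M (Y (real n + 1))"
    using Y by (simp add: martingale_def)
  have [measurable]: "Y (real n + 1) \<in> borel_measurable M" by (rule Ym) simp
  have inty: "integrable M (\<lambda>\<omega>. indicator B' \<omega> * y k \<omega>)" for k
    using dec(1)[of UNIV] by (simp add: B'_def y_def)
  have eqy: "(\<integral>\<omega>. indicator B' \<omega> * y k \<omega> \<partial>M) = (\<integral>\<omega>. indicator B' \<omega> * Y (real n + 1) \<omega> \<partial>M)" for k
    using dec(2)[of UNIV] by (simp add: B'_def y_def)
  have lim: "AE \<omega> in M. \<omega> \<in> B' \<longrightarrow> (\<lambda>k. y k \<omega>) \<longlonglongrightarrow> right_value Y R \<omega> \<and> \<bar>right_value Y R \<omega>\<bar> \<le> C"
    using cont bound
  proof eventually_elim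
    case (elim \<omega>)
    then show ?case
      using grid_value_tendsto[of R \<omega> Y] right_value_eq[of R \<omega> Y] R(1)[of \<omega>]
      by (auto simp: y_def B'_def)
  qed
  have small: "AE \<omega> in M. \<forall>\<^sub>F k in sequentially. \<omega> \<notin> H k"
    using lim
  proof eventually_elim
    case (elim \<omega>)
    show ?case
    proof (cases "\<omega> \<in> B'")
      case True
      with elim have l: "(\<lambda>k. \<bar>y k \<omega>\<bar>) \<longlonglongrightarrow> \<bar>right_value Y R \<omega>\<bar>" "\<bar>right_value Y R \<omega>\<bar> < C + 1"
        by (auto intro: tendsto_rabs)
      from order_tendstoD(2)[OF this] show ?thesis
        by eventually_elim (simp add: H_def)
    next
      case False
      then show ?thesis by (auto simp: H_def B'_def)
    qed
  qed
  have 1: "(\<lambda>k. \<integral>\<omega>. indicator (B' - H k) \<omega> * y k \<omega> \<partial>M) \<longlonglongrightarrow> (\<integral>\<omega>. indicator B' \<omega> * right_value Y R \<omega> \<partial>M)"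
  proof (rule integral_dominated_convergence[where w="\<lambda>_. \<bar>C + 1\<bar>"])
    show "AE \<omega> in M. (\<lambda>k. indicator (B' - H k) \<omega> * y k \<omega>) \<longlonglongrightarrow> indicator B' \<omega> * right_value Y R \<omega>"
      using lim small
    proof eventually_elim
      case (elim \<omega>)
      show ?case
      proof (cases "\<omega> \<in> B'")
        case True
        with elim(1) have "(\<lambda>k. y k \<omega>) \<longlonglongrightarrow> indicator B' \<omega> * right_value Y R \<omega>" by simp
        then show ?thesis
          by (rule Lim_transform_eventually) (use elim(2) True in \<open>auto elim!: eventually_mono\<close>)
      qed simp
    qed
    show "AE \<omega> in M. norm (indicator (B' - H k) \<omega> * y k \<omega>) \<le> \<bar>C + 1\<bar>" for k
      by (auto simp: indicator_def H_def B'_def)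
  qed simp_all
  have 2: "(\<lambda>k. \<integral>\<omega>. indicator (H k) \<omega> * \<bar>Y (real n + 1) \<omega>\<bar> \<partial>M) \<longlonglongrightarrow> (\<integral>\<omega>. 0 \<partial>M)"
  proof (rule integral_dominated_convergence[where w="\<lambda>\<omega>. \<bar>Y (real n + 1) \<omega>\<bar>"])
    show "AE \<omega> in M. (\<lambda>k. indicator (H k) \<omega> * \<bar>Y (real n + 1) \<omega>\<bar>) \<longlonglongrightarrow> 0"
      using small
    proof eventually_elim
      case (elim \<omega>)
      show ?case
        by (rule tendsto_eventually) (use elim in \<open>auto elim!: eventually_mono\<close>)
    qed
  qed (use intn in \<open>auto simp: indicator_def\<close>)
  have split: "(\<integral>\<omega>. indicator B' \<omega> * Y (real n + 1) \<omega> \<partial>M) - (\<integral>\<omega>. indicator (B' - H k) \<omega> * y k \<omega> \<partial>M)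
      = (\<integral>\<omega>. indicator (H k) \<omega> * y k \<omega> \<partial>M)" for k
  proof -
    have "indicator (B' - H k) \<omega> * y k \<omega> = indicator B' \<omega> * y k \<omega> - indicator (H k) \<omega> * y k \<omega>" for \<omega>
      by (auto simp: indicator_def H_def B'_def)
    then show ?thesis
      using inty[of k] dec(1)[OF D] eqy[of k] by (simp add: H_def y_def)
  qed
  have 3: "(\<lambda>k. \<integral>\<omega>. indicator (H k) \<omega> * y k \<omega> \<partial>M) \<longlonglongrightarrow> 0"
  proof (rule Lim_null_comparison)
    show "(\<lambda>k. \<integral>\<omega>. indicator (H k) \<omega> * \<bar>Y (real n + 1) \<omega>\<bar> \<partial>M) \<longlonglongrightarrow> 0" using 2 by simp
    have "norm (\<integral>\<omega>. indicator (H k) \<omega> * y k \<omega> \<partial>M) \<le> (\<integral>\<omega>. indicator (H k) \<omega> * \<bar>Y (real n + 1) \<omega>\<bar> \<partial>M)" for k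
    proof -
      have "norm (\<integral>\<omega>. indicator (H k) \<omega> * y k \<omega> \<partial>M) \<le> (\<integral>\<omega>. norm (indicator (H k) \<omega> * y k \<omega>) \<partial>M)"
        by (rule integral_norm_bound)
      also have "\<dots> = (\<integral>\<omega>. indicator (H k) \<omega> * \<bar>y k \<omega>\<bar> \<partial>M)"
        by (simp add: abs_mult)
      also have "\<dots> \<le> (\<integral>\<omega>. indicator (H k) \<omega> * \<bar>Y (real n + 1) \<omega>\<bar> \<partial>M)"
        using dec(3)[OF D] by (simp add: H_def y_def)
      finally show ?thesis .
    qed
    then show "\<forall>\<^sub>F k in sequentially. norm (\<integral>\<omega>. indicator (H k) \<omega> * y k \<omega> \<partial>M)
        \<le> (\<integral>\<omega>. indicator (H k) \<omega> * \<bar>Y (real n + 1) \<omega>\<bar> \<partial>M)" by simp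
  qed
  have "(\<lambda>k. (\<integral>\<omega>. indicator B' \<omega> * Y (real n + 1) \<omega> \<partial>M) - (\<integral>\<omega>. indicator (B' - H k) \<omega> * y k \<omega> \<partial>M)) \<longlonglongrightarrow>
      (\<integral>\<omega>. indicator B' \<omega> * Y (real n + 1) \<omega> \<partial>M) - (\<integral>\<omega>. indicator B' \<omega> * right_value Y R \<omega> \<partial>M)"
    by (intro tendsto_intros 1)
  with 3 show ?thesis
    unfolding split B'_def[symmetric] using LIMSEQ_unique by fastforce
qed

end

section \<open>Optional stopping for local martingales between two times\<close>

lemma stopped_at: "stopped N \<sigma> t \<omega> = N (enn2real (min (ennreal t) (\<sigma> \<omega>))) \<omega>"
  by (simp add: stopped_def value_at_def)

lemma stopped_right_continuous:
  assumes cont: "\<And>t. 0 \<le> t \<Longrightarrow> continuous (at_right t) (\<lambda>t. N t \<omega>)" and "0 \<le> t"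
  shows "continuous (at_right t) (\<lambda>t. stopped N \<sigma> t \<omega>)"
proof (cases "ennreal t < \<sigma> \<omega>")
  case True
  then obtain q where q: "0 \<le> q" "ennreal t < ennreal q" "ennreal q < \<sigma> \<omega>"
    by (rule ennreal_Rats_dense)
  have eq: "stopped N \<sigma> u \<omega> = N u \<omega>" if "t \<le> u" "u < q" for u
  proof -
    have "ennreal u \<le> \<sigma> \<omega>"
      using that q by (intro order_trans[OF ennreal_leI[of u q]] less_imp_le) auto
    then show ?thesis
      using that \<open>0 \<le> t\<close> by (simp add: stopped_at min_absorb1)
  qed
  have "t < q" using q(2) by (simp add: ennreal_less_iff \<open>0 \<le> t\<close>)
  then have ev: "\<forall>\<^sub>F u in at_right t. u \<in> {t<..<q}"
    by (rule eventually_at_right_real)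
  have "((\<lambda>u. N u \<omega>) \<longlongrightarrow> N t \<omega>) (at_right t)"
    using cont[OF \<open>0 \<le> t\<close>] by (simp add: continuous_within)
  then have "((\<lambda>u. stopped N \<sigma> u \<omega>) \<longlongrightarrow> N t \<omega>) (at_right t)"
    by (rule Lim_transform_eventually) (use ev in \<open>auto elim!: eventually_mono simp: eq\<close>)
  then show ?thesis
    using eq[of t] \<open>t < q\<close> by (simp add: continuous_within)
next
  case False
  have eq: "stopped N \<sigma> u \<omega> = stopped N \<sigma> t \<omega>" if "t \<le> u" for u
  proof -
    have "\<sigma> \<omega> \<le> ennreal t" "\<sigma> \<omega> \<le> ennreal u"
      using False ennreal_leI[OF that] by auto
    then show ?thesis by (simp add: stopped_at min_absorb2)
  qed
  have "\<forall>\<^sub>F u in at_right t. stopped N \<sigma> t \<omega> = stopped N \<sigma> u \<omega>"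
    using eventually_at_right_less[of t] by (rule eventually_mono) (rule eq[symmetric, OF less_imp_le])
  then show ?thesis
    unfolding continuous_within by (rule Lim_transform_eventually[OF tendsto_const])
qed

context filtered_prob_space
begin

text \<open>For a stopped martingale both times, truncated at \<open>m\<close>, lead to the value at
  \<open>m + 1\<close>, hence to each other. The bound makes it possible to let \<open>m\<close>
  tend to infinity by dominated convergence; it is asked on \<open>B\<close> and between the two
  times only, so \<open>N\<close> may be wild before \<rho>.\<close>

lemma local_martingale_optional_stopping:
  assumes N: "local_martingale M F N"
    and cont: "AE \<omega> in M. \<forall>t\<ge>0. continuous (at_right t) (\<lambda>t. N t \<omega>)"
    and \<rho>: "optional_time F \<rho>" and R: "optional_time F R"
    and B: "pre_event F \<rho> B" and le: "\<And>\<omega>. B \<omega> \<Longrightarrow> \<rho> \<omega> \<le> R \<omega>"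
    and fin: "AE \<omega> in M. B \<omega> \<longrightarrow> R \<omega> < \<infinity>"
    and bound: "AE \<omega> in M. B \<omega> \<longrightarrow> (\<forall>t\<ge>0. \<rho> \<omega> \<le> ennreal t \<and> ennreal t \<le> R \<omega> \<longrightarrow> \<bar>N t \<omega>\<bar> \<le> C)"
    and BM [measurable]: "Measurable.pred M B"
  shows "(\<integral>\<omega>. indicator {\<omega>\<in>space M. B \<omega>} \<omega> * right_value N (\<lambda>\<omega>. enn2real (R \<omega>)) \<omega> \<partial>M) =
    (\<integral>\<omega>. indicator {\<omega>\<in>space M. B \<omega>} \<omega> * right_value N (\<lambda>\<omega>. enn2real (\<rho> \<omega>)) \<omega> \<partial>M)" (is "?I R = ?I \<rho>")
proof -
  obtain \<sigma> where \<sigma>: "localizing_sequence M F \<sigma>" "\<And>m. martingale M F (stopped N (\<sigma> m))"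
    using N by (auto simp: local_martingale_def)
  have \<sigma>opt: "optional_time F (\<sigma> m)" for m
    using \<sigma>(1) by (auto simp: localizing_sequence_def intro: stopping_imp_optional)
  have [measurable]: "\<sigma> m \<in> borel_measurable M" "\<rho> \<in> borel_measurable M" "R \<in> borel_measurable M" for m
    using optional_time_measurable \<sigma>opt \<rho> R by blast+
  have Nm: "N t \<in> borel_measurable M" if "0 \<le> t" for t
    using N that by (auto simp: local_martingale_def adapted_def intro: measurable_F_M)
  have Ym: "stopped N (\<sigma> m) t \<in> borel_measurable M" if "0 \<le> t" for t m
    using \<sigma>(2)[of m] that by (auto simp: martingale_def)
  \<comment> \<open>With \<rho> below both \<open>\<sigma> m\<close> and \<open>m\<close>,
    truncating and stopping keep the evaluation time between \<rho> and \<open>R\<close>, where the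
    bound \<open>C\<close> holds.\<close>
  define B' where "B' m \<omega> \<longleftrightarrow> (B \<omega> \<and> \<rho> \<omega> < \<sigma> m \<omega>) \<and> \<rho> \<omega> < ennreal (real m)" for m :: nat and \<omega>
  have [measurable]: "Measurable.pred M (B' m)" for m
    unfolding B'_def by measurable
  have B': "pre_event F \<rho> (B' m)" for m
    unfolding B'_def by (intro pre_event_less B \<sigma>opt optional_time_const)
  define T where "T m Q \<omega> = enn2real (min (Q \<omega>) (ennreal (real m)))" for m :: nat and Q :: "'a \<Rightarrow> ennreal" and \<omega>
  have T: "ennreal (T m Q \<omega>) = min (Q \<omega>) (ennreal (real m))" for m Q \<omega>
    unfolding T_def by (intro ennreal_enn2real) (simp add: min_less_iff_disj)
  have T0: "0 \<le> T m Q \<omega>" "T m Q \<omega> \<le> real m" for m Q \<omega>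
    unfolding T_def by (simp, intro enn2real_leI) auto
  have Tm [measurable]: "T m Q \<in> borel_measurable M" if [measurable]: "Q \<in> borel_measurable M" for m Q
    unfolding T_def[abs_def] by measurable
  \<comment> \<open>The right-hand side does not mention \<open>Q\<close>; the lemma results from
    taking \<open>R\<close> and \<rho> for \<open>Q\<close>.\<close>
  have step: "(\<integral>\<omega>. indicator {\<omega>\<in>space M. B' m \<omega>} \<omega> * right_value (stopped N (\<sigma> m)) (T m Q) \<omega> \<partial>M) =
      (\<integral>\<omega>. indicator {\<omega>\<in>space M. B' m \<omega>} \<omega> * stopped N (\<sigma> m) (real m + 1) \<omega> \<partial>M)"
    if Q: "optional_time F Q" and ge: "\<And>\<omega>. B \<omega> \<Longrightarrow> \<rho> \<omega> \<le> Q \<omega>" and leR: "\<And>\<omega>. B \<omega> \<Longrightarrow> Q \<omega> \<le> R \<omega>" for m Q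
  proof (rule optional_stopping_bounded[OF \<sigma>(2), where C=C])
    show "T m Q \<in> borel_measurable M"
      using optional_time_measurable[OF Q] by measurable
    show "pre_event F (\<lambda>\<omega>. ennreal (T m Q \<omega>)) (B' m)"
      unfolding T using ge
      by (intro pre_event_mono[OF B'] optional_time_min Q optional_time_const) (auto simp: B'_def)
    show "AE \<omega> in M. B' m \<omega> \<longrightarrow> continuous (at_right (T m Q \<omega>)) (\<lambda>t. stopped N (\<sigma> m) t \<omega>)"
      using cont by eventually_elim (auto intro!: stopped_right_continuous T0)
    show "AE \<omega> in M. B' m \<omega> \<longrightarrow> \<bar>stopped N (\<sigma> m) (T m Q \<omega>) \<omega>\<bar> \<le> C"
      using bound
    proof eventually_elim
      case (elim \<omega>)
      show ?case
      proof
        assume b: "B' m \<omega>"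
        define s where "s = enn2real (min (min (Q \<omega>) (ennreal (real m))) (\<sigma> m \<omega>))"
        have s: "ennreal s = min (min (Q \<omega>) (ennreal (real m))) (\<sigma> m \<omega>)"
          unfolding s_def by (intro ennreal_enn2real) (simp add: min_less_iff_disj)
        have "\<rho> \<omega> \<le> ennreal s" "ennreal s \<le> R \<omega>" "0 \<le> s"
          using b ge[of \<omega>] leR[of \<omega>] unfolding s by (auto simp: B'_def min_le_iff_disj s_def)
        then have "\<bar>N s \<omega>\<bar> \<le> C" using elim b by (auto simp: B'_def)
        then show "\<bar>stopped N (\<sigma> m) (T m Q \<omega>) \<omega>\<bar> \<le> C"
          unfolding stopped_at T s_def .
      qed
    qed
  qed (auto intro: T0)
  have lim: "(\<lambda>m. \<integral>\<omega>. indicator {\<omega>\<in>space M. B' m \<omega>} \<omega> * right_value (stopped N (\<sigma> m)) (T m Q) \<omega> \<partial>M) \<longlonglongrightarrow> ?I Q"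
    if Q: "optional_time F Q" and ge: "\<And>\<omega>. B \<omega> \<Longrightarrow> \<rho> \<omega> \<le> Q \<omega>" and leR: "\<And>\<omega>. B \<omega> \<Longrightarrow> Q \<omega> \<le> R \<omega>" for Q
  proof (rule integral_dominated_convergence[where w="\<lambda>_. \<bar>C\<bar>"])
    have [measurable]: "Q \<in> borel_measurable M" by (rule optional_time_measurable[OF Q])
    have [measurable]: "right_value N (\<lambda>\<omega>. enn2real (Q \<omega>)) \<in> borel_measurable M"
      by (rule right_value_measurable[OF Nm]) measurable
    show "(\<lambda>\<omega>. indicator {\<omega>\<in>space M. B \<omega>} \<omega> * right_value N (\<lambda>\<omega>. enn2real (Q \<omega>)) \<omega>) \<in> borel_measurable M"
      by measurable
    have [measurable]: "right_value (stopped N (\<sigma> m)) (T m Q) \<in> borel_measurable M" for m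
      by (rule right_value_measurable[OF Ym]) measurable
    show "(\<lambda>\<omega>. indicator {\<omega>\<in>space M. B' m \<omega>} \<omega> * right_value (stopped N (\<sigma> m)) (T m Q) \<omega>) \<in> borel_measurable M" for m
      by measurable
    have val: "AE \<omega> in M. B' m \<omega> \<longrightarrow> right_value (stopped N (\<sigma> m)) (T m Q) \<omega> = stopped N (\<sigma> m) (T m Q \<omega>) \<omega>" for m
      using cont by eventually_elim (auto intro!: stopped_right_continuous right_value_eq T0)
    show "AE \<omega> in M. norm (indicator {\<omega>\<in>space M. B' m \<omega>} \<omega> * right_value (stopped N (\<sigma> m)) (T m Q) \<omega>) \<le> \<bar>C\<bar>" for m
      using val[of m] bound
    proof eventually_elim
      case (elim \<omega>)
      show ?case
      proof (cases "B' m \<omega>")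
        case b: True
        define s where "s = enn2real (min (min (Q \<omega>) (ennreal (real m))) (\<sigma> m \<omega>))"
        have s: "ennreal s = min (min (Q \<omega>) (ennreal (real m))) (\<sigma> m \<omega>)"
          unfolding s_def by (intro ennreal_enn2real) (simp add: min_less_iff_disj)
        have "\<rho> \<omega> \<le> ennreal s" "ennreal s \<le> R \<omega>" "0 \<le> s"
          using b ge[of \<omega>] leR[of \<omega>] unfolding s by (auto simp: B'_def min_le_iff_disj s_def)
        then have "\<bar>N s \<omega>\<bar> \<le> C" using elim b by (auto simp: B'_def)
        then have "\<bar>stopped N (\<sigma> m) (T m Q \<omega>) \<omega>\<bar> \<le> C"
          unfolding stopped_at T s_def .
        then show ?thesis
          using elim(1) b by (auto simp: indicator_def)
      qed simp
    qed
    have "AE \<omega> in M. (\<lambda>m. \<sigma> m \<omega>) \<longlonglongrightarrow> \<infinity>"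
      using \<sigma>(1) by (auto simp: localizing_sequence_def)
    moreover have "AE \<omega> in M. \<forall>m. B' m \<omega> \<longrightarrow> right_value (stopped N (\<sigma> m)) (T m Q) \<omega> = stopped N (\<sigma> m) (T m Q \<omega>) \<omega>"
      using val by (simp add: AE_all_countable)
    ultimately show "AE \<omega> in M. (\<lambda>m. indicator {\<omega>\<in>space M. B' m \<omega>} \<omega> * right_value (stopped N (\<sigma> m)) (T m Q) \<omega>)
        \<longlonglongrightarrow> indicator {\<omega>\<in>space M. B \<omega>} \<omega> * right_value N (\<lambda>\<omega>. enn2real (Q \<omega>)) \<omega>"
      using fin cont
    proof eventually_elim
      case (elim \<omega>)
      show ?case
      proof (cases "\<omega> \<in> space M \<and> B \<omega>")
        case True
        then have f: "Q \<omega> < \<infinity>" using elim(3) leR[of \<omega>] by (auto intro: le_less_trans)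
        then obtain r where r: "Q \<omega> = ennreal r" "0 \<le> r" by (cases "Q \<omega>") auto
        have "\<forall>\<^sub>F m in sequentially. Q \<omega> < \<sigma> m \<omega>"
          using order_tendstoD(1)[OF elim(1) f] .
        moreover have "\<forall>\<^sub>F m in sequentially. r < real m"
          using filterlim_real_sequentially by (simp add: filterlim_at_top_dense)
        ultimately have "\<forall>\<^sub>F m in sequentially. indicator {\<omega>\<in>space M. B \<omega>} \<omega> * right_value N (\<lambda>\<omega>. enn2real (Q \<omega>)) \<omega> =
          indicator {\<omega>\<in>space M. B' m \<omega>} \<omega> * right_value (stopped N (\<sigma> m)) (T m Q) \<omega>"
        proof eventually_elim
          case m: (elim m)
          then have Qm: "Q \<omega> < ennreal (real m)" using r by (simp add: ennreal_lessI)
          then have "B' m \<omega>"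
            using True ge[of \<omega>] m by (auto simp: B'_def intro: le_less_trans)
          moreover have "right_value N (\<lambda>\<omega>. enn2real (Q \<omega>)) \<omega> = N (enn2real (Q \<omega>)) \<omega>"
            using elim(4) by (intro right_value_eq) auto
          moreover have "stopped N (\<sigma> m) (T m Q \<omega>) \<omega> = N (enn2real (Q \<omega>)) \<omega>"
            unfolding stopped_at T using m Qm by (simp add: min_absorb1)
          ultimately show ?case
            using elim(2) True by simp
        qed
        then show ?thesis
          by (rule Lim_transform_eventually[OF tendsto_const])
      next
        case False
        then show ?thesis by (auto simp: B'_def indicator_def)
      qed
    qed
  qed simp
  have eq: "(\<integral>\<omega>. indicator {\<omega>\<in>space M. B' m \<omega>} \<omega> * right_value (stopped N (\<sigma> m)) (T m R) \<omega> \<partial>M) =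
      (\<integral>\<omega>. indicator {\<omega>\<in>space M. B' m \<omega>} \<omega> * right_value (stopped N (\<sigma> m)) (T m \<rho>) \<omega> \<partial>M)" for m
    by (rule trans[OF step[OF R] step[OF \<rho>, symmetric]]) (auto intro: le)
  show ?thesis
  proof (rule LIMSEQ_unique)
    show "(\<lambda>m. \<integral>\<omega>. indicator {\<omega>\<in>space M. B' m \<omega>} \<omega> * right_value (stopped N (\<sigma> m)) (T m R) \<omega> \<partial>M) \<longlonglongrightarrow> ?I R"
      by (rule lim[OF R]) (auto intro: le)
    show "(\<lambda>m. \<integral>\<omega>. indicator {\<omega>\<in>space M. B' m \<omega>} \<omega> * right_value (stopped N (\<sigma> m)) (T m R) \<omega> \<partial>M) \<longlonglongrightarrow> ?I \<rho>"
      unfolding eq by (rule lim[OF \<rho>]) (auto intro: le)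
  qed
qed

end

subsection \<open>Paths of class Sigma\<close>

definition level_time :: "(real \<Rightarrow> real) \<Rightarrow> real \<Rightarrow> ennreal" where
  "level_time a u = Inf {ennreal q |q. q \<in> \<rat> \<and> 0 \<le> q \<and> u < a q}"

text \<open>The slack turns the condition \<psi>(x) \<le> a at a real time into a strict inequality,
  which right-continuity carries over to rational times just after it.\<close>

definition approx_time :: "(real \<Rightarrow> ennreal) \<Rightarrow> (real \<Rightarrow> real) \<Rightarrow> (real \<Rightarrow> real) \<Rightarrow> nat \<Rightarrow> ennreal" where
  "approx_time \<psi> x a n = Inf {ennreal q |q. q \<in> \<rat> \<and> 0 \<le> q \<and> \<psi> (x q) \<le> ennreal (a q + 1 / Suc n)}"

definition announced_time :: "(real \<Rightarrow> ennreal) \<Rightarrow> (real \<Rightarrow> real) \<Rightarrow> (real \<Rightarrow> real) \<Rightarrow> ennreal" where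
  "announced_time \<psi> x a = (SUP n. approx_time \<psi> x a n)"

lemma level_time_mono: "u \<le> v \<Longrightarrow> level_time a u \<le> level_time a v"
  unfolding level_time_def by (rule Inf_superset_mono) auto

lemma approx_time_mono: "m \<le> n \<Longrightarrow> approx_time \<psi> x a m \<le> approx_time \<psi> x a n"
  unfolding approx_time_def
proof (rule Inf_superset_mono, clarify)
  fix q assume "m \<le> n" "\<psi> (x q) \<le> ennreal (a q + 1 / real (Suc n))" and q: "q \<in> \<rat>" "0 \<le> q"
  then have "ennreal (a q + 1 / real (Suc n)) \<le> ennreal (a q + 1 / real (Suc m))"
    by (intro ennreal_leI add_left_mono divide_left_mono) simp_all
  with \<open>\<psi> (x q) \<le> _\<close> have "\<psi> (x q) \<le> ennreal (a q + 1 / real (Suc m))" by (rule order_trans)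
  with q show "\<exists>q'. ennreal q = ennreal q' \<and> q' \<in> \<rat> \<and> 0 \<le> q' \<and> \<psi> (x q') \<le> ennreal (a q' + 1 / real (Suc m))"
    by blast
qed

lemma approx_time_le: "approx_time \<psi> x a n \<le> announced_time \<psi> x a"
  unfolding announced_time_def by (rule SUP_upper) simp

text \<open>The function \<psi> is abstract here: the path argument rests on its continuity, its
  monotonicity and its positivity at 0. The sign of the jumps is encoded in
  \<open>x_left\<close>.\<close>

locale sigma_path =
  fixes x a :: "real \<Rightarrow> real" and \<psi> :: "real \<Rightarrow> ennreal"
  assumes x_nonneg: "\<And>t. 0 \<le> t \<Longrightarrow> 0 \<le> x t"
    and x_right: "\<And>t. 0 \<le> t \<Longrightarrow> continuous (at_right t) x"
    and x_left: "\<And>t. 0 < t \<Longrightarrow> \<exists>l. (x \<longlongrightarrow> l) (at_left t) \<and> x t \<le> l"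
    and x_0: "x 0 = 0"
    and a_cont: "continuous_on {0..} a"
    and a_mono: "\<And>s t. 0 \<le> s \<Longrightarrow> s \<le> t \<Longrightarrow> a s \<le> a t"
    and a_0: "a 0 = 0"
    and a_top: "filterlim a at_top at_top"
    and carried: "AE t in interval_measure (\<lambda>t. a (max 0 t)). 0 \<le> t \<longrightarrow> x t = 0"
    and \<psi>_cont: "continuous_on UNIV \<psi>"
    and \<psi>_anti: "\<And>y z. y \<le> z \<Longrightarrow> \<psi> z \<le> \<psi> y"
    and \<psi>_0: "0 < \<psi> 0"
begin

abbreviation "S n \<equiv> approx_time \<psi> x a n"
abbreviation "\<sigma> \<equiv> announced_time \<psi> x a"
abbreviation "\<tau> u \<equiv> level_time a u"

lemma a_nonneg: "0 \<le> t \<Longrightarrow> 0 \<le> a t"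
  using a_mono[of 0 t] a_0 by simp

lemma a_right: "0 \<le> t \<Longrightarrow> (a \<longlongrightarrow> a t) (at_right t)"
  using a_cont unfolding continuous_on_def
  by (auto intro: tendsto_within_subset[of _ _ _ "{0..}"])

lemma a_left: "0 < t \<Longrightarrow> (a \<longlongrightarrow> a t) (at_left t)"
proof -
  assume "0 < t"
  have "continuous_on {0<..} a" by (rule continuous_on_subset[OF a_cont]) auto
  then have "isCont a t" using \<open>0 < t\<close> by (simp add: continuous_on_eq_continuous_at)
  then show ?thesis by (auto simp: isCont_def intro: tendsto_within_subset)
qed

lemma \<psi>_tendsto: "(f \<longlongrightarrow> l) G \<Longrightarrow> ((\<lambda>r. \<psi> (f r)) \<longlongrightarrow> \<psi> l) G"
  using \<psi>_cont by (rule continuous_on_tendsto_compose) auto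

lemma \<psi>x_right: "0 \<le> t \<Longrightarrow> ((\<lambda>r. \<psi> (x r)) \<longlongrightarrow> \<psi> (x t)) (at_right t)"
  using x_right[of t] by (intro \<psi>_tendsto) (simp add: continuous_within)

lemma Rats_between:
  fixes s t :: real
  assumes "s < t" obtains q where "q \<in> \<rat>" "s < q" "q < t"
  using Rats_dense_in_real[OF assms] by blast

lemma Rats_right:
  assumes "0 \<le> t" "ennreal t < T" "\<forall>\<^sub>F r in at_right t. P r"
  obtains q where "q \<in> \<rat>" "t < q" "ennreal q < T" "P q"
proof -
  obtain b where b: "t < b" "\<And>r. t < r \<Longrightarrow> r < b \<Longrightarrow> P r"
    using assms(3) unfolding eventually_at_right_field by blast
  obtain c where c: "0 \<le> c" "ennreal t < ennreal c" "ennreal c < T"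
    using ennreal_Rats_dense[OF assms(2)] by metis
  then have "t < min b c" using b(1) assms(1) by (simp add: ennreal_less_iff)
  then obtain q where q: "q \<in> \<rat>" "t < q" "q < min b c" by (rule Rats_between)
  have "ennreal q < T"
    using q assms(1) c by (intro le_less_trans[OF ennreal_leI c(3)]) auto
  with q b(2)[of q] that show thesis by simp
qed

lemma level_time_gt: "0 \<le> t \<Longrightarrow> ennreal t < \<tau> u \<Longrightarrow> a t \<le> u"
proof (rule ccontr)
  assume t: "0 \<le> t" "ennreal t < \<tau> u" "\<not> a t \<le> u"
  obtain q where q: "q \<in> \<rat>" "t < q" "ennreal q < \<tau> u"
    using Rats_right[OF t(1,2), of "\<lambda>_. True"] by auto
  then have "u < a q" using a_mono[of t q] t by auto
  then have "\<tau> u \<le> ennreal q"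
    unfolding level_time_def using q t(1) by (intro Inf_lower) auto
  with q show False by simp
qed

lemma level_time_less: "0 \<le> t \<Longrightarrow> \<tau> u < ennreal t \<Longrightarrow> u < a t"
proof -
  assume t: "0 \<le> t" "\<tau> u < ennreal t"
  then obtain q where "0 \<le> q" "u < a q" "ennreal q < ennreal t"
    unfolding level_time_def Inf_less_iff by auto
  then show ?thesis using a_mono[of q t] by (simp add: ennreal_less_iff)
qed

lemma level_time_finite: "\<tau> u < \<infinity>"
proof -
  have "\<forall>\<^sub>F t in at_top. u < a t"
    using a_top by (simp add: filterlim_at_top_dense)
  then obtain k where k: "\<And>t. k \<le> t \<Longrightarrow> u < a t"
    by (auto simp: eventually_at_top_linorder)
  define n where "n = real (nat \<lceil>k\<rceil>)"
  have "\<tau> u \<le> ennreal n"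
    unfolding level_time_def by (rule Inf_lower) (auto intro!: exI[of _ n] k simp: n_def real_nat_ceiling_ge)
  then show ?thesis by (simp add: le_less_trans[OF _ ennreal_less_top])
qed

lemma level_time_neg: "u < 0 \<Longrightarrow> \<tau> u = 0"
proof -
  assume "u < 0"
  then have "\<tau> u \<le> ennreal 0"
    unfolding level_time_def by (intro Inf_lower) (auto intro!: exI[of _ 0] simp: a_0)
  then show ?thesis by simp
qed

lemma a_level_time: "a (enn2real (\<tau> u)) = max u 0"
proof (cases "u < 0")
  case True
  then show ?thesis by (simp add: level_time_neg a_0)
next
  case False
  define s where "s = enn2real (\<tau> u)"
  have s: "ennreal s = \<tau> u" "0 \<le> s"
    using level_time_finite[of u] by (auto simp: s_def)
  have "u \<le> a s"
  proof (rule tendsto_lowerbound[OF a_right[OF s(2)]])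
    show "\<forall>\<^sub>F t in at_right s. u \<le> a t"
      using eventually_at_right_less[of s]
    proof eventually_elim
      case (elim t)
      then have "\<tau> u < ennreal t" unfolding s(1)[symmetric] using s(2) by (simp add: ennreal_less_iff)
      then show ?case using elim s(2) level_time_less[of t u] by simp
    qed
  qed simp
  moreover have "a s \<le> u"
  proof (cases "s = 0")
    case True
    then show ?thesis using False a_0 by simp
  next
    case False
    then have "0 < s" using s by simp
    show ?thesis
    proof (rule tendsto_upperbound[OF a_left[OF \<open>0 < s\<close>]])
      show "\<forall>\<^sub>F t in at_left s. a t \<le> u"
        using eventually_at_left_real[OF \<open>0 < s\<close>]
      proof eventually_elim
        case (elim t)
        then have "ennreal t < \<tau> u" unfolding s(1)[symmetric] by (simp add: ennreal_less_iff)
        then show ?case using elim level_time_gt[of t u] by simp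
      qed
    qed simp
  qed
  ultimately show ?thesis using False by (simp add: s_def)
qed

text \<open>Just after \<tau>(u) the path \<open>a\<close> exceeds u, so \<open>da\<close> charges
  every interval to the right of that time and \<open>x\<close> has zeros arbitrarily close to it.
  Right-continuity carries the zero to the time itself.\<close>

lemma x_level_time: "x (enn2real (\<tau> u)) = 0"
proof (cases "u < 0")
  case True
  then show ?thesis by (simp add: level_time_neg x_0)
next
  case False
  define s where "s = enn2real (\<tau> u)"
  have s: "ennreal s = \<tau> u" "0 \<le> s" "a s = u"
    using level_time_finite[of u] a_level_time[of u] False by (auto simp: s_def)
  have zero: "\<exists>r. s < r \<and> r \<le> t \<and> x r = 0" if "s < t" for t
  proof (rule ccontr)
    assume no: "\<not> ?thesis"
    define G where "G = (\<lambda>t. a (max 0 t))"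
    have mono: "G y \<le> G z" if "y \<le> z" for y z
      using that by (auto simp: G_def intro!: a_mono)
    have cont: "continuous_on UNIV G"
      unfolding G_def by (intro continuous_on_compose2[OF a_cont] continuous_intros) auto
    have "AE r in interval_measure G. r \<notin> {s<..t}"
      using carried unfolding G_def by eventually_elim (use no s(2) in auto)
    then have "emeasure (interval_measure G) {s<..t} = 0"
      using AE_iff_null_sets[of "{s<..t}" "interval_measure G"] by auto
    moreover have "emeasure (interval_measure G) {s<..t} = ennreal (G t - G s)"
      using \<open>s < t\<close> mono cont
      by (subst emeasure_interval_measure_Ioc)
        (auto simp: continuous_on_eq_continuous_at intro: continuous_at_imp_continuous_within)
    moreover have "u < a t"
      using that s level_time_less[of t u] by (simp add: s(1)[symmetric] ennreal_less_iff)
    ultimately show False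
      using s that by (simp add: G_def max_def split: if_splits)
  qed
  have "x s = 0"
  proof (rule ccontr)
    assume "x s \<noteq> 0"
    then have "\<forall>\<^sub>F r in at_right s. x r \<noteq> 0"
      using x_right[OF s(2)] by (intro tendsto_imp_eventually_ne) (auto simp: continuous_within)
    then obtain b where b: "s < b" "\<And>r. s < r \<Longrightarrow> r < b \<Longrightarrow> x r \<noteq> 0"
      unfolding eventually_at_right_field by blast
    with zero[of "(s + b) / 2"] show False by force
  qed
  then show ?thesis by (simp add: s_def)
qed

text \<open>If the inequality failed at \<open>t\<close>, the condition with slack would hold
  strictly at \<open>t\<close> for every \<open>n\<close>, hence at rational times arbitrarily soon
  after \<open>t\<close>, and no \<open>S n\<close> could exceed \<open>t\<close>.\<close>

lemma before_announced: "0 \<le> t \<Longrightarrow> ennreal t < \<sigma> \<Longrightarrow> ennreal (a t) < \<psi> (x t)"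
proof (rule ccontr)
  assume t: "0 \<le> t" "ennreal t < \<sigma>" "\<not> ennreal (a t) < \<psi> (x t)"
  then obtain n where n: "ennreal t < S n" by (auto simp: announced_time_def less_SUP_iff)
  have "\<psi> (x t) < ennreal (a t + 1 / Suc n)"
    using t(3) a_nonneg[OF t(1)] by (simp add: ennreal_less_iff not_less le_less_trans)
  from order_tendstoD(2)[OF \<psi>x_right[OF t(1)] this]
  obtain q where q: "q \<in> \<rat>" "t < q" "ennreal q < S n" "\<psi> (x q) < ennreal (a t + 1 / Suc n)"
    using Rats_right[OF t(1) n] by blast
  have "\<psi> (x q) \<le> ennreal (a q + 1 / Suc n)"
    using q a_mono[of t q] t(1) by (intro order_trans[OF less_imp_le[OF q(4)] ennreal_leI]) simp
  then have "S n \<le> ennreal q"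
    unfolding approx_time_def using q t(1) by (intro Inf_lower) auto
  with q show False by simp
qed

lemma left_limit_announced:
  assumes "\<sigma> = ennreal s" "0 < s" "(x \<longlongrightarrow> l) (at_left s)"
  shows "ennreal (a s) \<le> \<psi> l"
proof (rule tendsto_le[OF _ \<psi>_tendsto[OF assms(3)] tendsto_ennrealI[OF a_left[OF assms(2)]]])
  show "\<forall>\<^sub>F t in at_left s. ennreal (a t) \<le> \<psi> (x t)"
    using eventually_at_left_real[OF assms(2)]
    by eventually_elim (auto intro!: less_imp_le before_announced simp: assms(1) ennreal_less_iff)
qed simp

text \<open>The inequality holds strictly before \<sigma> and weakly in the left limit; a jump can
  only lower \<open>x\<close>, which raises \<psi>. At time 0 it holds because \<open>a\<close>
  vanishes.\<close>

lemma a_announced_le: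
  assumes "\<sigma> = ennreal s" "0 \<le> s"
  shows "ennreal (a s) \<le> \<psi> (x s)"
proof (cases "s = 0")
  case False
  then obtain l where l: "(x \<longlongrightarrow> l) (at_left s)" "x s \<le> l"
    using x_left[of s] assms(2) by auto
  have "ennreal (a s) \<le> \<psi> l"
    using left_limit_announced[OF assms(1) _ l(1)] False assms(2) by simp
  also have "\<dots> \<le> \<psi> (x s)" by (rule \<psi>_anti[OF l(2)])
  finally show ?thesis .
qed (simp add: a_0)

text \<open>A failure at \<open>s\<close> would persist on a right neighbourhood by
  right-continuity, and the infimum would lie beyond it.\<close>

lemma at_approx:
  assumes "S n = ennreal s" "0 \<le> s"
  shows "\<psi> (x s) \<le> ennreal (a s + 1 / Suc n)"
proof (rule ccontr)
  assume "\<not> ?thesis"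
  then have "ennreal (a s + 1 / Suc n) < \<psi> (x s)" by simp
  then obtain c where c: "ennreal (a s + 1 / Suc n) < c" "c < \<psi> (x s)"
    using dense by blast
  have "((\<lambda>r. ennreal (a r + 1 / Suc n)) \<longlongrightarrow> ennreal (a s + 1 / Suc n)) (at_right s)"
    by (intro tendsto_intros tendsto_ennrealI a_right assms)
  from order_tendstoD(2)[OF this c(1)] order_tendstoD(1)[OF \<psi>x_right[OF assms(2)] c(2)]
  have "\<forall>\<^sub>F r in at_right s. ennreal (a r + 1 / Suc n) < \<psi> (x r)"
    by eventually_elim (rule less_trans)
  then obtain b where b: "s < b" "\<And>r. s < r \<Longrightarrow> r < b \<Longrightarrow> ennreal (a r + 1 / Suc n) < \<psi> (x r)"
    unfolding eventually_at_right_field by blast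
  have "ennreal b \<le> S n"
    unfolding approx_time_def
  proof (rule Inf_greatest, clarify)
    fix q assume q: "q \<in> \<rat>" "0 \<le> q" "\<psi> (x q) \<le> ennreal (a q + 1 / Suc n)"
    then have "S n \<le> ennreal q" unfolding approx_time_def by (intro Inf_lower) auto
    then have "s \<le> q" using assms q by simp
    moreover have "q \<noteq> s" using q c by auto
    ultimately have "b \<le> q" using b(2)[of q] q by (meson not_less order_le_neq_trans)
    then show "ennreal b \<le> ennreal q" by (rule ennreal_leI)
  qed
  with assms b(1) show False by (simp add: ennreal_le_iff2)
qed

text \<open>The limit \<open>l\<close> is \<open>x s\<close> if some \<open>S n\<close> already
  equals \<sigma>, and the left limit at \<open>s\<close> otherwise. The gap between
  \<open>x s\<close> and \<open>l\<close> is what remains to be closed by expectations.\<close>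

lemma approx_tendsto:
  assumes "\<sigma> = ennreal s" "0 \<le> s"
  obtains l where "x s \<le> l" "(\<lambda>n. x (enn2real (S n))) \<longlonglongrightarrow> l" "(\<lambda>n. a (enn2real (S n))) \<longlonglongrightarrow> a s"
    "\<psi> l \<le> ennreal (a s)"
proof -
  note goal = that
  define s' where "s' n = enn2real (S n)" for n
  have fin: "S n = ennreal (s' n)" for n
    using approx_time_le[of \<psi> x a n] assms(1) unfolding s'_def
    by (metis ennreal_enn2real ennreal_less_top infinity_ennreal_def le_less_trans)
  have s'0: "0 \<le> s' n" for n by (simp add: s'_def)
  have s's: "s' n \<le> s" for n
    using approx_time_le[of \<psi> x a n] assms unfolding fin by simp
  have "(\<lambda>n. S n) \<longlonglongrightarrow> \<sigma>"
    unfolding announced_time_def by (rule LIMSEQ_SUP) (simp add: incseq_def approx_time_mono)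
  then have s'lim: "s' \<longlonglongrightarrow> s"
    unfolding fin assms(1) using s'0 assms(2) by (simp add: tendsto_ennreal_iff)
  have aux: thesis if l: "(\<lambda>n. x (s' n)) \<longlonglongrightarrow> l" "(\<lambda>n. a (s' n)) \<longlonglongrightarrow> a s" "x s \<le> l" for l
  proof -
    have inv: "(\<lambda>n. 1 / Suc n) \<longlonglongrightarrow> 0"
      using LIMSEQ_inverse_real_of_nat by (simp add: inverse_eq_divide)
    have "\<psi> l \<le> ennreal (a s + 0)"
    proof (rule tendsto_le[OF _ tendsto_ennrealI[OF tendsto_add[OF l(2) inv]] \<psi>_tendsto[OF l(1)]])
      show "\<forall>\<^sub>F n in sequentially. \<psi> (x (s' n)) \<le> ennreal (a (s' n) + 1 / Suc n)"
        using at_approx[OF fin s'0] by simp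
    qed simp
    then show thesis using goal[OF l(3) l(1)[unfolded s'_def] l(2)[unfolded s'_def]] by simp
  qed
  show thesis
  proof (cases "\<exists>n. S n = \<sigma>")
    case True
    then obtain n where n: "S n = \<sigma>" ..
    have "s' m = s" if "n \<le> m" for m
      using approx_time_mono[OF that, of \<psi> x a] approx_time_le[of \<psi> x a m] n assms s'0 fin
      by (metis ennreal_inj order_antisym)
    then have "\<forall>\<^sub>F m in sequentially. s = s' m"
      unfolding eventually_sequentially by metis
    then have "\<forall>\<^sub>F m in sequentially. x s = x (s' m)" "\<forall>\<^sub>F m in sequentially. a s = a (s' m)"
      by (auto elim: eventually_mono)
    then show thesis
      by (intro aux[of "x s"] Lim_transform_eventually[OF tendsto_const]) auto
  next
    case False
    have less: "s' n < s" for n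
      using False fin s's[of n] assms(1) by (metis order_le_neq_trans)
    with s'0[of 0] have "0 < s" by (auto intro: le_less_trans)
    then obtain l where l: "(x \<longlongrightarrow> l) (at_left s)" "x s \<le> l" using x_left by blast
    have "filterlim s' (at_left s) sequentially"
      unfolding filterlim_at using s'lim less by (simp add: less_imp_neq)
    then show thesis
      using filterlim_compose[OF l(1)] filterlim_compose[OF a_left[OF \<open>0 < s\<close>]] l(2) by (intro aux) auto
  qed
qed

lemma announced_pos: "0 < \<sigma>"
proof (rule ccontr)
  assume "\<not> ?thesis"
  then have z: "\<sigma> = ennreal 0" by simp
  obtain l where l: "(\<lambda>n. x (enn2real (S n))) \<longlonglongrightarrow> l" "\<psi> l \<le> ennreal (a 0)"
    using approx_tendsto[OF z] by auto
  have "S n = 0" for n using approx_time_le[of \<psi> x a n] z by simp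
  then have "l = 0" using l(1) by (simp add: x_0 LIMSEQ_const_iff)
  then show False using l(2) \<psi>_0 by (simp add: a_0)
qed

text \<open>After \<tau>(u) and before \<sigma> one has \<psi>(x) > a \<ge> u \<ge> \<psi>(C), which
  forces \<open>x\<close> below \<open>C\<close>. The bound extends to \<sigma> itself because there
  is no upward jump.\<close>

lemma bounded_until_announced:
  assumes "\<tau> u < \<sigma>" "\<psi> C \<le> ennreal u" "0 \<le> t" "\<tau> u \<le> ennreal t" "ennreal t \<le> \<sigma>"
  shows "x t \<le> C"
proof -
  have 1: "x r \<le> C" if r: "0 \<le> r" "\<tau> u \<le> ennreal r" "ennreal r < \<sigma>" for r
  proof (rule ccontr)
    assume "\<not> x r \<le> C"
    then have "\<psi> (x r) \<le> \<psi> C" by (intro \<psi>_anti) simp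
    also have "\<dots> \<le> ennreal (max u 0)" using assms(2) by (auto intro: order_trans ennreal_leI)
    also have "\<dots> \<le> ennreal (a r)"
    proof (intro ennreal_leI)
      have "enn2real (\<tau> u) \<le> r" using enn2real_mono[OF r(2)] r(1) by simp
      then show "max u 0 \<le> a r" using a_mono[of "enn2real (\<tau> u)" r] a_level_time[of u] by simp
    qed
    finally show False using before_announced[OF r(1,3)] by simp
  qed
  show ?thesis
  proof (cases "ennreal t < \<sigma>")
    case True
    then show ?thesis using 1 assms by simp
  next
    case False
    then have t: "ennreal t = \<sigma>" using assms by simp
    define p where "p = enn2real (\<tau> u)"
    have p: "ennreal p = \<tau> u" "0 \<le> p" using level_time_finite[of u] by (auto simp: p_def)
    have "p < t" using assms(1) p t by (metis assms(3) ennreal_less_iff)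
    then obtain l where l: "(x \<longlongrightarrow> l) (at_left t)" "x t \<le> l" using x_left[of t] p by auto
    have "l \<le> C"
    proof (rule tendsto_upperbound[OF l(1)])
      show "\<forall>\<^sub>F r in at_left t. x r \<le> C"
        using eventually_at_left_real[OF \<open>p < t\<close>]
        by eventually_elim (use p t in \<open>auto intro!: 1 simp: p(1)[symmetric] t[symmetric] ennreal_less_iff\<close>)
    qed simp
    with l show ?thesis by simp
  qed
qed

text \<open>This makes the probability that \<tau>(u) precedes \<sigma> the tail at u of the law of
  \<open>a\<close> at \<sigma>, as far as \<sigma> is finite.\<close>

lemma level_before_announced_iff:
  assumes "\<sigma> = ennreal s" "0 \<le> s"
  shows "\<tau> u < \<sigma> \<longleftrightarrow> u < a s"
proof
  assume "\<tau> u < \<sigma>"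
  then show "u < a s" using level_time_less[OF assms(2)] assms(1) by simp
next
  assume u: "u < a s"
  show "\<tau> u < \<sigma>"
  proof (cases "u < 0")
    case True
    then show ?thesis using announced_pos by (simp add: level_time_neg)
  next
    case False
    show ?thesis
    proof (rule ccontr)
      assume "\<not> ?thesis"
      then have "s \<le> enn2real (\<tau> u)"
        using level_time_finite[of u] enn2real_mono[of "ennreal s" "\<tau> u"] assms by simp
      then have "a s \<le> max u 0" using a_mono[OF assms(2)] a_level_time[of u] by metis
      with u False show False by simp
    qed
  qed
qed

text \<open>The maximum with \<tau>(u) keeps the early times behind the start and is eventually
  inactive, since \<open>S n\<close> tends to a limit beyond \<tau>(u). If \<tau>(b) precedes
  \<sigma>, the times are eventually all equal to \<tau>(b); otherwise they are eventually
  \<open>S n\<close>.\<close>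

lemma approx_limit:
  assumes "u < b" "0 \<le> b" "\<tau> u < \<sigma>"
  defines "r n \<equiv> enn2real (max (\<tau> u) (min (S n) (\<tau> b)))" and "r' \<equiv> enn2real (min \<sigma> (\<tau> b))"
  obtains L where "(\<lambda>n. x (r n) - a (r n)) \<longlonglongrightarrow> L" "x r' - a r' \<le> L"
    "\<sigma> \<le> \<tau> b \<Longrightarrow> \<psi> (L + a (enn2real \<sigma>)) \<le> ennreal (a (enn2real \<sigma>))"
proof -
  have Slim: "(\<lambda>n. S n) \<longlonglongrightarrow> \<sigma>"
    unfolding announced_time_def by (rule LIMSEQ_SUP) (simp add: incseq_def approx_time_mono)
  have ub: "\<tau> u \<le> \<tau> b" using assms(1) by (intro level_time_mono) simp
  show thesis
  proof (cases "\<sigma> \<le> \<tau> b")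
    case False
    then have "\<forall>\<^sub>F n in sequentially. \<tau> b < S n"
      using order_tendstoD(1)[OF Slim, of "\<tau> b"] by simp
    then have "\<forall>\<^sub>F n in sequentially. x r' - a r' = x (r n) - a (r n)"
    proof eventually_elim
      case (elim n)
      then show ?case using False ub unfolding r_def r'_def by (simp add: min_absorb2 max_absorb2)
    qed
    then show thesis
      using False by (intro that[of "x r' - a r'"] Lim_transform_eventually[OF tendsto_const]) auto
  next
    case True
    then have "\<sigma> < \<infinity>" using level_time_finite[of b] by (rule le_less_trans)
    then obtain s where s: "\<sigma> = ennreal s" "0 \<le> s" by (cases "\<sigma>") auto
    then have s': "enn2real \<sigma> = s" by simp
    obtain l where l: "x s \<le> l" "(\<lambda>n. x (enn2real (S n))) \<longlonglongrightarrow> l" "(\<lambda>n. a (enn2real (S n))) \<longlonglongrightarrow> a s"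
      "\<psi> l \<le> ennreal (a s)" using approx_tendsto[OF s] by metis
    have "\<forall>\<^sub>F n in sequentially. \<tau> u < S n"
      using order_tendstoD(1)[OF Slim assms(3)] .
    then have ev: "\<forall>\<^sub>F n in sequentially. x (enn2real (S n)) - a (enn2real (S n)) = x (r n) - a (r n)"
    proof eventually_elim
      case (elim n)
      then show ?case
        using order_trans[OF approx_time_le True] unfolding r_def by (simp add: min_absorb1 max_absorb2)
    qed
    show thesis
    proof (rule that[of "l - a s"])
      show "(\<lambda>n. x (r n) - a (r n)) \<longlonglongrightarrow> l - a s"
        by (rule Lim_transform_eventually[OF tendsto_diff[OF l(2,3)] ev])
      show "x r' - a r' \<le> l - a s" using l(1) True s' by (simp add: r'_def min_absorb1)
    qed (use l(4) s' in simp)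
  qed
qed

text \<open>The infimum over real times agrees with the one built from rational times as soon as the
  condition holds at \<sigma>, which will be known almost surely.\<close>

lemma hitting_eq_announced:
  assumes "\<sigma> = ennreal s" "0 \<le> s" "\<psi> (x s) \<le> ennreal (a s)"
  shows "Inf {ennreal t |t. 0 \<le> t \<and> \<psi> (x t) \<le> ennreal (a t)} = \<sigma>"
proof (rule order_antisym)
  show "Inf {ennreal t |t. 0 \<le> t \<and> \<psi> (x t) \<le> ennreal (a t)} \<le> \<sigma>"
    unfolding assms(1) using assms by (intro Inf_lower) auto
  show "\<sigma> \<le> Inf {ennreal t |t. 0 \<le> t \<and> \<psi> (x t) \<le> ennreal (a t)}"
    using before_announced by (intro Inf_greatest) (auto simp: not_less[symmetric])
qed

end

subsection \<open>Announced exit time\<close>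

locale sigma_embedding = filtered_prob_space M F
  for M :: "'a measure" and F :: "ennreal \<Rightarrow> 'a measure" +
  fixes X N A :: "real \<Rightarrow> 'a \<Rightarrow> real" and \<psi> :: "real \<Rightarrow> ennreal"
  assumes class_Sigma: "class_Sigma M F X N A"
    and neg_jumps: "only_negative_jumps M X"
    and A_top: "AE \<omega> in M. filterlim (\<lambda>t. A t \<omega>) at_top at_top"
    and \<psi>_cont: "continuous_on UNIV \<psi>"
    and \<psi>_anti: "\<And>y z. y \<le> z \<Longrightarrow> \<psi> z \<le> \<psi> y"
    and \<psi>_0: "0 < \<psi> 0"
    and \<psi>_vanish: "\<And>u. 0 < u \<Longrightarrow> \<exists>C. \<psi> C \<le> ennreal u"
begin

definition \<tau> :: "real \<Rightarrow> 'a \<Rightarrow> ennreal" where "\<tau> u \<omega> = level_time (\<lambda>t. A t \<omega>) u"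
definition S :: "nat \<Rightarrow> 'a \<Rightarrow> ennreal" where "S n \<omega> = approx_time \<psi> (\<lambda>t. X t \<omega>) (\<lambda>t. A t \<omega>) n"
definition \<sigma> :: "'a \<Rightarrow> ennreal" where "\<sigma> \<omega> = announced_time \<psi> (\<lambda>t. X t \<omega>) (\<lambda>t. A t \<omega>)"

definition regular :: "'a \<Rightarrow> bool" where
  "regular \<omega> \<longleftrightarrow> sigma_path (\<lambda>t. X t \<omega>) (\<lambda>t. A t \<omega>) \<psi> \<and> (\<forall>t\<ge>0. N t \<omega> = X t \<omega> - A t \<omega>) \<and>
     (\<forall>t\<ge>0. continuous (at_right t) (\<lambda>t. N t \<omega>))"

lemma AE_regular: "AE \<omega> in M. regular \<omega>"
proof -
  have "AE \<omega> in M. \<forall>t\<ge>0. 0 \<le> X t \<omega>" "AE \<omega> in M. \<forall>t\<ge>0. X t \<omega> = N t \<omega> + A t \<omega>"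
    "AE \<omega> in M. cadlag (\<lambda>t. N t \<omega>)" "AE \<omega> in M. N 0 \<omega> = 0"
    "AE \<omega> in M. continuous_on {0..} (\<lambda>t. A t \<omega>)" "AE \<omega> in M. mono_on {0..} (\<lambda>t. A t \<omega>)"
    "AE \<omega> in M. A 0 \<omega> = 0"
    "AE \<omega> in M. AE t in interval_measure (\<lambda>t. A (max 0 t) \<omega>). 0 \<le> t \<longrightarrow> X t \<omega> = 0"
    using class_Sigma by (auto simp: class_Sigma_def)
  moreover have "AE \<omega> in M. \<forall>t>0. jump (\<lambda>t. X t \<omega>) t \<le> 0"
    using neg_jumps by (simp add: only_negative_jumps_def)
  ultimately show ?thesis
    using A_top
  proof eventually_elim
    case (elim \<omega>)
    have X: "X t \<omega> = N t \<omega> + A t \<omega>" if "0 \<le> t" for t using elim(2) that by simp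
    have Nr: "((\<lambda>t. N t \<omega>) \<longlongrightarrow> N t \<omega>) (at_right t)" if "0 \<le> t" for t
      using elim(3) that by (auto simp: cadlag_def continuous_within)
    have Ar: "((\<lambda>t. A t \<omega>) \<longlongrightarrow> A t \<omega>) (at_right t)" if "0 \<le> t" for t
      using elim(5) that unfolding continuous_on_def
      by (auto intro: tendsto_within_subset[of _ _ _ "{0..}"])
    have "sigma_path (\<lambda>t. X t \<omega>) (\<lambda>t. A t \<omega>) \<psi>"
    proof
      show "continuous (at_right t) (\<lambda>t. X t \<omega>)" if "0 \<le> t" for t
      proof -
        have "\<forall>\<^sub>F r in at_right t. N r \<omega> + A r \<omega> = X r \<omega>"
          using eventually_at_right_less[of t] by (rule eventually_mono) (use that X in simp)
        then show ?thesis
          unfolding continuous_within X[OF that]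
          by (rule Lim_transform_eventually[OF tendsto_add[OF Nr[OF that] Ar[OF that]]])
      qed
      show "\<exists>l. ((\<lambda>t. X t \<omega>) \<longlongrightarrow> l) (at_left t) \<and> X t \<omega> \<le> l" if "0 < t" for t
      proof -
        have "\<exists>l. ((\<lambda>t. N t \<omega>) \<longlongrightarrow> l) (at_left t)"
          using elim(3) that unfolding cadlag_def by simp
        then obtain l where l: "((\<lambda>t. N t \<omega>) \<longlongrightarrow> l) (at_left t)" ..
        have "continuous_on {0<..} (\<lambda>t. A t \<omega>)"
          by (rule continuous_on_subset[OF elim(5)]) auto
        then have "isCont (\<lambda>t. A t \<omega>) t" using that by (simp add: continuous_on_eq_continuous_at)
        then have Al: "((\<lambda>t. A t \<omega>) \<longlongrightarrow> A t \<omega>) (at_left t)"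
          by (auto simp: isCont_def intro: tendsto_within_subset)
        have "\<forall>\<^sub>F r in at_left t. N r \<omega> + A r \<omega> = X r \<omega>"
          using eventually_at_left_real[OF that] by (rule eventually_mono) (use X in simp)
        then have Xl: "((\<lambda>t. X t \<omega>) \<longlongrightarrow> l + A t \<omega>) (at_left t)"
          by (rule Lim_transform_eventually[OF tendsto_add[OF l Al]])
        then have "Lim (at_left t) (\<lambda>t. X t \<omega>) = l + A t \<omega>"
          by (intro tendsto_Lim) simp_all
        then show ?thesis
          using Xl elim(9) that by (intro exI[of _ "l + A t \<omega>"]) (auto simp: jump_def)
      qed
      show "A s \<omega> \<le> A t \<omega>" if "0 \<le> s" "s \<le> t" for s t
        using elim(6) that by (auto simp: mono_on_def)
    qed (use elim \<psi>_anti \<psi>_0 \<psi>_cont X[of 0] in simp_all)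
    then show "regular \<omega>"
      using elim by (auto simp: regular_def cadlag_def)
  qed
qed

lemma adapted: "0 \<le> t \<Longrightarrow> X t \<in> borel_measurable (F (ennreal t))" "0 \<le> t \<Longrightarrow> A t \<in> borel_measurable (F (ennreal t))"
  using class_Sigma by (auto simp: class_Sigma_def local_submartingale_def adapted_def)

lemma \<psi>_measurable [measurable]: "\<psi> \<in> borel_measurable borel"
  using \<psi>_cont by (rule borel_measurable_continuous_onI)

lemma optional_\<tau>: "optional_time F (\<tau> u)"
  unfolding \<tau>_def[abs_def] level_time_def
proof (rule optional_time_rational_debut)
  fix q :: real assume "0 \<le> q"
  note [measurable] = adapted(2)[OF this]
  show "Measurable.pred (F (ennreal q)) (\<lambda>\<omega>. u < A q \<omega>)" by measurable
qed

lemma optional_S: "optional_time F (S n)"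
  unfolding S_def[abs_def] approx_time_def
proof (rule optional_time_rational_debut)
  fix q :: real assume "0 \<le> q"
  note [measurable] = adapted[OF this]
  show "Measurable.pred (F (ennreal q)) (\<lambda>\<omega>. \<psi> (X q \<omega>) \<le> ennreal (A q \<omega> + 1 / Suc n))" by measurable
qed

lemma optional_\<sigma>: "optional_time F \<sigma>"
  using optional_time_SUP[OF optional_S] unfolding \<sigma>_def[abs_def] announced_time_def S_def .

lemmas times_measurable [measurable] =
  optional_time_measurable[OF optional_\<tau>] optional_time_measurable[OF optional_S] optional_time_measurable[OF optional_\<sigma>]

text \<open>Paths on which \<sigma> is infinite are counted at every level, because all level times
  are almost surely finite. Small values of \<open>G\<close> will therefore show that \<sigma> is
  finite.\<close>

definition G :: "real \<Rightarrow> real" where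
  "G u = measure M {\<omega>\<in>space M. \<tau> u \<omega> < \<sigma> \<omega>}"

lemma \<tau>_mono: "u \<le> v \<Longrightarrow> \<tau> u \<omega> \<le> \<tau> v \<omega>"
  unfolding \<tau>_def by (rule level_time_mono)

lemma G_antimono: "u \<le> v \<Longrightarrow> G v \<le> G u"
  unfolding G_def using \<tau>_mono[of u v] by (intro finite_measure_mono) (auto intro: le_less_trans)

lemma right_value_N:
  assumes "regular \<omega>"
  shows "right_value N (\<lambda>\<omega>. enn2real (Q \<omega>)) \<omega> = X (enn2real (Q \<omega>)) \<omega> - A (enn2real (Q \<omega>)) \<omega>"
  using assms by (subst right_value_eq) (auto simp: regular_def)

lemma right_value_N_measurable:
  assumes [measurable]: "Q \<in> borel_measurable M"
  shows "right_value N (\<lambda>\<omega>. enn2real (Q \<omega>)) \<in> borel_measurable M"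
proof (rule right_value_measurable)
  show "N t \<in> borel_measurable M" if "0 \<le> t" for t
    using class_Sigma that by (auto simp: class_Sigma_def local_martingale_def adapted_def intro: measurable_F_M)
qed measurable

lemma N_bounded:
  assumes \<omega>: "regular \<omega>" and less: "\<tau> u \<omega> < \<sigma> \<omega>" and C: "\<psi> C \<le> ennreal u" and "0 \<le> b"
    and t: "0 \<le> t" "\<tau> u \<omega> \<le> ennreal t" "ennreal t \<le> \<sigma> \<omega>" "ennreal t \<le> \<tau> b \<omega>"
  shows "\<bar>X t \<omega> - A t \<omega>\<bar> \<le> \<bar>C\<bar> + b"
proof -
  interpret p: sigma_path "\<lambda>t. X t \<omega>" "\<lambda>t. A t \<omega>" \<psi> using \<omega> by (simp add: regular_def)
  have "X t \<omega> \<le> C"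
    using p.bounded_until_announced[OF _ C t(1)] less t by (simp add: \<tau>_def \<sigma>_def)
  moreover have "0 \<le> X t \<omega>" "0 \<le> A t \<omega>" using p.x_nonneg p.a_nonneg t(1) by auto
  moreover have "A t \<omega> \<le> b"
  proof -
    have "t \<le> enn2real (level_time (\<lambda>t. A t \<omega>) b)"
      using enn2real_mono[OF t(4)] t(1) p.level_time_finite[of b] by (simp add: \<tau>_def)
    from p.a_mono[OF t(1) this] show ?thesis using p.a_level_time[of b] \<open>0 \<le> b\<close> by simp
  qed
  ultimately show ?thesis by simp
qed

text \<open>The right-hand side is the contribution of the starting value: at \<tau>(u) the process
  \<open>X\<close> vanishes and \<open>A\<close> equals \<open>max u 0\<close>. It is the same for
  every admissible \<open>Q\<close>, which allows different stopping times to be compared.\<close>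

lemma stopping_identity:
  assumes ub: "u < b" "0 \<le> b" and C: "\<psi> C \<le> ennreal u"
    and Q: "optional_time F Q" and ge: "\<And>\<omega>. \<tau> u \<omega> < \<sigma> \<omega> \<Longrightarrow> \<tau> u \<omega> \<le> Q \<omega>"
    and le: "\<And>\<omega>. \<tau> u \<omega> < \<sigma> \<omega> \<Longrightarrow> Q \<omega> \<le> \<sigma> \<omega>" "\<And>\<omega>. \<tau> u \<omega> < \<sigma> \<omega> \<Longrightarrow> Q \<omega> \<le> \<tau> b \<omega>"
  shows "(\<integral>\<omega>. indicator {\<omega>\<in>space M. \<tau> u \<omega> < \<sigma> \<omega>} \<omega> * right_value N (\<lambda>\<omega>. enn2real (Q \<omega>)) \<omega> \<partial>M) = - max u 0 * G u"
    (is "?I Q = _")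
proof -
  have Nl: "local_martingale M F N" using class_Sigma by (simp add: class_Sigma_def)
  have "?I Q = ?I (\<tau> u)"
  proof (rule local_martingale_optional_stopping[OF Nl _ optional_\<tau> Q _ ge, where C="\<bar>C\<bar> + b"])
    show "AE \<omega> in M. \<forall>t\<ge>0. continuous (at_right t) (\<lambda>t. N t \<omega>)"
      using AE_regular by eventually_elim (simp add: regular_def)
    show "pre_event F (\<tau> u) (\<lambda>\<omega>. \<tau> u \<omega> < \<sigma> \<omega>)"
      using pre_event_less[OF optional_\<tau>[unfolded optional_time_def] optional_\<sigma>] by simp
    show "AE \<omega> in M. \<tau> u \<omega> < \<sigma> \<omega> \<longrightarrow> Q \<omega> < \<infinity>"
      using AE_regular
    proof eventually_elim
      case (elim \<omega>)
      then have "\<tau> b \<omega> < \<infinity>"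
        unfolding \<tau>_def regular_def by (blast intro: sigma_path.level_time_finite)
      then show ?case using le(2)[of \<omega>] by (auto intro: le_less_trans)
    qed
    show "AE \<omega> in M. \<tau> u \<omega> < \<sigma> \<omega> \<longrightarrow> (\<forall>t\<ge>0. \<tau> u \<omega> \<le> ennreal t \<and> ennreal t \<le> Q \<omega> \<longrightarrow> \<bar>N t \<omega>\<bar> \<le> \<bar>C\<bar> + b)"
      using AE_regular
    proof eventually_elim
      case (elim \<omega>)
      then show ?case
        using N_bounded[OF elim _ C \<open>0 \<le> b\<close>] le[of \<omega>] by (auto simp: regular_def)
    qed
  qed measurable
  also have "\<dots> = (\<integral>\<omega>. - max u 0 * indicator {\<omega>\<in>space M. \<tau> u \<omega> < \<sigma> \<omega>} \<omega> \<partial>M)"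
  proof (rule integral_cong_AE)
    show "AE \<omega> in M. indicator {\<omega>\<in>space M. \<tau> u \<omega> < \<sigma> \<omega>} \<omega> * right_value N (\<lambda>\<omega>. enn2real (\<tau> u \<omega>)) \<omega> =
        - max u 0 * indicator {\<omega>\<in>space M. \<tau> u \<omega> < \<sigma> \<omega>} \<omega>"
      using AE_regular
    proof eventually_elim
      case (elim \<omega>)
      then interpret p: sigma_path "\<lambda>t. X t \<omega>" "\<lambda>t. A t \<omega>" \<psi> by (simp add: regular_def)
      show ?case
        using p.a_level_time[of u] p.x_level_time[of u] unfolding right_value_N[OF elim] by (simp add: \<tau>_def)
    qed
    note [measurable] = right_value_N_measurable[OF times_measurable(1)]
    show "(\<lambda>\<omega>. indicator {\<omega>\<in>space M. \<tau> u \<omega> < \<sigma> \<omega>} \<omega> * right_value N (\<lambda>\<omega>. enn2real (\<tau> u \<omega>)) \<omega>) \<in> borel_measurable M"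
      by measurable
  qed measurable
  also have "\<dots> = - max u 0 * G u"
    by (simp add: G_def)
  finally show ?thesis .
qed

text \<open>Along the announcing sequence and at its limit \<open>N\<close> has the same expectation, while the values along
  the sequence can only exceed the final one: hence \<open>X\<close> does not jump at \<open>\<sigma>\<close>.\<close>

lemma attained_on_interval:
  assumes ub: "u < b" "0 \<le> b" and C: "\<psi> C \<le> ennreal u"
  shows "AE \<omega> in M. \<tau> u \<omega> < \<sigma> \<omega> \<and> \<sigma> \<omega> \<le> \<tau> b \<omega> \<longrightarrow>
    \<psi> (X (enn2real (\<sigma> \<omega>)) \<omega>) \<le> ennreal (A (enn2real (\<sigma> \<omega>)) \<omega>)"
proof -
  define B where "B = {\<omega>\<in>space M. \<tau> u \<omega> < \<sigma> \<omega>}"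
  define Q where "Q n \<omega> = max (\<tau> u \<omega>) (min (S n \<omega>) (\<tau> b \<omega>))" for n \<omega>
  define Q' where "Q' \<omega> = min (\<sigma> \<omega>) (\<tau> b \<omega>)" for \<omega>
  define v where "v n = right_value N (\<lambda>\<omega>. enn2real (Q n \<omega>))" for n
  define v' where "v' = right_value N (\<lambda>\<omega>. enn2real (Q' \<omega>))"
  define L where "L \<omega> = lim (\<lambda>n. v n \<omega>)" for \<omega>
  have le: "\<tau> u \<omega> \<le> \<tau> b \<omega>" for \<omega> using ub by (intro \<tau>_mono) simp
  have S\<sigma>: "S n \<omega> \<le> \<sigma> \<omega>" for n \<omega> unfolding S_def \<sigma>_def by (rule approx_time_le)
  have [measurable]: "B \<in> sets M" unfolding B_def by measurable
  have Qo: "optional_time F (Q n)" for n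
    unfolding Q_def[abs_def] by (intro optional_time_max optional_time_min optional_\<tau> optional_S)
  have Q'o: "optional_time F Q'"
    unfolding Q'_def[abs_def] by (intro optional_time_min optional_\<tau> optional_\<sigma>)
  have vm [measurable]: "v n \<in> borel_measurable M" for n
    unfolding v_def by (rule right_value_N_measurable[OF optional_time_measurable[OF Qo]])
  have v'm [measurable]: "v' \<in> borel_measurable M"
    unfolding v'_def by (rule right_value_N_measurable[OF optional_time_measurable[OF Q'o]])
  have Lm [measurable]: "L \<in> borel_measurable M"
    unfolding L_def[abs_def] by measurable
  have Qb: "Q n \<omega> \<le> \<tau> b \<omega>" "\<tau> u \<omega> < \<sigma> \<omega> \<Longrightarrow> Q n \<omega> \<le> \<sigma> \<omega>" "\<tau> u \<omega> \<le> Q n \<omega>" for n \<omega>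
    using le[of \<omega>] S\<sigma>[of n \<omega>] by (auto simp: Q_def min_le_iff_disj)
  have In: "(\<integral>\<omega>. indicator B \<omega> * v n \<omega> \<partial>M) = - max u 0 * G u" for n
    unfolding B_def v_def using Qb by (intro stopping_identity[OF ub C Qo])
  have I': "(\<integral>\<omega>. indicator B \<omega> * v' \<omega> \<partial>M) = - max u 0 * G u"
    unfolding B_def v'_def using le by (intro stopping_identity[OF ub C Q'o]) (auto simp: Q'_def less_imp_le)
  have limit: "AE \<omega> in M. \<omega> \<in> B \<longrightarrow> (\<lambda>n. v n \<omega>) \<longlonglongrightarrow> L \<omega> \<and> v' \<omega> \<le> L \<omega> \<and>
      (\<forall>n. \<bar>v n \<omega>\<bar> \<le> \<bar>C\<bar> + b) \<and> \<bar>v' \<omega>\<bar> \<le> \<bar>C\<bar> + b \<and>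
      (\<sigma> \<omega> \<le> \<tau> b \<omega> \<longrightarrow> v' \<omega> = X (enn2real (\<sigma> \<omega>)) \<omega> - A (enn2real (\<sigma> \<omega>)) \<omega> \<and>
        \<psi> (L \<omega> + A (enn2real (\<sigma> \<omega>)) \<omega>) \<le> ennreal (A (enn2real (\<sigma> \<omega>)) \<omega>))"
    using AE_regular
  proof eventually_elim
    case (elim \<omega>)
    then interpret p: sigma_path "\<lambda>t. X t \<omega>" "\<lambda>t. A t \<omega>" \<psi> by (simp add: regular_def)
    show ?case
    proof
      assume "\<omega> \<in> B"
      then have less: "\<tau> u \<omega> < \<sigma> \<omega>" by (simp add: B_def)
      have v: "v n \<omega> = X (enn2real (Q n \<omega>)) \<omega> - A (enn2real (Q n \<omega>)) \<omega>" for n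
        unfolding v_def by (rule right_value_N[OF elim])
      have v': "v' \<omega> = X (enn2real (Q' \<omega>)) \<omega> - A (enn2real (Q' \<omega>)) \<omega>"
        unfolding v'_def by (rule right_value_N[OF elim])
      obtain l where l: "(\<lambda>n. v n \<omega>) \<longlonglongrightarrow> l" "v' \<omega> \<le> l"
        "\<sigma> \<omega> \<le> \<tau> b \<omega> \<Longrightarrow> \<psi> (l + A (enn2real (\<sigma> \<omega>)) \<omega>) \<le> ennreal (A (enn2real (\<sigma> \<omega>)) \<omega>)"
        by (rule p.approx_limit[OF ub less[unfolded \<tau>_def \<sigma>_def], folded \<tau>_def \<sigma>_def S_def, folded Q_def Q'_def, folded v v']) blast
      have Ll: "L \<omega> = l" unfolding L_def using l(1) by (rule limI)
      have fin: "\<tau> b \<omega> < \<infinity>" unfolding \<tau>_def by (rule p.level_time_finite)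
      have Qe: "ennreal (enn2real (Q n \<omega>)) = Q n \<omega>" "ennreal (enn2real (Q' \<omega>)) = Q' \<omega>" for n
        using Qb(1)[of n \<omega>] fin by (auto intro!: ennreal_enn2real le_less_trans[of "Q n \<omega>"] simp: Q'_def min_less_iff_disj)
      have "\<bar>v n \<omega>\<bar> \<le> \<bar>C\<bar> + b" for n
        unfolding v using Qb(1)[of n \<omega>] Qb(2)[of \<omega> n] Qb(3)[of \<omega> n] less by (intro N_bounded[OF elim less C \<open>0 \<le> b\<close>]) (simp_all add: Qe)
      moreover have "\<bar>v' \<omega>\<bar> \<le> \<bar>C\<bar> + b"
        unfolding v' using less le[of \<omega>]
        by (intro N_bounded[OF elim less C \<open>0 \<le> b\<close>]) (simp_all add: Qe, simp_all add: Q'_def)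
      ultimately show "(\<lambda>n. v n \<omega>) \<longlonglongrightarrow> L \<omega> \<and> v' \<omega> \<le> L \<omega> \<and>
          (\<forall>n. \<bar>v n \<omega>\<bar> \<le> \<bar>C\<bar> + b) \<and> \<bar>v' \<omega>\<bar> \<le> \<bar>C\<bar> + b \<and>
          (\<sigma> \<omega> \<le> \<tau> b \<omega> \<longrightarrow> v' \<omega> = X (enn2real (\<sigma> \<omega>)) \<omega> - A (enn2real (\<sigma> \<omega>)) \<omega> \<and>
            \<psi> (L \<omega> + A (enn2real (\<sigma> \<omega>)) \<omega>) \<le> ennreal (A (enn2real (\<sigma> \<omega>)) \<omega>))"
        using l Ll v' by (auto simp: Q'_def min_absorb1)
    qed
  qed
  have bnd: "AE \<omega> in M. norm (indicator B \<omega> * v n \<omega>) \<le> \<bar>C\<bar> + b" for n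
    using limit by eventually_elim (use \<open>0 \<le> b\<close> in \<open>simp add: indicator_def\<close>)
  have conv: "AE \<omega> in M. (\<lambda>n. indicator B \<omega> * v n \<omega>) \<longlonglongrightarrow> indicator B \<omega> * L \<omega>"
    using limit by eventually_elim (simp add: indicator_def)
  have m: "(\<lambda>\<omega>. indicator B \<omega> * L \<omega>) \<in> borel_measurable M" "(\<lambda>\<omega>. indicator B \<omega> * v n \<omega>) \<in> borel_measurable M" for n
    by measurable
  have w: "integrable M (\<lambda>_. \<bar>C\<bar> + b)" by simp
  have intL: "integrable M (\<lambda>\<omega>. indicator B \<omega> * L \<omega>)"
    by (rule integrable_dominated_convergence[OF m w conv bnd])
  have dct: "(\<lambda>n. \<integral>\<omega>. indicator B \<omega> * v n \<omega> \<partial>M) \<longlonglongrightarrow> (\<integral>\<omega>. indicator B \<omega> * L \<omega> \<partial>M)"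
    by (rule integral_dominated_convergence[OF m w conv bnd])
  have bnd': "AE \<omega> in M. norm (indicator B \<omega> * v' \<omega>) \<le> \<bar>C\<bar> + b"
    using limit by eventually_elim (use \<open>0 \<le> b\<close> in \<open>simp add: indicator_def\<close>)
  have int': "integrable M (\<lambda>\<omega>. indicator B \<omega> * v' \<omega>)"
    by (rule integrable_const_bound[OF bnd']) measurable
  have "(\<integral>\<omega>. indicator B \<omega> * L \<omega> \<partial>M) = - max u 0 * G u"
    using dct unfolding In by (simp add: LIMSEQ_const_iff)
  then have zero: "(\<integral>\<omega>. indicator B \<omega> * L \<omega> - indicator B \<omega> * v' \<omega> \<partial>M) = 0"
    using intL int' I' by simp
  have nonneg: "AE \<omega> in M. 0 \<le> indicator B \<omega> * L \<omega> - indicator B \<omega> * v' \<omega>"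
    using limit by eventually_elim (simp add: indicator_def)
  \<comment> \<open>Once \<open>L\<close> and \<open>v'\<close> coincide on \<open>B\<close>, the
    inequality for \<psi> at \<open>L + A\<close> in \<open>limit\<close> is the inequality at the
    value of \<open>X\<close> itself.\<close>
  have "AE \<omega> in M. indicator B \<omega> * L \<omega> - indicator B \<omega> * v' \<omega> = 0"
    using integral_nonneg_eq_0_iff_AE[OF Bochner_Integration.integrable_diff[OF intL int'] nonneg] zero by blast
  then show ?thesis
    using limit AE_space
  proof eventually_elim
    case (elim \<omega>)
    then show ?case by (auto simp: B_def indicator_def)
  qed
qed

lemma regular_path: "regular \<omega> \<Longrightarrow> sigma_path (\<lambda>t. X t \<omega>) (\<lambda>t. A t \<omega>) \<psi>"
  by (simp add: regular_def)

lemma level_less_iff: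
  assumes "regular \<omega>" "\<sigma> \<omega> = ennreal s" "0 \<le> s"
  shows "\<tau> u \<omega> < \<sigma> \<omega> \<longleftrightarrow> u < A s \<omega>"
  using sigma_path.level_before_announced_iff[OF regular_path[OF assms(1)]] assms(2,3)
  by (simp add: \<tau>_def \<sigma>_def)

text \<open>If \<psi> vanishes at some \<open>C\<close>, then \<open>C\<close> bounds
  \<open>X\<close> from time 0 on, and level -1 encodes the start at 0. Otherwise a bound exists
  only behind a positive level, and the levels \<open>1 / Suc k\<close> exhaust all of them.\<close>

definition start_level :: "nat \<Rightarrow> real" where
  "start_level k = (if \<exists>C. \<psi> C = 0 then -1 else 1 / Suc k)"

lemma start_level_bound: "\<exists>C. \<psi> C \<le> ennreal (start_level k)"
proof (cases "\<exists>C. \<psi> C = 0")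
  case True
  then obtain C where "\<psi> C = 0" ..
  then show ?thesis by (intro exI[of _ C]) simp
qed (auto simp: start_level_def intro!: \<psi>_vanish)

text \<open>If \<psi> has no zero, the inequality of \<psi>(l) with \<open>A\<close> at \<sigma>
  forces \<open>A\<close> to be positive there, so some level \<open>1 / Suc k\<close> has already
  been passed.\<close>

lemma start_level_before:
  assumes "regular \<omega>"
  shows "\<exists>k. \<tau> (start_level k) \<omega> < \<sigma> \<omega>"
proof -
  interpret p: sigma_path "\<lambda>t. X t \<omega>" "\<lambda>t. A t \<omega>" \<psi> by (rule regular_path[OF assms])
  show ?thesis
  proof (cases "\<exists>C. \<psi> C = 0")
    case True
    then have "\<tau> (start_level 0) \<omega> = 0"
      by (simp add: start_level_def \<tau>_def p.level_time_neg)
    then show ?thesis using p.announced_pos by (intro exI[of _ 0]) (simp add: \<sigma>_def)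
  next
    case False
    show ?thesis
    proof (cases "\<sigma> \<omega>")
      case (real s)
      then obtain l where "\<psi> l \<le> ennreal (A s \<omega>)"
        using p.approx_tendsto[of s] by (auto simp: \<sigma>_def)
      with False have "0 < A s \<omega>"
        by (metis ennreal_neg not_gr_zero not_less le_zero_eq)
      then obtain k where "1 / Suc k < A s \<omega>"
        using nat_approx_posE by blast
      then show ?thesis
        using False level_less_iff[OF assms real(2,1)] by (intro exI[of _ k]) (simp add: start_level_def)
    next
      case top
      then show ?thesis using p.level_time_finite by (auto simp: \<tau>_def)
    qed
  qed
qed

lemma attained: "AE \<omega> in M. \<sigma> \<omega> < \<infinity> \<longrightarrow> \<psi> (X (enn2real (\<sigma> \<omega>)) \<omega>) \<le> ennreal (A (enn2real (\<sigma> \<omega>)) \<omega>)"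
proof -
  \<comment> \<open>The upper level \<open>real j + 2\<close> exceeds every start level, these being
    at most 1; countably many pairs of levels cover all finite \<sigma>.\<close>
  have "AE \<omega> in M. \<forall>k j. \<tau> (start_level k) \<omega> < \<sigma> \<omega> \<and> \<sigma> \<omega> \<le> \<tau> (real j + 2) \<omega> \<longrightarrow>
      \<psi> (X (enn2real (\<sigma> \<omega>)) \<omega>) \<le> ennreal (A (enn2real (\<sigma> \<omega>)) \<omega>)"
    unfolding AE_all_countable
  proof (intro allI)
    fix k j
    obtain C where C: "\<psi> C \<le> ennreal (start_level k)" using start_level_bound by blast
    have "start_level k \<le> 1" by (simp add: start_level_def)
    then show "AE \<omega> in M. \<tau> (start_level k) \<omega> < \<sigma> \<omega> \<and> \<sigma> \<omega> \<le> \<tau> (real j + 2) \<omega> \<longrightarrow>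
      \<psi> (X (enn2real (\<sigma> \<omega>)) \<omega>) \<le> ennreal (A (enn2real (\<sigma> \<omega>)) \<omega>)"
      by (intro attained_on_interval[OF _ _ C]) auto
  qed
  then show ?thesis
    using AE_regular
  proof eventually_elim
    case (elim \<omega>)
    show ?case
    proof
      assume "\<sigma> \<omega> < \<infinity>"
      then obtain s where s: "\<sigma> \<omega> = ennreal s" "0 \<le> s" by (cases "\<sigma> \<omega>") auto
      obtain k where k: "\<tau> (start_level k) \<omega> < \<sigma> \<omega>" using start_level_before[OF elim(2)] by blast
      obtain j :: nat where "A s \<omega> \<le> real j" using real_arch_simple by blast
      then have "\<not> \<tau> (real j + 2) \<omega> < \<sigma> \<omega>" using level_less_iff[OF elim(2) s] by simp
      with k elim(1) show "\<psi> (X (enn2real (\<sigma> \<omega>)) \<omega>) \<le> ennreal (A (enn2real (\<sigma> \<omega>)) \<omega>)"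
        by (meson not_less)
    qed
  qed
qed

section \<open>Balance inequalities for the tail of \<open>A\<close> at the exit time\<close>

lemma exit_value_bounds:
  assumes ub: "u < b" "0 \<le> b" and C: "\<psi> C \<le> ennreal u"
  defines "v \<equiv> right_value N (\<lambda>\<omega>. enn2real (min (\<sigma> \<omega>) (\<tau> b \<omega>)))"
  shows "AE \<omega> in M. \<tau> u \<omega> < \<sigma> \<omega> \<longrightarrow>
    (if \<tau> b \<omega> < \<sigma> \<omega> then v \<omega> = - b
     else v \<omega> \<le> C - max u 0 \<and> (\<forall>y. ennreal b < \<psi> y \<longrightarrow> y - b \<le> v \<omega>))"
  using AE_regular attained
proof eventually_elim
  case (elim \<omega>)
  interpret p: sigma_path "\<lambda>t. X t \<omega>" "\<lambda>t. A t \<omega>" \<psi> by (rule regular_path[OF elim(1)])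
  have v: "v \<omega> = X (enn2real (min (\<sigma> \<omega>) (\<tau> b \<omega>))) \<omega> - A (enn2real (min (\<sigma> \<omega>) (\<tau> b \<omega>))) \<omega>"
    unfolding v_def by (rule right_value_N[OF elim(1)])
  show ?case
  proof
    assume less: "\<tau> u \<omega> < \<sigma> \<omega>"
    show "if \<tau> b \<omega> < \<sigma> \<omega> then v \<omega> = - b
      else v \<omega> \<le> C - max u 0 \<and> (\<forall>y. ennreal b < \<psi> y \<longrightarrow> y - b \<le> v \<omega>)"
    proof (cases "\<tau> b \<omega> < \<sigma> \<omega>")
      case True
      then have "v \<omega> = X (enn2real (\<tau> b \<omega>)) \<omega> - A (enn2real (\<tau> b \<omega>)) \<omega>"
        unfolding v by (simp add: min_absorb2)
      also have "\<dots> = - b"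
        using p.x_level_time[of b] p.a_level_time[of b] \<open>0 \<le> b\<close> by (simp add: \<tau>_def)
      finally show ?thesis using True by simp
    next
      case False
      then have le: "\<sigma> \<omega> \<le> \<tau> b \<omega>" by simp
      have "\<tau> b \<omega> < \<infinity>" unfolding \<tau>_def by (rule p.level_time_finite)
      with le have fin: "\<sigma> \<omega> < \<infinity>" by (rule le_less_trans)
      then obtain s where s: "\<sigma> \<omega> = ennreal s" "0 \<le> s" by (cases "\<sigma> \<omega>") auto
      have vs: "v \<omega> = X s \<omega> - A s \<omega>" using le s by (simp add: v min_absorb1)
      have u: "u < A s \<omega>" using less level_less_iff[OF elim(1) s] by simp
      have b: "A s \<omega> \<le> b" using False level_less_iff[OF elim(1) s] by simp
      have "X s \<omega> \<le> C"
        using p.bounded_until_announced[OF _ C s(2)] less s by (simp add: \<tau>_def \<sigma>_def less_imp_le)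
      then have "v \<omega> \<le> C - max u 0"
        using u p.a_nonneg[OF s(2)] by (simp add: vs)
      \<comment> \<open>Attainment at \<sigma> is what gives this lower bound: \<psi>(X) \<le> A
        \<le> b < \<psi>(y) puts \<open>X\<close> above \<open>y\<close>.\<close>
      moreover have "y - b \<le> v \<omega>" if y: "ennreal b < \<psi> y" for y
      proof -
        have "\<psi> (X s \<omega>) \<le> ennreal (A s \<omega>)" using elim(2) fin s by simp
        also have "\<dots> \<le> ennreal b" using b by (rule ennreal_leI)
        also note y
        finally have "\<not> X s \<omega> \<le> y" using \<psi>_anti[of "X s \<omega>" y] by auto
        with b show ?thesis by (simp add: vs)
      qed
      ultimately show ?thesis using False by simp
    qed
  qed
qed

text \<open>The value of \<open>N\<close> at the earlier of \<sigma> and \<tau>(b) is -b with weight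
  \<open>G b\<close>, and lies between \<open>y - b\<close> and \<open>C - max u 0\<close> with
  weight \<open>G u - G b\<close>; its mean is known from the stopping identity. As \<open>y\<close>
  approaches \<phi>(b) and \<open>C\<close> equals \<phi>(u), this is the integrated form of the
  differential equation for \<open>G\<close>.\<close>

lemma
  assumes ub: "u < b" "0 \<le> b" and C: "\<psi> C \<le> ennreal u"
  shows G_upper: "ennreal b < \<psi> y \<Longrightarrow> y * (G u - G b) \<le> (b - max u 0) * G u"
    and G_lower: "(b - max u 0) * G b \<le> C * (G u - G b)"
proof -
  define v where "v = right_value N (\<lambda>\<omega>. enn2real (min (\<sigma> \<omega>) (\<tau> b \<omega>)))"
  define B where "B c = {\<omega>\<in>space M. \<tau> c \<omega> < \<sigma> \<omega>}" for c
  have [measurable]: "B c \<in> sets M" for c unfolding B_def by measurable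
  have BB: "B b \<subseteq> B u"
    unfolding B_def using \<tau>_mono[of u b] ub by (auto intro: le_less_trans)
  have Q: "optional_time F (\<lambda>\<omega>. min (\<sigma> \<omega>) (\<tau> b \<omega>))"
    by (intro optional_time_min optional_\<tau> optional_\<sigma>)
  have vm [measurable]: "v \<in> borel_measurable M"
    unfolding v_def by (rule right_value_N_measurable[OF optional_time_measurable[OF Q]])
  have I: "(\<integral>\<omega>. indicator (B u) \<omega> * v \<omega> \<partial>M) = - max u 0 * G u"
    unfolding B_def v_def using \<tau>_mono[of u b] ub
    by (intro stopping_identity[OF ub C Q]) (simp_all add: less_imp_le)
  have bnd: "AE \<omega> in M. norm (indicator (B u) \<omega> * v \<omega>) \<le> \<bar>C\<bar> + b"
    using AE_regular
  proof eventually_elim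
    case (elim \<omega>)
    have fin: "\<tau> b \<omega> < \<infinity>"
      unfolding \<tau>_def by (rule sigma_path.level_time_finite[OF regular_path[OF elim]])
    show ?case
    proof (cases "\<tau> u \<omega> < \<sigma> \<omega>")
      case True
      have e: "ennreal (enn2real (min (\<sigma> \<omega>) (\<tau> b \<omega>))) = min (\<sigma> \<omega>) (\<tau> b \<omega>)"
        using fin by (intro ennreal_enn2real) (simp add: min_less_iff_disj)
      have "\<bar>v \<omega>\<bar> \<le> \<bar>C\<bar> + b"
        unfolding v_def right_value_N[OF elim] using True \<tau>_mono[of u b \<omega>] ub
        by (intro N_bounded[OF elim True C \<open>0 \<le> b\<close>]) (simp_all add: e)
      then show ?thesis using \<open>0 \<le> b\<close> by (auto simp: indicator_def)
    next
      case False
      then show ?thesis using \<open>0 \<le> b\<close> by (simp add: B_def)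
    qed
  qed
  have int: "integrable M (\<lambda>\<omega>. indicator (B u) \<omega> * v \<omega>)"
    by (rule integrable_const_bound[OF bnd]) measurable
  have w: "(\<integral>\<omega>. - b * indicator (B b) \<omega> + c * (indicator (B u) \<omega> - indicator (B b) \<omega>) \<partial>M) = - b * G b + c * (G u - G b)"
    "integrable M (\<lambda>\<omega>. - b * indicator (B b) \<omega> + c * (indicator (B u) \<omega> - indicator (B b) \<omega>))" for c :: real
    by (simp_all add: G_def B_def[symmetric] less_top[symmetric] emeasure_eq_measure)
  note bounds = exit_value_bounds[OF ub C, folded v_def]
  {
    assume y: "ennreal b < \<psi> y"
    have "- b * G b + (y - b) * (G u - G b) \<le> - max u 0 * G u"
      unfolding w(1)[symmetric] I[symmetric]
    proof (rule integral_mono_AE[OF w(2) int])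
      show "AE \<omega> in M. - b * indicator (B b) \<omega> + (y - b) * (indicator (B u) \<omega> - indicator (B b) \<omega>) \<le> indicator (B u) \<omega> * v \<omega>"
        using bounds
        by eventually_elim (use BB y in \<open>auto simp: indicator_def B_def split: if_splits\<close>)
    qed
    then show "y * (G u - G b) \<le> (b - max u 0) * G u" by (simp add: algebra_simps)
  }
  have "- max u 0 * G u \<le> - b * G b + (C - max u 0) * (G u - G b)"
    unfolding w(1)[symmetric] I[symmetric]
  proof (rule integral_mono_AE[OF int w(2)])
    show "AE \<omega> in M. indicator (B u) \<omega> * v \<omega> \<le> - b * indicator (B b) \<omega> + (C - max u 0) * (indicator (B u) \<omega> - indicator (B b) \<omega>)"
      using bounds
      by eventually_elim (use BB in \<open>auto simp: indicator_def B_def split: if_splits\<close>)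
  qed
  then show "(b - max u 0) * G b \<le> C * (G u - G b)" by (simp add: algebra_simps)
qed

lemma G_le_1: "G u \<le> 1"
  unfolding G_def by simp

lemma G_nonneg: "0 \<le> G u"
  unfolding G_def by simp

text \<open>If \<psi> has no zero, \<open>A\<close> is positive at \<sigma> on almost every path. If
  it has one, a path could exit while \<open>A\<close> is still 0; the upper balance inequality from
  level -1, where \<open>G\<close> is 1, shows that the probability of exiting by level b is at most
  b / y.\<close>

lemma G_tendsto_1: "(G \<longlongrightarrow> 1) (at_right 0)"
proof (rule order_tendstoI)
  fix e :: real assume "1 < e"
  then have "G b < e" for b using G_le_1[of b] by simp
  then show "\<forall>\<^sub>F b in at_right 0. G b < e" by simp
next
  fix e :: real assume e: "e < 1"
  have ex: "\<exists>c>0. e < G c"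
  proof (cases "\<exists>C. \<psi> C = 0")
    case True
    then obtain C where "\<psi> C = 0" ..
    then have C: "\<psi> C \<le> ennreal (-1)" by simp
    have G1: "G (-1) = 1"
    proof -
      have "AE \<omega> in M. \<tau> (-1) \<omega> < \<sigma> \<omega>"
        using AE_regular
      proof eventually_elim
        case (elim \<omega>)
        interpret p: sigma_path "\<lambda>t. X t \<omega>" "\<lambda>t. A t \<omega>" \<psi> by (rule regular_path[OF elim])
        show ?case using p.announced_pos by (simp add: \<tau>_def \<sigma>_def p.level_time_neg)
      qed
      then show ?thesis unfolding G_def by (intro prob_Collect_eq_1[THEN iffD2]) auto
    qed
    have "(\<psi> \<longlongrightarrow> \<psi> 0) (at_right 0)"
      using \<psi>_cont by (auto simp: continuous_on_def intro: tendsto_within_subset)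
    from order_tendstoD(1)[OF this \<psi>_0] obtain d :: real where d: "0 < d" "\<And>y. 0 < y \<Longrightarrow> y < d \<Longrightarrow> 0 < \<psi> y"
      unfolding eventually_at_right_field by blast
    define y where "y = d / 2"
    have y: "0 < y" "0 < \<psi> y" using d by (auto simp: y_def)
    obtain c where c: "0 \<le> c" "0 < ennreal c" "ennreal c < \<psi> y"
      using ennreal_Rats_dense[OF y(2)] by metis
    \<comment> \<open>The bound by \<open>c\<close> keeps \<open>b\<close> below \<psi>(y), as the
      balance inequality requires; the other bound makes b / y smaller than 1 - e.\<close>
    define b where "b = min c (y * (1 - e) / 2)"
    have b: "0 < b" "b \<le> c" "b < y * (1 - e)"
      using c y e by (auto simp: b_def min_less_iff_disj)
    have "y * (G (-1) - G b) \<le> (b - max (-1) 0) * G (-1)"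
      using b(1) le_less_trans[OF ennreal_leI[OF b(2)] c(3)] by (intro G_upper[OF _ _ C]) auto
    then have "y * (1 - G b) < y * (1 - e)" using b G1 by simp
    then have "e < G b" using y by simp
    with b show ?thesis by blast
  next
    case False
    have "(\<lambda>k. measure M {\<omega>\<in>space M. \<tau> (1 / Suc k) \<omega> < \<sigma> \<omega>}) \<longlonglongrightarrow>
        measure M (\<Union>k. {\<omega>\<in>space M. \<tau> (1 / Suc k) \<omega> < \<sigma> \<omega>})"
    proof (rule finite_Lim_measure_incseq)
      show "incseq (\<lambda>k. {\<omega>\<in>space M. \<tau> (1 / Suc k) \<omega> < \<sigma> \<omega>})"
      proof (rule incseq_SucI)
        fix k :: nat
        have "\<tau> (1 / Suc (Suc k)) \<omega> \<le> \<tau> (1 / Suc k) \<omega>" for \<omega>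
          by (intro \<tau>_mono divide_left_mono) simp_all
        then show "{\<omega>\<in>space M. \<tau> (1 / Suc k) \<omega> < \<sigma> \<omega>} \<subseteq> {\<omega>\<in>space M. \<tau> (1 / Suc (Suc k)) \<omega> < \<sigma> \<omega>}"
          by (auto intro: le_less_trans simp del: of_nat_Suc)
      qed
    qed auto
    moreover have "measure M (\<Union>k. {\<omega>\<in>space M. \<tau> (1 / Suc k) \<omega> < \<sigma> \<omega>}) = 1"
    proof (subst prob_eq_1)
      show "AE \<omega> in M. \<omega> \<in> (\<Union>k. {\<omega>\<in>space M. \<tau> (1 / Suc k) \<omega> < \<sigma> \<omega>})"
        using AE_regular AE_space
      proof eventually_elim
        case (elim \<omega>)
        then show ?case using start_level_before[OF elim(1)] False by (simp add: start_level_def)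
      qed
    qed auto
    ultimately have "(\<lambda>k. G (1 / Suc k)) \<longlonglongrightarrow> 1" by (simp add: G_def)
    from order_tendstoD(1)[OF this e] obtain k where "e < G (1 / Suc k)"
      by (auto simp: eventually_sequentially)
    then show ?thesis by (intro exI[of _ "1 / Suc k"]) simp
  qed
  then obtain c where c: "0 < c" "e < G c" by blast
  then show "\<forall>\<^sub>F b in at_right 0. e < G b"
    unfolding eventually_at_right_field using G_antimono less_le_trans by (metis less_imp_le)
qed

end

subsection \<open>Solutions of the balance equation\<close>

text \<open>On an equidistant partition the first terms telescope to mesh times
  \<open>m b - m a\<close>, and the squares sum up to a multiple of the mesh. No continuity of
  \<open>m\<close> is needed, so a coefficient with jumps is allowed.\<close>

lemma constant_if_small_increments:
  fixes Q m :: "real \<Rightarrow> real"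
  assumes "a < b"
    and inc: "\<And>s t. a \<le> s \<Longrightarrow> s < t \<Longrightarrow> t \<le> b \<Longrightarrow> \<bar>Q t - Q s\<bar> \<le> (t - s) * (m t - m s) + D * (t - s)\<^sup>2"
  shows "Q a = Q b"
proof -
  define E where "E = (b - a) * (m b - m a) + D * (b - a)\<^sup>2"
  have E: "\<bar>Q b - Q a\<bar> \<le> E / Suc n" for n
  proof -
    define d where "d = (b - a) / Suc n"
    have d: "0 < d" "real (Suc n) * d = b - a" using assms(1) by (simp_all add: d_def)
    define x where "x k = a + real k * d" for k
    have "\<bar>Q (x k) - Q a\<bar> \<le> d * (m (x k) - m a) + real k * (D * d\<^sup>2)" if "k \<le> Suc n" for k
      using that
    proof (induction k)
      case 0
      then show ?case by (simp add: x_def)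
    next
      case (Suc k)
      have "real (Suc k) * d \<le> real (Suc n) * d"
        using Suc.prems d by (intro mult_right_mono) auto
      then have "x (Suc k) \<le> b" unfolding x_def using d(2) by linarith
      moreover have "a \<le> x k" "x (Suc k) - x k = d" using d by (simp_all add: x_def algebra_simps)
      ultimately have "\<bar>Q (x (Suc k)) - Q (x k)\<bar> \<le> d * (m (x (Suc k)) - m (x k)) + D * d\<^sup>2"
        using inc[of "x k" "x (Suc k)"] d(1) by simp
      with Suc.IH Suc.prems show ?case by (simp add: algebra_simps)
    qed
    from this[of "Suc n"] have "\<bar>Q b - Q a\<bar> \<le> d * (m b - m a) + real (Suc n) * (D * d\<^sup>2)"
      using d(2) by (simp add: x_def)
    also have "real (Suc n) * (D * d\<^sup>2) = D * d * (real (Suc n) * d)"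
      by (simp add: power2_eq_square algebra_simps)
    also have "d * (m b - m a) + D * d * (real (Suc n) * d) = E / Suc n"
      unfolding d(2) by (simp add: E_def d_def power2_eq_square add_divide_distrib)
    finally show ?thesis .
  qed
  have "(\<lambda>n. E / Suc n) \<longlonglongrightarrow> 0"
    using tendsto_mult[OF tendsto_const[of E] LIMSEQ_inverse_real_of_nat] by (simp add: divide_inverse)
  then have "\<bar>Q b - Q a\<bar> \<le> 0"
    by (rule LIMSEQ_le_const) (use E in blast)
  then show ?thesis by simp
qed

text \<open>Both \<open>G\<close> and \<open>K\<close> satisfy \<open>dG / G = - ds / g\<close> in a form that does not refer to derivatives.\<close>

lemma proportional_solutions:
  fixes G K g :: "real \<Rightarrow> real"
  assumes "a < b"
    and G: "\<And>s t. a \<le> s \<Longrightarrow> s < t \<Longrightarrow> t \<le> b \<Longrightarrow> g t * (G s - G t) \<le> (t - s) * G s"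
      "\<And>s t. a \<le> s \<Longrightarrow> s < t \<Longrightarrow> t \<le> b \<Longrightarrow> (t - s) * G t \<le> g s * (G s - G t)"
    and K: "\<And>s t. a \<le> s \<Longrightarrow> s < t \<Longrightarrow> t \<le> b \<Longrightarrow> g t * (K s - K t) \<le> (t - s) * K s"
      "\<And>s t. a \<le> s \<Longrightarrow> s < t \<Longrightarrow> t \<le> b \<Longrightarrow> (t - s) * K t \<le> g s * (K s - K t)"
    and g: "\<And>s. a \<le> s \<Longrightarrow> s \<le> b \<Longrightarrow> 0 < g s" "\<And>s t. a \<le> s \<Longrightarrow> s \<le> t \<Longrightarrow> t \<le> b \<Longrightarrow> g t \<le> g s"
    and pos: "\<And>s. a \<le> s \<Longrightarrow> s \<le> b \<Longrightarrow> 0 \<le> G s" "\<And>s. a \<le> s \<Longrightarrow> s \<le> b \<Longrightarrow> 0 < K s"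
  shows "G a / K a = G b / K b"
proof -
  \<comment> \<open>Both functions are nonincreasing, so this quotient of extreme values bounds
    \<open>G / K\<close> on the whole interval.\<close>
  define C where "C = G a / K b"
  have anti: "f t \<le> f s" if f: "(t - s) * f t \<le> g s * (f s - f t)" "0 \<le> f t" and st: "a \<le> s" "s \<le> t" "t \<le> b" for f s t
  proof -
    have "0 \<le> g s * (f s - f t)" using f st by (intro order_trans[OF _ f(1)]) auto
    then show ?thesis using g(1)[of s] st by (simp add: zero_le_mult_iff)
  qed
  have Ga: "G s \<le> G a" if "a \<le> s" "s \<le> b" for s
    using anti[of s a G] G(2)[of a s] pos(1)[of s] that by (cases "a = s") auto
  have Kb: "K b \<le> K s" if "a \<le> s" "s \<le> b" for s
    using anti[of b s K] K(2)[of s b] pos(2)[of b] that by (cases "s = b") auto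
  have QC: "G s / K s \<le> C" "0 \<le> G s / K s" if "a \<le> s" "s \<le> b" for s
    using Ga[OF that] Kb[OF that] pos(1)[OF that] pos(2)[of b] pos(2)[OF that] assms(1)
    unfolding C_def by (auto intro!: frac_le)
  have C0: "0 \<le> C" using QC[of a] assms(1) by auto
  show ?thesis
  proof (rule constant_if_small_increments[OF assms(1), where Q="\<lambda>s. G s / K s" and m="\<lambda>s. C / g s" and D="C / (g b)\<^sup>2"])
    fix s t assume st: "a \<le> s" "s < t" "t \<le> b"
    \<comment> \<open>The hypotheses say that over a step from \<open>s\<close> to \<open>t\<close>
      both functions are multiplied by a factor between \<open>1 - q\<close> and
      \<open>1 / (1 + p)\<close>.\<close>
    define p where "p = (t - s) / g s"
    define q where "q = (t - s) / g t"
    have gs: "0 < g s" "0 < g t" "g t \<le> g s" "0 < g b" "g b \<le> g t" using g st by auto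
    have p: "0 \<le> p" "p \<le> q" using gs st by (auto simp: p_def q_def intro!: divide_left_mono)
    have "(1 - q) * G s \<le> G t" "(1 + p) * G t \<le> G s" "(1 - q) * K s \<le> K t" "(1 + p) * K t \<le> K s"
      using G[OF st] K[OF st] gs unfolding p_def q_def by (simp_all add: field_simps)
    note b = this
    have nn: "0 \<le> G s" "0 \<le> G t" "0 < K s" "0 < K t" using pos st by auto
    have "((1 + p) * G t) * ((1 - q) * K s) \<le> ((1 + p) * G t) * K t"
      using b(3) nn p by (intro mult_left_mono) auto
    also have "\<dots> \<le> G s * K t" using b(2) nn by (intro mult_right_mono) auto
    finally have 1: "G t / K t * ((1 + p) * (1 - q)) \<le> G s / K s"
      using nn by (simp add: field_simps)
    have "((1 - q) * G s) * ((1 + p) * K t) \<le> G t * ((1 + p) * K t)"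
      using b(1) nn p by (intro mult_right_mono) auto
    also have "\<dots> \<le> G t * K s" using b(4) nn by (intro mult_left_mono) auto
    finally have 2: "G s / K s * ((1 + p) * (1 - q)) \<le> G t / K t"
      using nn by (simp add: field_simps)
    \<comment> \<open>\<open>1 - e\<close> is the product \<open>(1 + p) * (1 - q)\<close>, which
      limits how far the two quotients can differ. In \<open>e\<close> the part \<open>q - p\<close>
      is an increment of 1 / g times \<open>t - s\<close> and telescopes; the part
      \<open>p * q\<close> is quadratic in \<open>t - s\<close>.\<close>
    define e where "e = q - p + p * q"
    have "0 \<le> p * q" using p by (intro mult_nonneg_nonneg) auto
    with p(2) have e: "0 \<le> e" "(1 + p) * (1 - q) = 1 - e"
      unfolding e_def by (linarith, simp add: algebra_simps)
    have "G t / K t * e \<le> C * e" "G s / K s * e \<le> C * e"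
      using QC st e by (auto intro!: mult_right_mono simp del: times_divide_eq_left)
    moreover have "G t / K t - G t / K t * e \<le> G s / K s" "G s / K s - G s / K s * e \<le> G t / K t"
      using 1 2 unfolding e(2) by (simp_all only: right_diff_distrib mult_1_right)
    ultimately have "\<bar>G t / K t - G s / K s\<bar> \<le> C * e"
      by linarith
    also have "C * e = C * (q - p) + C * (p * q)" by (simp add: e_def algebra_simps)
    also have "C * (p * q) \<le> C * ((t - s)\<^sup>2 / (g b)\<^sup>2)"
    proof (intro mult_left_mono C0)
      have "p \<le> (t - s) / g b" "q \<le> (t - s) / g b"
        unfolding p_def q_def using gs st by (auto intro!: divide_left_mono)
      then have "p * q \<le> ((t - s) / g b) * ((t - s) / g b)" using p by (intro mult_mono) auto
      then show "p * q \<le> (t - s)\<^sup>2 / (g b)\<^sup>2" by (simp add: power2_eq_square)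
    qed
    finally show "\<bar>G t / K t - G s / K s\<bar> \<le> (t - s) * (C / g t - C / g s) + C / (g b)\<^sup>2 * (t - s)\<^sup>2"
      by (simp add: p_def q_def algebra_simps)
  qed
qed

subsection \<open>The embedded law\<close>

locale embedded_law = real_distribution \<theta> for \<theta> :: "real measure" +
  assumes null_neg: "emeasure \<theta> {..<0} = 0"
    and no_atoms: "\<And>z. emeasure \<theta> {z} = 0"
    and finite_mean: "integrable \<theta> (\<lambda>z. z)"
begin

abbreviation "\<Phi> \<equiv> cdf \<theta>"

lemma \<Phi>_cont: "isCont \<Phi> x"
  by (simp add: isCont_cdf measure_def no_atoms)

lemma \<Phi>_measurable [measurable]: "\<Phi> \<in> borel_measurable borel"
  by (intro borel_measurable_continuous_onI) (simp add: continuous_on_eq_continuous_at \<Phi>_cont)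

lemma emeasure_Icc: "emeasure \<theta> {0..z} = ennreal (\<Phi> z)"
proof -
  have "emeasure \<theta> {..z} = emeasure \<theta> {0..z}"
  proof (rule emeasure_eq_AE)
    have "AE x in \<theta>. x \<notin> {..<0}"
      by (rule AE_not_in) (simp add: null_sets_def null_neg)
    then show "AE x in \<theta>. x \<in> {..z} \<longleftrightarrow> x \<in> {0..z}"
      by eventually_elim auto
  qed auto
  then show ?thesis by (simp add: cdf_def emeasure_eq_measure)
qed

lemma emeasure_Ioc: "y \<le> z \<Longrightarrow> emeasure \<theta> {y<..z} = ennreal (\<Phi> z - \<Phi> y)"
  using cdf_diff_eq[of y z] by (cases "y = z") (auto simp: emeasure_eq_measure)

lemma \<Phi>_0: "z \<le> 0 \<Longrightarrow> \<Phi> z = 0"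
proof -
  assume "z \<le> 0"
  have "emeasure \<theta> {0..z} \<le> emeasure \<theta> {0}" using \<open>z \<le> 0\<close> by (intro emeasure_mono) auto
  then show ?thesis using emeasure_Icc[of z] no_atoms[of 0] cdf_nonneg[of z] by simp
qed

lemma \<Phi>_surj:
  assumes "0 < p" "p < 1"
  obtains z where "0 < z" "\<Phi> z = p"
proof -
  have "\<forall>\<^sub>F z in at_top. p < \<Phi> z"
    using order_tendstoD(1)[OF cdf_lim_at_top_prob assms(2)] .
  then obtain k where k: "\<And>z. k \<le> z \<Longrightarrow> p < \<Phi> z" by (auto simp: eventually_at_top_linorder)
  have "\<exists>z. 0 \<le> z \<and> z \<le> max 0 k \<and> \<Phi> z = p"
    using k[of "max 0 k"] assms(1) \<Phi>_0[of 0] \<Phi>_cont by (intro IVT) auto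
  then obtain z where "0 \<le> z" "\<Phi> z = p" by blast
  then show thesis using that[of z] \<Phi>_0[of z] assms(1) by (cases "z = 0") auto
qed

section \<open>The measure whose tail is \<psi>\<close>

definition rate :: "real \<Rightarrow> ennreal" where "rate z = ennreal z / emeasure \<theta> {0..z}"
text \<open>\<psi>(x) is the \<nu>-mass of (x, \<infinity>), so continuity and increments of \<psi>
  become statements about \<nu>. The rate is infinite at positive points where \<Phi> vanishes, but
  these form a \<theta>-null set.\<close>

definition \<nu> :: "real measure" where "\<nu> = density \<theta> rate"
abbreviation "\<psi> \<equiv> psi_bar \<theta>"

lemma rate_measurable [measurable]: "rate \<in> borel_measurable borel"
  unfolding rate_def[abs_def] emeasure_Icc by measurable

lemma sets_\<nu> [simp, measurable_cong]: "sets \<nu> = sets borel"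
  by (simp add: \<nu>_def)

lemma \<nu>_eq: "D \<in> sets borel \<Longrightarrow> emeasure \<nu> D = (\<integral>\<^sup>+z. rate z * indicator D z \<partial>\<theta>)"
  unfolding \<nu>_def by (intro emeasure_density) auto

lemma psi_eq: "\<psi> x = emeasure \<nu> {x<..}"
  unfolding psi_bar_def by (simp add: \<nu>_eq rate_def)

lemma psi_anti: "y \<le> z \<Longrightarrow> \<psi> z \<le> \<psi> y"
  unfolding psi_eq by (intro emeasure_mono) auto

lemma null_\<nu>: "emeasure \<theta> D = 0 \<Longrightarrow> D \<in> sets borel \<Longrightarrow> emeasure \<nu> D = 0"
proof -
  assume D: "emeasure \<theta> D = 0" "D \<in> sets borel"
  then have "AE x in \<theta>. x \<notin> D" by (intro AE_not_in) (simp add: null_sets_def)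
  then have "D \<in> null_sets \<nu>"
    unfolding \<nu>_def using D(2) by (subst null_sets_density_iff) (auto elim!: eventually_mono)
  then show ?thesis by auto
qed

lemma null_\<theta>: "emeasure \<nu> D = 0 \<Longrightarrow> D \<in> sets borel \<Longrightarrow> D \<subseteq> {0<..} \<Longrightarrow> emeasure \<theta> D = 0"
proof -
  assume D: "emeasure \<nu> D = 0" "D \<in> sets borel" "D \<subseteq> {0<..}"
  then have "D \<in> null_sets \<nu>" by (simp add: null_sets_def)
  then have "AE x in \<theta>. x \<in> D \<longrightarrow> rate x = 0"
    unfolding \<nu>_def by (subst (asm) null_sets_density_iff) auto
  then have "AE x in \<theta>. x \<notin> D"
    by eventually_elim (use D(3) in \<open>auto simp: rate_def emeasure_eq_measure\<close>)
  then show ?thesis using D(2) AE_iff_null_sets[of D \<theta>] by auto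
qed

lemma \<nu>_Ioc_split: "y \<le> z \<Longrightarrow> \<psi> y = emeasure \<nu> {y<..z} + \<psi> z"
  unfolding psi_eq by (subst plus_emeasure) (auto intro: arg_cong[where f="emeasure \<nu>"])

text \<open>By monotonicity of \<Phi> the rate on (y, z] lies between \<open>y / \<Phi> z\<close>
  and \<open>z / \<Phi> y\<close>. This bound and its counterpart \<open>\<nu>_upper\<close> become
  the two balance inequalities of \<open>K\<close>.\<close>

lemma \<nu>_lower:
  assumes "0 \<le> y" "y \<le> z" "0 < \<Phi> z"
  shows "ennreal (y * (\<Phi> z - \<Phi> y) / \<Phi> z) \<le> emeasure \<nu> {y<..z}"
proof -
  have "ennreal (y * (\<Phi> z - \<Phi> y) / \<Phi> z) = ennreal (y / \<Phi> z) * emeasure \<theta> {y<..z}"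
    using assms cdf_nondecreasing[of y z] by (simp add: emeasure_Ioc ennreal_mult[symmetric])
  also have "\<dots> = (\<integral>\<^sup>+u. ennreal (y / \<Phi> z) * indicator {y<..z} u \<partial>\<theta>)"
    by (simp add: nn_integral_cmult_indicator)
  also have "\<dots> \<le> (\<integral>\<^sup>+u. rate u * indicator {y<..z} u \<partial>\<theta>)"
  proof (intro nn_integral_mono)
    fix u
    show "ennreal (y / \<Phi> z) * indicator {y<..z} u \<le> rate u * indicator {y<..z} u"
    proof (cases "u \<in> {y<..z}")
      case True
      have "ennreal (y / \<Phi> z) \<le> rate u"
      proof (cases "\<Phi> u = 0")
        case True
        then show ?thesis using \<open>u \<in> _\<close> assms(1) by (simp add: rate_def emeasure_Icc ennreal_divide_eq_top_iff)
      next
        case False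
        then have "0 < \<Phi> u" using cdf_nonneg[of u] by simp
        moreover have "y / \<Phi> z \<le> u / \<Phi> u"
          using True assms cdf_nondecreasing[of u z] \<open>0 < \<Phi> u\<close> by (intro frac_le) auto
        ultimately show ?thesis
          using True assms(1) by (simp add: rate_def emeasure_Icc divide_ennreal ennreal_leI)
      qed
      with True show ?thesis by simp
    qed simp
  qed
  finally show ?thesis by (simp add: \<nu>_eq)
qed

lemma \<nu>_upper:
  assumes "0 \<le> y" "y \<le> z" "0 < \<Phi> y"
  shows "emeasure \<nu> {y<..z} \<le> ennreal (z * (\<Phi> z - \<Phi> y) / \<Phi> y)"
proof -
  have "emeasure \<nu> {y<..z} = (\<integral>\<^sup>+u. rate u * indicator {y<..z} u \<partial>\<theta>)" by (simp add: \<nu>_eq)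
  also have "\<dots> \<le> (\<integral>\<^sup>+u. ennreal (z / \<Phi> y) * indicator {y<..z} u \<partial>\<theta>)"
  proof (intro nn_integral_mono)
    fix u
    show "rate u * indicator {y<..z} u \<le> ennreal (z / \<Phi> y) * indicator {y<..z} u"
    proof (cases "u \<in> {y<..z}")
      case True
      have u: "\<Phi> y \<le> \<Phi> u" using True by (intro cdf_nondecreasing) simp
      moreover have "u / \<Phi> u \<le> z / \<Phi> y"
        using True assms u by (intro frac_le) auto
      ultimately have "rate u \<le> ennreal (z / \<Phi> y)"
        using True assms by (simp add: rate_def emeasure_Icc divide_ennreal ennreal_leI)
      with True show ?thesis by simp
    qed simp
  qed
  also have "\<dots> = ennreal (z / \<Phi> y) * emeasure \<theta> {y<..z}"
    by (simp add: nn_integral_cmult_indicator)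
  also have "\<dots> = ennreal (z * (\<Phi> z - \<Phi> y) / \<Phi> y)"
    using assms cdf_nondecreasing[of y z] by (simp add: emeasure_Ioc ennreal_mult[symmetric])
  finally show ?thesis .
qed

text \<open>Beyond \<open>x\<close> the rate at u is at most \<open>u / \<Phi> x\<close>, which is
  integrable because the mean is finite.\<close>

lemma psi_finite:
  assumes "0 < \<Phi> x"
  shows "\<psi> x < \<infinity>"
proof -
  have "0 < x" using assms \<Phi>_0[of x] by (cases "x \<le> 0") auto
  have "\<psi> x = (\<integral>\<^sup>+u. rate u * indicator {x<..} u \<partial>\<theta>)" by (simp add: psi_eq \<nu>_eq)
  also have "\<dots> \<le> (\<integral>\<^sup>+u. ennreal (1 / \<Phi> x) * ennreal (norm u) \<partial>\<theta>)"
  proof (intro nn_integral_mono)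
    fix u
    show "rate u * indicator {x<..} u \<le> ennreal (1 / \<Phi> x) * ennreal (norm u)"
    proof (cases "u \<in> {x<..}")
      case True
      have u: "\<Phi> x \<le> \<Phi> u" using True by (intro cdf_nondecreasing) simp
      have "rate u = ennreal (u / \<Phi> u)"
        using True \<open>0 < x\<close> assms u by (simp add: rate_def emeasure_Icc divide_ennreal)
      also have "\<dots> \<le> ennreal (u / \<Phi> x)"
        using True \<open>0 < x\<close> assms u by (intro ennreal_leI divide_left_mono) auto
      also have "\<dots> = ennreal (1 / \<Phi> x) * ennreal (norm u)"
        using True \<open>0 < x\<close> assms by (simp add: ennreal_mult[symmetric])
      finally show ?thesis using True by simp
    qed simp
  qed
  also have "\<dots> = ennreal (1 / \<Phi> x) * (\<integral>\<^sup>+u. ennreal (norm u) \<partial>\<theta>)"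
    by (intro nn_integral_cmult) simp
  also have "\<dots> < \<infinity>"
    using finite_mean by (auto simp: integrable_iff_bounded ennreal_mult_less_top)
  finally show ?thesis .
qed

text \<open>Near the left end point of the support \<open>d\<Phi> / \<Phi>\<close> has infinite mass.\<close>

lemma psi_infinite:
  assumes "0 < x" "\<Phi> x = 0"
  shows "\<psi> x = \<infinity>"
proof (rule ccontr)
  assume "\<psi> x \<noteq> \<infinity>"
  define Z where "Z = {z. \<Phi> z = 0}"
  obtain w where w: "0 < w" "\<Phi> w = 1/2" using \<Phi>_surj[of "1/2"] by auto
  have le_w: "z \<le> w" if "z \<in> Z" for z
    using that w(2) cdf_nondecreasing[of w z] by (cases "z \<le> w") (auto simp: Z_def)
  then have bdd: "bdd_above Z" by (auto simp: bdd_above_def)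
  have "closed Z"
    unfolding Z_def using \<Phi>_cont by (intro closed_Collect_eq) (auto simp: continuous_on_eq_continuous_at)
  moreover have "x \<in> Z" using assms by (simp add: Z_def)
  ultimately have x0: "Sup Z \<in> Z" using bdd by (intro closed_contains_Sup) auto
  define x0 where "x0 = Sup Z"
  have x0': "x \<le> x0" "\<Phi> x0 = 0" using x0 \<open>x \<in> Z\<close> cSup_upper[OF _ bdd] by (auto simp: x0_def Z_def)
  have pos: "0 < \<Phi> z" if "x0 < z" for z
    using that cSup_upper[OF _ bdd, of z] cdf_nonneg[of z] by (force simp: x0_def Z_def)
  define D where "D n = {x0<..x0 + 1 / Suc n}" for n
  \<comment> \<open>As \<Phi> vanishes at its last zero \<open>x0\<close>, the quotient in
    \<open>\<nu>_lower\<close> equals \<open>x0\<close>, however short the interval is. With finite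
    \<nu>-mass these masses would have to tend to 0.\<close>
  have lower: "ennreal x0 \<le> emeasure \<nu> (D n)" for n
    using \<nu>_lower[of x0 "x0 + 1 / Suc n"] pos[of "x0 + 1 / Suc n"] x0' assms(1) by (simp add: D_def)
  have fin: "emeasure \<nu> (D n) \<noteq> \<infinity>" for n
  proof -
    have "emeasure \<nu> (D n) \<le> \<psi> x"
      unfolding psi_eq D_def using x0' by (intro emeasure_mono) auto
    then show ?thesis using \<open>\<psi> x \<noteq> \<infinity>\<close> by (auto simp: top_unique)
  qed
  have "decseq D"
  proof (rule decseq_SucI)
    show "D (Suc n) \<subseteq> D n" for n
    proof -
      have "1 / real (Suc (Suc n)) \<le> 1 / real (Suc n)" by (intro divide_left_mono) auto
      then show ?thesis by (auto simp: D_def simp del: of_nat_Suc)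
    qed
  qed
  moreover have "range D \<subseteq> sets \<nu>" by (auto simp: D_def)
  ultimately have "(\<lambda>n. emeasure \<nu> (D n)) \<longlonglongrightarrow> emeasure \<nu> (\<Inter>n. D n)"
    using fin by (intro Lim_emeasure_decseq)
  moreover have "(\<Inter>n. D n) = {}"
  proof (rule ccontr)
    assume "(\<Inter>n. D n) \<noteq> {}"
    then obtain y where y: "\<And>n. y \<in> D n" by blast
    then have "0 < y - x0" by (simp add: D_def)
    then obtain n where "1 / Suc n < y - x0" by (rule nat_approx_posE)
    with y[of n] show False by (simp add: D_def)
  qed
  ultimately have "(\<lambda>n. emeasure \<nu> (D n)) \<longlonglongrightarrow> 0" by simp
  then have "ennreal x0 \<le> 0" by (rule LIMSEQ_le_const) (use lower in blast)
  then show False using x0' assms by simp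
qed

text \<open>Continuity from the right is continuity of \<nu> from below. From the left there are
  three cases: for x \<le> 0 there is no mass to the left; for positive x with
  \<open>\<Phi> x = 0\<close> the function is infinite at x and everywhere to its left; otherwise
  nearby tails are finite and \<nu> has no atom at x.\<close>

lemma psi_cont: "continuous_on UNIV \<psi>"
proof -
  have "isCont \<psi> x" for x
    unfolding continuous_at_split
  proof
    have "(\<psi> \<longlongrightarrow> \<psi> x) (at_right x)"
    proof (rule tendsto_at_right_sequentially[of x "x + 1"])
      fix f :: "nat \<Rightarrow> real" assume f: "\<And>n. x < f n" "decseq f" "f \<longlonglongrightarrow> x"
      have "(\<lambda>n. emeasure \<nu> {f n<..}) \<longlonglongrightarrow> emeasure \<nu> (\<Union>n. {f n<..})"
        using f(2) by (intro Lim_emeasure_incseq) (auto simp: incseq_def decseq_def intro: le_less_trans)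
      also have "(\<Union>n. {f n<..}) = {x<..}"
        using f(1) order_tendstoD(2)[OF f(3)] by (auto simp: eventually_sequentially intro: less_trans) blast
      finally show "(\<lambda>n. \<psi> (f n)) \<longlonglongrightarrow> \<psi> x" by (simp add: psi_eq)
    qed simp
    then show "continuous (at_right x) \<psi>" by (simp add: continuous_within)
    have "(\<psi> \<longlongrightarrow> \<psi> x) (at_left x)"
    proof (cases "x \<le> 0")
      case True
      have "\<psi> u = \<psi> x" if "u < x" for u
      proof -
        have "emeasure \<nu> {u<..x} = 0"
          using that True by (intro null_\<nu>) (simp_all add: emeasure_Ioc \<Phi>_0)
        then show ?thesis using \<nu>_Ioc_split[of u x] that by simp
      qed
      then have "\<forall>\<^sub>F u in at_left x. \<psi> x = \<psi> u"
        by (auto simp: eventually_at_left_field intro!: exI[of _ "x - 1"])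
      then show ?thesis by (rule Lim_transform_eventually[OF tendsto_const])
    next
      case False
      show ?thesis
      proof (cases "\<Phi> x = 0")
        case True
        then have "\<psi> x = \<infinity>" using False by (intro psi_infinite) auto
        then have "\<psi> x = \<psi> u" if "u < x" for u
          using psi_anti[of u x] that by (simp add: top_unique)
        then have "\<forall>\<^sub>F u in at_left x. \<psi> x = \<psi> u"
          by (auto simp: eventually_at_left_field intro!: exI[of _ "x - 1"])
        then show ?thesis by (rule Lim_transform_eventually[OF tendsto_const])
      next
        case False
        then have "0 < \<Phi> x" using cdf_nonneg[of x] by simp
        moreover have "(\<Phi> \<longlongrightarrow> \<Phi> x) (at_left x)"
          using \<Phi>_cont[of x] by (auto simp: isCont_def intro: tendsto_within_subset)
        ultimately have "\<forall>\<^sub>F u in at_left x. 0 < \<Phi> u" by (metis order_tendstoD(1))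
        then obtain c where c: "c < x" "\<And>u. c < u \<Longrightarrow> u < x \<Longrightarrow> 0 < \<Phi> u"
          unfolding eventually_at_left_field by blast
        show ?thesis
        proof (rule tendsto_at_left_sequentially[OF c(1)])
          fix f :: "nat \<Rightarrow> real" assume f: "\<And>n. f n < x" "\<And>n. c < f n" "incseq f" "f \<longlonglongrightarrow> x"
          have "emeasure \<nu> {f n<..} \<noteq> \<infinity>" for n
            using psi_finite[OF c(2)[OF f(2)[of n] f(1)[of n]]] by (simp add: psi_eq less_top[symmetric])
          then have "(\<lambda>n. emeasure \<nu> {f n<..}) \<longlonglongrightarrow> emeasure \<nu> (\<Inter>n. {f n<..})"
            using f(3) by (intro Lim_emeasure_decseq) (auto simp: incseq_def decseq_def intro: le_less_trans)
          also have "(\<Inter>n. {f n<..}) = {x..}"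
            using f(1) order_tendstoD(1)[OF f(4)]
            by (auto simp: eventually_sequentially not_le intro: less_le_trans) (meson less_asym not_le order_refl)
          also have "emeasure \<nu> {x..} = emeasure \<nu> {x} + emeasure \<nu> {x<..}"
            by (subst plus_emeasure) (auto intro: arg_cong[where f="emeasure \<nu>"])
          also have "emeasure \<nu> {x} = 0"
            by (rule null_\<nu>) (simp_all add: no_atoms)
          finally show "(\<lambda>n. \<psi> (f n)) \<longlonglongrightarrow> \<psi> x" by (simp add: psi_eq)
        qed
      qed
    qed
    then show "continuous (at_left x) \<psi>" by (simp add: continuous_within)
  qed
  then show ?thesis by (simp add: continuous_on_eq_continuous_at)
qed

text \<open>If the two values were equal, \<psi>(z), being finite, could be cancelled; (y, z] would
  be \<nu>-null and, the rate being positive there, \<theta>-null.\<close>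

lemma psi_strict:
  assumes "0 \<le> y" "y \<le> z" "\<Phi> y < \<Phi> z"
  shows "\<psi> z < \<psi> y"
proof (rule ccontr)
  assume "\<not> ?thesis"
  then have "\<psi> y = \<psi> z" using psi_anti[OF assms(2)] by simp
  moreover have "\<psi> z < \<infinity>" using assms(3) cdf_nonneg[of y] by (intro psi_finite) simp
  ultimately have "emeasure \<nu> {y<..z} = 0"
    using \<nu>_Ioc_split[OF assms(2)] by (metis add_cancel_left_left ennreal_add_left_cancel add.commute infinity_ennreal_def order_less_irrefl add_0)
  then have "emeasure \<theta> {y<..z} = 0" using assms(1) by (intro null_\<theta>) auto
  then show False using assms by (simp add: emeasure_Ioc)
qed

lemma psi_pos:
  assumes "0 \<le> z" "\<Phi> z < 1"
  shows "0 < \<psi> z"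
proof (rule ccontr)
  assume "\<not> ?thesis"
  then have "emeasure \<nu> {z<..} = 0" by (simp add: psi_eq)
  then have "emeasure \<theta> {z<..} = 0" using assms(1) by (intro null_\<theta>) auto
  then have "AE x in \<theta>. x \<in> {..z}" using AE_iff_null_sets[of "{z<..}" \<theta>] by (auto simp: null_sets_def elim: eventually_mono)
  then have "\<Phi> z = 1" unfolding cdf_def by (intro prob_eq_1[THEN iffD2]) auto
  with assms show False by simp
qed

lemma psi_vanish: "0 < u \<Longrightarrow> \<exists>C. \<psi> C \<le> ennreal u"
proof -
  assume u: "0 < u"
  \<comment> \<open>A median is just a point at which \<Phi> is positive, so that the tails beyond
    it are finite and decrease to the mass of the empty set.\<close>
  obtain w where w: "0 < w" "\<Phi> w = 1/2" using \<Phi>_surj[of "1/2"] by auto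
  have "(\<lambda>n. emeasure \<nu> {w + real n<..}) \<longlonglongrightarrow> emeasure \<nu> (\<Inter>n. {w + real n<..})"
  proof (intro Lim_emeasure_decseq)
    show "emeasure \<nu> {w + real n<..} \<noteq> \<infinity>" for n
      using psi_finite[of "w + real n"] w(2) cdf_nondecreasing[of w "w + real n"] by (auto simp: psi_eq)
  qed (auto simp: decseq_def)
  moreover have "(\<Inter>n. {w + real n<..}) = {}"
  proof (rule ccontr)
    assume "(\<Inter>n. {w + real n<..}) \<noteq> {}"
    then obtain y where y: "\<And>n. w + real n < y" by auto
    obtain n where "y - w \<le> real n" using real_arch_simple by blast
    with y[of n] show False by simp
  qed
  ultimately have "(\<lambda>n. \<psi> (w + real n)) \<longlonglongrightarrow> 0" by (simp add: psi_eq)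
  from order_tendstoD(2)[OF this, of "ennreal u"] u show ?thesis
    by (auto simp: eventually_sequentially intro: less_imp_le)
qed

lemma psi_0: "0 < \<psi> 0"
  using \<Phi>_0[of 0] by (intro psi_pos) auto

section \<open>The inverse of \<psi> at positive levels and the comparison solution
  \<open>K\<close>\<close>

definition g :: "real \<Rightarrow> real" where "g a = Inf {z. \<psi> z \<le> ennreal a}"

text \<open>The set in the definition of \<open>g\<close> is closed, nonempty and contains no
  negative points, so its infimum is attained; continuity of \<psi> from the left turns the
  inequality there into an equality. Positivity of \<Phi> follows since \<psi> would be infinite at
  \<open>g a\<close> otherwise.\<close>

lemma
  assumes "0 < a" "ennreal a < \<psi> 0"
  shows psi_g: "\<psi> (g a) = ennreal a" and g_pos: "0 < g a" and psi_below_g: "\<And>y. y < g a \<Longrightarrow> ennreal a < \<psi> y"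
    and g_le: "\<And>z. \<psi> z \<le> ennreal a \<Longrightarrow> g a \<le> z" and \<Phi>_g_pos: "0 < \<Phi> (g a)"
proof -
  define Z where "Z = {z. \<psi> z \<le> ennreal a}"
  have ne: "Z \<noteq> {}" using psi_vanish[OF assms(1)] by (auto simp: Z_def)
  have lb: "0 \<le> z" if "z \<in> Z" for z
    using that psi_anti[of z 0] assms(2) by (cases "z < 0") (auto simp: Z_def)
  then have bdd: "bdd_below Z" by (auto simp: bdd_below_def)
  have "closed Z" unfolding Z_def by (intro closed_Collect_le psi_cont continuous_on_const)
  then have "g a \<in> Z" using ne bdd unfolding g_def Z_def[symmetric] by (intro closed_contains_Inf)
  then have le: "\<psi> (g a) \<le> ennreal a" by (simp add: Z_def)
  show gle: "g a \<le> z" if "\<psi> z \<le> ennreal a" for z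
    using cInf_lower[OF _ bdd, of z] that by (simp add: g_def Z_def)
  show below: "ennreal a < \<psi> y" if "y < g a" for y
    using gle[of y] that by (cases "\<psi> y \<le> ennreal a") auto
  have "isCont \<psi> (g a)" using psi_cont by (simp add: continuous_on_eq_continuous_at)
  then have "(\<psi> \<longlongrightarrow> \<psi> (g a)) (at_left (g a))" by (auto simp: isCont_def intro: tendsto_within_subset)
  then have "ennreal a \<le> \<psi> (g a)"
  proof (rule tendsto_lowerbound)
    show "\<forall>\<^sub>F y in at_left (g a). ennreal a \<le> \<psi> y"
      using below by (auto simp: eventually_at_left_field intro!: exI[of _ "g a - 1"] less_imp_le)
  qed simp
  with le show eq: "\<psi> (g a) = ennreal a" by (rule order_antisym)
  show pos: "0 < g a"
    using eq assms(2) psi_anti[of "g a" 0] by (cases "0 < g a") auto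
  show "0 < \<Phi> (g a)"
    using psi_infinite[OF pos] eq cdf_nonneg[of "g a"] by (cases "\<Phi> (g a) = 0") auto
qed

definition K :: "real \<Rightarrow> real" where "K a = \<Phi> (g a)"

text \<open>Since \<psi>(g(a)) = a, the interval (g(b), g(a)] has \<nu>-mass exactly b - a.
  Inserting this into the two bounds on \<nu> yields the inequalities.\<close>

lemma
  assumes ab: "0 < a" "a < b" "ennreal b < \<psi> 0"
  shows K_upper: "g b * (K a - K b) \<le> (b - a) * K a"
    and K_lower: "(b - a) * K b \<le> g a * (K a - K b)"
    and g_anti: "g b \<le> g a"
proof -
  have a: "ennreal a < \<psi> 0" using ab by (intro le_less_trans[OF ennreal_leI ab(3)]) simp
  have b: "0 < b" using ab by simp
  show g: "g b \<le> g a"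
    using psi_g[OF ab(1) a] ab by (intro g_le[OF b ab(3)]) (simp add: ennreal_leI)
  have "ennreal b = emeasure \<nu> {g b<..g a} + ennreal a"
    using \<nu>_Ioc_split[OF g] psi_g[OF ab(1) a] psi_g[OF b ab(3)] by simp
  then have eq: "emeasure \<nu> {g b<..g a} = ennreal (b - a)"
    using ab by (metis add_diff_self_ennreal ennreal_minus ennreal_add_diff_cancel_right ennreal_neq_top less_imp_le)
  have K: "0 < K a" "0 < K b" "K b \<le> K a"
    using \<Phi>_g_pos[OF ab(1) a] \<Phi>_g_pos[OF b ab(3)] cdf_nondecreasing[OF g] by (auto simp: K_def)
  have gp: "0 < g b" "0 < g a" using g_pos[OF ab(1) a] g_pos[OF b ab(3)] by auto
  have "g b * (K a - K b) / K a \<le> b - a"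
    using \<nu>_lower[of "g b" "g a"] gp g K ab unfolding eq K_def by simp
  then show "g b * (K a - K b) \<le> (b - a) * K a" using K by (simp add: pos_divide_le_eq)
  have "b - a \<le> g a * (K a - K b) / K b"
    using \<nu>_upper[of "g b" "g a"] gp g K ab unfolding eq K_def
    by (subst (asm) ennreal_le_iff) (auto intro!: divide_nonneg_nonneg mult_nonneg_nonneg cdf_nonneg)
  then show "(b - a) * K b \<le> g a * (K a - K b)" using K by (simp add: pos_le_divide_eq)
qed

lemma K_tendsto_1: "(K \<longlongrightarrow> 1) (at_right 0)"
proof (rule order_tendstoI)
  fix e :: real assume "1 < e"
  then have "K a < e" for a using cdf_bounded_prob[of "g a"] by (simp add: K_def)
  then show "\<forall>\<^sub>F a in at_right 0. K a < e" by simp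
next
  fix e :: real assume e: "e < 1"
  \<comment> \<open>The maximum with 0 keeps \<open>p\<close> strictly between 0 and 1 even for
    negative \<open>e\<close>. A quantile \<open>z\<close> of order \<open>p\<close> is then a lower
    bound for \<open>g\<close> at all levels below \<psi>(z).\<close>
  define p where "p = (max e 0 + 1) / 2"
  have p: "0 < p" "p < 1" "e < p" using e by (auto simp: p_def max_def)
  obtain z where z: "0 < z" "\<Phi> z = p" using \<Phi>_surj[OF p(1,2)] .
  have "0 < \<psi> z" using z p by (intro psi_pos) auto
  then obtain c where c: "0 \<le> c" "0 < ennreal c" "ennreal c < \<psi> z"
    using dense[of 0 "\<psi> z"] by (metis ennreal_cases not_less top.extremum ennreal_less_zero_iff less_imp_le infinity_ennreal_def)
  have "e < K a" if a: "0 < a" "a < c" for a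
  proof -
    have ac: "ennreal a < \<psi> z" using a by (intro le_less_trans[OF ennreal_leI c(3)]) simp
    then have a0: "ennreal a < \<psi> 0" using psi_anti[of 0 z] z by (simp add: less_le_trans)
    have "z \<le> g a"
      using ac psi_g[OF a(1) a0] psi_anti[of "g a" z] by (cases "z \<le> g a") auto
    then have "p \<le> K a" using cdf_nondecreasing z by (auto simp: K_def)
    with p show ?thesis by simp
  qed
  moreover have "0 < c" using c by simp
  ultimately show "\<forall>\<^sub>F a in at_right 0. e < K a"
    unfolding eventually_at_right_field by blast
qed

text \<open>\<open>G\<close> is the tail of the law of \<open>A\<close> at the stopping time; the hypotheses are the balance between
  the growth of \<open>A\<close> and the value \<open>\<phi>(A)\<close> of \<open>X\<close> at that time.\<close>

lemma tail_eq_cdf: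
  fixes G :: "real \<Rightarrow> real"
  assumes up: "\<And>u b C y. 0 < u \<Longrightarrow> u < b \<Longrightarrow> \<psi> C \<le> ennreal u \<Longrightarrow> ennreal b < \<psi> y \<Longrightarrow> y * (G u - G b) \<le> (b - u) * G u"
    and low: "\<And>u b C. 0 < u \<Longrightarrow> u < b \<Longrightarrow> \<psi> C \<le> ennreal u \<Longrightarrow> (b - u) * G b \<le> C * (G u - G b)"
    and nonneg: "\<And>u. 0 \<le> G u" and lim: "(G \<longlongrightarrow> 1) (at_right 0)"
    and z: "0 < \<Phi> z" "\<Phi> z < 1"
  shows "G (enn2real (\<psi> z)) = \<Phi> z"
proof -
  have up': "g b * (G u - G b) \<le> (b - u) * G u" if u: "0 < u" "u < b" "ennreal b < \<psi> 0" for u b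
  proof -
    have u0: "ennreal u < \<psi> 0" using u by (intro le_less_trans[OF ennreal_leI u(3)]) simp
    \<comment> \<open>The hypothesis covers only \<open>y\<close> strictly below \<open>g b\<close>,
      where \<psi> exceeds \<open>b\<close>; the value \<open>g b\<close> is reached as a limit from
      the left.\<close>
    have "((\<lambda>y. y * (G u - G b)) \<longlongrightarrow> g b * (G u - G b)) (at_left (g b))"
      by (intro tendsto_intros)
    then show ?thesis
    proof (rule tendsto_upperbound)
      have "0 < b" using u by simp
      then have "y * (G u - G b) \<le> (b - u) * G u" if "y < g b" for y
        using up[OF u(1,2) eq_refl[OF psi_g[OF u(1) u0]]] psi_below_g[OF _ u(3)] that by blast
      then show "\<forall>\<^sub>F y in at_left (g b). y * (G u - G b) \<le> (b - u) * G u"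
        by (auto simp: eventually_at_left_field intro!: exI[of _ "g b - 1"])
    qed simp
  qed
  have low': "(b - u) * G b \<le> g u * (G u - G b)" if u: "0 < u" "u < b" "ennreal b < \<psi> 0" for u b
  proof -
    have "ennreal u < \<psi> 0" using u by (intro le_less_trans[OF ennreal_leI u(3)]) simp
    then show ?thesis using low[OF u(1,2)] psi_g[OF u(1)] by simp
  qed
  have quot: "G u / K u = G b / K b" if u: "0 < u" "u < b" "ennreal b < \<psi> 0" for u b
  proof (rule proportional_solutions[OF u(2), where g=g])
    have le: "ennreal t < \<psi> 0" if "t \<le> b" for t using that by (intro le_less_trans[OF ennreal_leI u(3)])
    fix s :: real assume s: "u \<le> s"
    then have s0: "0 < s" using u by simp
    show "g t * (G s - G t) \<le> (t - s) * G s" "(t - s) * G t \<le> g s * (G s - G t)"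
      "g t * (K s - K t) \<le> (t - s) * K s" "(t - s) * K t \<le> g s * (K s - K t)" if "s < t" "t \<le> b" for t
      using up' low' K_upper K_lower s0 that le by auto
    show "0 < g s" "0 \<le> G s" "0 < K s" if "s \<le> b"
      using g_pos[OF s0 le[OF that]] nonneg \<Phi>_g_pos[OF s0 le[OF that]] by (auto simp: K_def)
    show "g t \<le> g s" if "s \<le> t" "t \<le> b" for t
      using g_anti[OF s0 _ le[OF that(2)]] that by (cases "s = t") auto
  qed
  have GK: "G b = K b" if b: "0 < b" "ennreal b < \<psi> 0" for b
  proof -
    \<comment> \<open>The quotient is constant on the levels below \<psi>(0), and the limits at 0
      identify the constant as 1.\<close>
    have "((\<lambda>u. G u / K u) \<longlongrightarrow> 1 / 1) (at_right 0)"
      by (intro tendsto_divide lim K_tendsto_1) simp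
    moreover have "\<forall>\<^sub>F u in at_right 0. G u / K u = G b / K b"
      using quot b by (auto simp: eventually_at_right_field intro!: exI[of _ b])
    ultimately have "((\<lambda>u. G b / K b) \<longlongrightarrow> 1 / 1) (at_right (0::real))"
      by (rule Lim_transform_eventually)
    then have "G b / K b = 1 / 1"
      by (intro tendsto_unique[OF _ tendsto_const]) simp_all
    then show ?thesis using \<Phi>_g_pos[OF b] by (simp add: K_def)
  qed
  have z0: "0 < z" using z \<Phi>_0[of z] by (cases "z \<le> 0") auto
  define a where "a = enn2real (\<psi> z)"
  have a: "ennreal a = \<psi> z" using psi_finite[OF z(1)] by (simp add: a_def)
  have "0 < \<psi> z" using z z0 by (intro psi_pos) auto
  then have a0: "0 < a" unfolding a[symmetric] by simp
  have "\<psi> z < \<psi> 0" using z z0 \<Phi>_0[of 0] by (intro psi_strict) auto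
  then have a1: "ennreal a < \<psi> 0" by (simp add: a)
  have "g a \<le> z" by (rule g_le[OF a0 a1]) (simp add: a)
  \<comment> \<open>\<open>z\<close> may differ from \<open>g a\<close> if \<psi> is flat between
    them, but then \<theta> has no mass in between.\<close>
  then have "\<Phi> (g a) = \<Phi> z"
    using psi_strict[of "g a" z] psi_g[OF a0 a1] g_pos[OF a0 a1] cdf_nondecreasing[of "g a" z] a by force
  then show ?thesis using GK[OF a0 a1] by (simp add: K_def a_def)
qed

end

text \<open>If \<psi>(z) > x, continuity keeps \<psi> above x up to some d > z, so the whole set
  under the infimum lies beyond d. From level \<psi>(0) on both sides are true.\<close>

lemma (in embedded_law) phi_bar_le_iff:
  assumes "0 \<le> z"
  shows "phi_bar \<theta> x \<le> ennreal z \<longleftrightarrow> \<psi> z \<le> ennreal x"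
proof (cases "ennreal x < \<psi> 0")
  case True
  define D where "D = {ennreal z |z. 0 \<le> z \<and> \<psi> z \<le> ennreal x}"
  have phi: "phi_bar \<theta> x = Inf D" using True by (simp add: phi_bar_def D_def)
  show ?thesis
  proof
    assume le: "phi_bar \<theta> x \<le> ennreal z"
    show "\<psi> z \<le> ennreal x"
    proof (rule ccontr)
      assume "\<not> \<psi> z \<le> ennreal x"
      moreover have "(\<psi> \<longlongrightarrow> \<psi> z) (at_right z)"
        using psi_cont by (auto simp: continuous_on_def intro: tendsto_within_subset)
      ultimately have z: "ennreal x < \<psi> z" "\<forall>\<^sub>F w in at_right z. ennreal x < \<psi> w"
        by (auto simp: not_le dest: order_tendstoD(1))
      then obtain d where d: "z < d" "\<And>w. z < w \<Longrightarrow> w < d \<Longrightarrow> ennreal x < \<psi> w"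
        unfolding eventually_at_right_field by blast
      have "ennreal d \<le> Inf D"
      proof (rule Inf_greatest)
        fix y assume "y \<in> D"
        then obtain w where w: "y = ennreal w" "\<psi> w \<le> ennreal x" by (auto simp: D_def)
        have "\<not> w \<le> z" using w(2) z(1) psi_anti[of w z] by auto
        then have "d \<le> w" using w(2) d(2)[of w] by (cases "d \<le> w") auto
        then show "ennreal d \<le> y" by (simp add: w(1) ennreal_leI)
      qed
      also have "\<dots> \<le> ennreal z" using le by (simp add: phi)
      finally show False using d(1) assms by (simp add: ennreal_le_iff2)
    qed
  next
    assume "\<psi> z \<le> ennreal x"
    then show "phi_bar \<theta> x \<le> ennreal z"
      unfolding phi using assms by (intro Inf_lower) (auto simp: D_def)
  qed
next
  case False
  then show ?thesis
    using psi_anti[OF assms] by (auto simp: phi_bar_def)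
qed

section \<open>Transfer along null sets to the completion and the usual augmentation\<close>

lemma AE_completion_null:
  assumes "AE \<omega> in M. P \<omega>" "D \<subseteq> {\<omega>\<in>space M. \<not> P \<omega>}"
  shows "D \<in> null_sets (completion M)"
proof -
  obtain Z where "{\<omega>\<in>space M. \<not> P \<omega>} \<subseteq> Z" "Z \<in> null_sets M"
    using assms(1) by (rule AE_E3) (auto intro: that)
  then show ?thesis
    using assms(2) by (intro null_sets_completion_subset[OF _ null_sets_completionI]) auto
qed

lemma borel_measurable_completion_AE:
  assumes g: "g \<in> measurable M N" and eq: "AE \<omega> in M. f \<omega> = g \<omega>" and sp: "\<And>\<omega>. \<omega> \<in> space M \<Longrightarrow> f \<omega> \<in> space N"
  shows "f \<in> measurable (completion M) N"
proof (rule measurableI)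
  fix D assume D: "D \<in> sets N"
  define U where "U = f -` D \<inter> space M"
  define V where "V = g -` D \<inter> space M"
  have "V \<in> sets (completion M)" using measurable_sets[OF g D] by (simp add: V_def)
  moreover have "U - V \<in> null_sets (completion M)" "V - U \<in> null_sets (completion M)"
    by (rule AE_completion_null[OF eq]; auto simp: U_def V_def)+
  ultimately have "(V - (V - U)) \<union> (U - V) \<in> sets (completion M)" by auto
  also have "(V - (V - U)) \<union> (U - V) = U" by auto
  finally show "f -` D \<inter> space (completion M) \<in> sets (completion M)" by (simp add: U_def)
qed (use sp in simp)

text \<open>Right-continuity replaces the strict inequality by the weak one, and the completion
  absorbs the null set on which \<open>T\<close> differs from \<open>S\<close>.\<close>

lemma (in filtered_prob_space) optional_imp_stopping_usual_augmentation:
  assumes S: "optional_time F S" and eq: "AE \<omega> in M. T \<omega> = S \<omega>"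
  shows "stopping_time (usual_augmentation M F) T"
proof
  fix t :: ennreal
  define \<A> where "\<A> s = sigma_sets (space M) (sets (F s) \<union> null_sets (completion M))" for s
  define D where "D = {\<omega>\<in>space M. T \<omega> \<le> t}"
  define D' where "D' = {\<omega>\<in>space M. S \<omega> \<le> t}"
  have sub: "sets (F s) \<union> null_sets (completion M) \<subseteq> Pow (space M)" for s
    using sets.sets_into_space[of _ "F s"] sets.sets_into_space[of _ "completion M"] by (auto simp: space_F)
  have sa: "sigma_algebra (space M) (\<A> s)" for s
    unfolding \<A>_def by (rule sigma_algebra_sigma_sets[OF sub])
  have mem: "D \<in> \<A> s" if s: "t < s \<or> s = \<infinity>" for s
  proof -
    interpret sigma_algebra "space M" "\<A> s" by (rule sa)
    have "D' \<in> sets (F s)"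
    proof (cases "t < s")
      case True
      \<comment> \<open>Only rationals between \<open>t\<close> and \<open>s\<close> are inspected,
        so the event belongs to \<open>F s\<close> for every \<open>s\<close> beyond
        \<open>t\<close>.\<close>
      have "S \<omega> \<le> t \<longleftrightarrow> \<not> (\<exists>q\<in>{q\<in>\<rat>. 0 \<le> q \<and> ennreal q < s}. t < ennreal q \<and> \<not> S \<omega> < ennreal q)" for \<omega>
      proof
        assume "S \<omega> \<le> t"
        then show "\<not> (\<exists>q\<in>{q\<in>\<rat>. 0 \<le> q \<and> ennreal q < s}. t < ennreal q \<and> \<not> S \<omega> < ennreal q)"
          by (auto intro: le_less_trans)
      next
        assume no: "\<not> (\<exists>q\<in>{q\<in>\<rat>. 0 \<le> q \<and> ennreal q < s}. t < ennreal q \<and> \<not> S \<omega> < ennreal q)"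
        show "S \<omega> \<le> t"
        proof (rule ccontr)
          assume "\<not> S \<omega> \<le> t"
          then have "t < min (S \<omega>) s" using True by simp
          then obtain q where "q \<in> \<rat>" "0 \<le> q" "t < ennreal q" "ennreal q < min (S \<omega>) s"
            by (rule ennreal_Rats_dense)
          with no show False by auto
        qed
      qed
      moreover have "Measurable.pred (F s) (\<lambda>\<omega>. \<not> (\<exists>q\<in>{q\<in>\<rat>. 0 \<le> q \<and> ennreal q < s}. t < ennreal q \<and> \<not> S \<omega> < ennreal q))"
      proof (rule pred_intros_logic(2), rule pred_F_Rats_Ex)
        fix q :: real assume "ennreal q < s"
        then have [measurable]: "Measurable.pred (F s) (\<lambda>\<omega>. S \<omega> < ennreal q)"
          by (intro pred_F_mono[OF _ optional_timeD[OF S]]) simp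
        show "Measurable.pred (F s) (\<lambda>\<omega>. t < ennreal q \<and> \<not> S \<omega> < ennreal q)" by measurable
      qed
      ultimately show ?thesis by (simp add: D'_def pred_def space_F)
    next
      \<comment> \<open>Here both \<open>s\<close> and \<open>t\<close> are infinite, and the event
        is the whole space.\<close>
      case False
      with s have "D' = space (F s)" by (auto simp: D'_def space_F not_less top_unique)
      then show ?thesis by simp
    qed
    then have "D' \<in> \<A> s" by (auto simp: \<A>_def)
    moreover have "D - D' \<in> null_sets (completion M)" "D' - D \<in> null_sets (completion M)"
      by (rule AE_completion_null[OF eq]; auto simp: D_def D'_def)+
    then have "D - D' \<in> \<A> s" "D' - D \<in> \<A> s" by (auto simp: \<A>_def)
    ultimately have "(D' - (D' - D)) \<union> (D - D') \<in> \<A> s" by blast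
    also have "(D' - (D' - D)) \<union> (D - D') = D" by auto
    finally show ?thesis .
  qed
  have "(\<Inter>s\<in>{s. t < s \<or> s = \<infinity>}. \<A> s) \<subseteq> Pow (space M)"
    using sigma_algebra.axioms(1)[OF sa[of \<infinity>]] sigma_sets_into_sp[OF sub[of \<infinity>]] by (auto simp: \<A>_def)
  moreover have "D \<in> (\<Inter>s\<in>{s. t < s \<or> s = \<infinity>}. \<A> s)" using mem by blast
  ultimately have "D \<in> sets (usual_augmentation M F t)"
    unfolding usual_augmentation_def \<A>_def by (simp add: sets_measure_of_conv)
  then show "Measurable.pred (usual_augmentation M F t) (\<lambda>\<omega>. T \<omega> \<le> t)"
    by (simp add: pred_def D_def usual_augmentation_def space_measure_of_conv)
qed

section \<open>From the tail of \<open>A\<close> at the exit time to the law of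
  \<open>X\<close>\<close>

theorem proposition5p6:
  fixes M :: "'a measure" and F :: "ennreal \<Rightarrow> 'a measure"
    and X N A :: "real \<Rightarrow> 'a \<Rightarrow> real" and \<theta> :: "real measure"
  assumes "filtered_prob_space M F"
    and "class_Sigma M F X N A"
    and "only_negative_jumps M X"
    and "AE \<omega> in M. filterlim (\<lambda>t. A t \<omega>) at_top at_top"
    and "prob_space \<theta>" and "sets \<theta> = sets borel" and "emeasure \<theta> {..<0} = 0"
    and no_atoms: "\<And>z. emeasure \<theta> {z} = 0"
    and finite_mean: "integrable \<theta> (\<lambda>z. z)"
  shows "embeds M F X (T_bar \<theta> X A) \<theta>"
proof -
  interpret L: embedded_law \<theta>
    using assms by (intro embedded_law.intro real_distribution.intro real_distribution_axioms.intro embedded_law_axioms.intro)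
  interpret E: sigma_embedding M F X N A "psi_bar \<theta>"
    using assms L.psi_cont L.psi_anti L.psi_0 L.psi_vanish
    by (intro sigma_embedding.intro sigma_embedding_axioms.intro)
  have tail: "E.G (enn2real (psi_bar \<theta> z)) = cdf \<theta> z" if "0 < cdf \<theta> z" "cdf \<theta> z < 1" for z
  proof (rule L.tail_eq_cdf[OF _ _ E.G_nonneg E.G_tendsto_1 that])
    fix u b C :: real assume u: "0 < u" "u < b" "psi_bar \<theta> C \<le> ennreal u"
    show "y * (E.G u - E.G b) \<le> (b - u) * E.G u" if "ennreal b < psi_bar \<theta> y" for y
      using E.G_upper[OF u(2) _ u(3) that] u by simp
    show "(b - u) * E.G b \<le> C * (E.G u - E.G b)"
      using E.G_lower[OF u(2) _ u(3)] u by simp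
  qed
  have level: "ennreal (enn2real (psi_bar \<theta> z)) = psi_bar \<theta> z" if "0 < cdf \<theta> z" for z
    using L.psi_finite[OF that] by simp
  \<comment> \<open>Almost every path with infinite \<sigma> is counted in every value of
    \<open>G\<close>, and by \<open>tail\<close> these values become arbitrarily small.\<close>
  have prob_top: "measure M {\<omega>\<in>space M. E.\<sigma> \<omega> = \<infinity>} \<le> p" if p: "0 < p" "p < 1" for p
  proof -
    obtain z where z: "cdf \<theta> z = p" using L.\<Phi>_surj[OF p] by blast
    have "measure M {\<omega>\<in>space M. E.\<sigma> \<omega> = \<infinity>} \<le> E.G (enn2real (psi_bar \<theta> z))"
      unfolding E.G_def
    proof (rule E.finite_measure_mono_AE)
      show "AE \<omega> in M. \<omega> \<in> {\<omega>\<in>space M. E.\<sigma> \<omega> = \<infinity>} \<longrightarrow>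
          \<omega> \<in> {\<omega>\<in>space M. E.\<tau> (enn2real (psi_bar \<theta> z)) \<omega> < E.\<sigma> \<omega>}"
        using E.AE_regular
      proof eventually_elim
        case (elim \<omega>)
        then show ?case
          using sigma_path.level_time_finite[OF E.regular_path[OF elim]] by (auto simp: E.\<tau>_def)
      qed
    qed measurable
    also have "\<dots> = p" using tail[of z] z p by simp
    finally show ?thesis .
  qed
  have "measure M {\<omega>\<in>space M. E.\<sigma> \<omega> = \<infinity>} \<le> 0"
  proof (rule dense_ge)
    fix p :: real assume "0 < p"
    then show "measure M {\<omega>\<in>space M. E.\<sigma> \<omega> = \<infinity>} \<le> p"
      using prob_top[of "min p (1/2)"] by simp
  qed
  then have "{\<omega>\<in>space M. E.\<sigma> \<omega> = \<infinity>} \<in> null_sets M"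
    by (intro null_setsI) (simp_all add: E.emeasure_eq_measure measure_le_0_iff)
  then have fin: "AE \<omega> in M. E.\<sigma> \<omega> < \<infinity>"
    by (rule AE_I') (auto simp: less_top[symmetric])
  \<comment> \<open>\<open>W\<close> is a version of the stopped value that is measurable for
    \<open>M\<close>, so its law can be found there and then moved to the completion.\<close>
  define W where "W = right_value X (\<lambda>\<omega>. enn2real (E.\<sigma> \<omega>))"
  have [measurable]: "W \<in> borel_measurable M"
    unfolding W_def by (rule right_value_measurable) (auto intro: E.measurable_F_M E.adapted(1), measurable)
  have main: "AE \<omega> in M. T_bar \<theta> X A \<omega> = E.\<sigma> \<omega> \<and> value_at X (T_bar \<theta> X A) \<omega> = W \<omega> \<and>
      (\<exists>s\<ge>0. E.\<sigma> \<omega> = ennreal s \<and> psi_bar \<theta> (W \<omega>) = ennreal (A s \<omega>) \<and> 0 \<le> A s \<omega> \<and> E.regular \<omega>)"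
    using E.AE_regular E.attained fin
  proof eventually_elim
    case (elim \<omega>)
    interpret p: sigma_path "\<lambda>t. X t \<omega>" "\<lambda>t. A t \<omega>" "psi_bar \<theta>" by (rule E.regular_path[OF elim(1)])
    obtain s where s: "E.\<sigma> \<omega> = ennreal s" "0 \<le> s" using elim(3) by (cases "E.\<sigma> \<omega>") auto
    have le: "psi_bar \<theta> (X s \<omega>) \<le> ennreal (A s \<omega>)" using elim(2,3) s by simp
    have "T_bar \<theta> X A \<omega> = Inf {ennreal t |t. 0 \<le> t \<and> psi_bar \<theta> (X t \<omega>) \<le> ennreal (A t \<omega>)}"
      unfolding T_bar_def
      by (rule arg_cong[where f=Inf]) (use L.phi_bar_le_iff[OF p.x_nonneg] in blast)
    also have "\<dots> = E.\<sigma> \<omega>"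
      using p.hitting_eq_announced[of s] s le by (simp add: E.\<sigma>_def)
    finally have T: "T_bar \<theta> X A \<omega> = E.\<sigma> \<omega>" .
    have W: "W \<omega> = X s \<omega>"
      unfolding W_def using s p.x_right[of s] by (subst right_value_eq) auto
    have "psi_bar \<theta> (X s \<omega>) = ennreal (A s \<omega>)"
      using le p.a_announced_le[of s] s by (intro order_antisym) (auto simp: E.\<sigma>_def)
    then show ?case
      using T W s elim(1) p.a_nonneg[of s] by (intro conjI exI[of _ s]) (simp_all add: value_at_def)
  qed
  have T: "AE \<omega> in M. T_bar \<theta> X A \<omega> = E.\<sigma> \<omega>"
    and V: "AE \<omega> in M. value_at X (T_bar \<theta> X A) \<omega> = W \<omega>"
    using main by (auto elim: eventually_mono)
  have Vm: "value_at X (T_bar \<theta> X A) \<in> borel_measurable (completion M)"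
    by (rule borel_measurable_completion_AE[OF _ V]) simp_all
  \<comment> \<open>\<open>tail\<close> covers only points where \<Phi> is strictly between 0 and 1.
    Approaching \<Phi>(w) by such values \<open>p\<close> from below, and from above in the next
    claim, also settles the values 0 and 1.\<close>
  have above: "p \<le> measure M {\<omega>\<in>space M. W \<omega> \<le> w}" if p: "0 < p" "p < cdf \<theta> w" for p w
  proof -
    have "p < 1" using p(2) L.cdf_bounded_prob[of w] by simp
    then obtain z where z: "cdf \<theta> z = p" using L.\<Phi>_surj[OF p(1)] by blast
    have "z \<le> w" using L.cdf_nondecreasing[of w z] z p by (cases "z \<le> w") auto
    have "E.G (enn2real (psi_bar \<theta> z)) \<le> measure M {\<omega>\<in>space M. W \<omega> \<le> w}"
      unfolding E.G_def
    proof (rule E.finite_measure_mono_AE)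
      show "AE \<omega> in M. \<omega> \<in> {\<omega>\<in>space M. E.\<tau> (enn2real (psi_bar \<theta> z)) \<omega> < E.\<sigma> \<omega>} \<longrightarrow>
          \<omega> \<in> {\<omega>\<in>space M. W \<omega> \<le> w}"
        using main
      proof eventually_elim
        case (elim \<omega>)
        then obtain s where s: "E.\<sigma> \<omega> = ennreal s" "0 \<le> s" "psi_bar \<theta> (W \<omega>) = ennreal (A s \<omega>)" "0 \<le> A s \<omega>" "E.regular \<omega>"
          by blast
        have "W \<omega> \<le> w" if "E.\<tau> (enn2real (psi_bar \<theta> z)) \<omega> < E.\<sigma> \<omega>"
        proof -
          have "enn2real (psi_bar \<theta> z) < A s \<omega>" using that E.level_less_iff[OF s(5,1,2)] by simp
          then have "psi_bar \<theta> z < psi_bar \<theta> (W \<omega>)"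
            using level[of z] z p by (metis ennreal_lessI enn2real_nonneg le_less_trans s(3))
          then have "W \<omega> < z" using L.psi_anti[of z "W \<omega>"] by (cases "W \<omega> < z") auto
          with \<open>z \<le> w\<close> show ?thesis by simp
        qed
        then show ?case by blast
      qed
    qed measurable
    then show ?thesis using tail[of z] z p \<open>p < 1\<close> by simp
  qed
  have below: "measure M {\<omega>\<in>space M. W \<omega> \<le> w} \<le> p" if p: "cdf \<theta> w < p" "p < 1" for p w
  proof -
    have "0 < p" using p(1) L.cdf_nonneg[of w] by simp
    then obtain z where z: "0 < z" "cdf \<theta> z = p" using L.\<Phi>_surj[OF _ p(2)] by blast
    \<comment> \<open>From \<open>W \<le> w\<close> only the weak inequality of \<psi>(W) with
      \<psi>(w) follows; the strict gap between \<psi>(z) and \<psi>(w) yields the strict order of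
      the level time and \<sigma>.\<close>
    have less: "psi_bar \<theta> z < psi_bar \<theta> w"
    proof (cases "0 \<le> w")
      case True
      have "w \<le> z" using L.cdf_nondecreasing[of z w] z p by (cases "w \<le> z") auto
      then show ?thesis using True z p by (intro L.psi_strict) auto
    next
      case False
      have "psi_bar \<theta> z < psi_bar \<theta> 0" using z \<open>0 < p\<close> L.\<Phi>_0[of 0] by (intro L.psi_strict) auto
      also have "\<dots> \<le> psi_bar \<theta> w" using False by (intro L.psi_anti) simp
      finally show ?thesis .
    qed
    have "measure M {\<omega>\<in>space M. W \<omega> \<le> w} \<le> E.G (enn2real (psi_bar \<theta> z))"
      unfolding E.G_def
    proof (rule E.finite_measure_mono_AE)
      show "AE \<omega> in M. \<omega> \<in> {\<omega>\<in>space M. W \<omega> \<le> w} \<longrightarrow>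
          \<omega> \<in> {\<omega>\<in>space M. E.\<tau> (enn2real (psi_bar \<theta> z)) \<omega> < E.\<sigma> \<omega>}"
        using main
      proof eventually_elim
        case (elim \<omega>)
        then obtain s where s: "E.\<sigma> \<omega> = ennreal s" "0 \<le> s" "psi_bar \<theta> (W \<omega>) = ennreal (A s \<omega>)" "0 \<le> A s \<omega>" "E.regular \<omega>"
          by blast
        have "E.\<tau> (enn2real (psi_bar \<theta> z)) \<omega> < E.\<sigma> \<omega>" if "W \<omega> \<le> w"
        proof -
          have "psi_bar \<theta> z < ennreal (A s \<omega>)"
            using less L.psi_anti[OF that] s(3) by simp
          then have "ennreal (enn2real (psi_bar \<theta> z)) < ennreal (A s \<omega>)"
            using level[of z] z \<open>0 < p\<close> by simp
          then have "enn2real (psi_bar \<theta> z) < A s \<omega>" by (simp add: ennreal_less_iff)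
          then show ?thesis using E.level_less_iff[OF s(5,1,2)] by simp
        qed
        then show ?case by blast
      qed
    qed measurable
    then show ?thesis using tail[of z] z p \<open>0 < p\<close> by simp
  qed
  have law: "distr M borel W = \<theta>"
  proof (rule cdf_unique)
    show "real_distribution (distr M borel W)"
      by (rule E.real_distribution_distr) measurable
    show "real_distribution \<theta>" by (rule L.real_distribution_axioms)
    show "cdf (distr M borel W) = cdf \<theta>"
    proof
      fix w
      have eq: "cdf (distr M borel W) w = measure M {\<omega>\<in>space M. W \<omega> \<le> w}"
        unfolding cdf_def by (subst measure_distr) (auto intro!: arg_cong[where f="measure M"])
      have "measure M {\<omega>\<in>space M. W \<omega> \<le> w} \<le> cdf \<theta> w"
      proof (cases "cdf \<theta> w < 1")
        case True
        show ?thesis by (rule dense_ge_bounded[OF True]) (rule below)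
      next
        case False
        then show ?thesis using E.prob_le_1[of "{\<omega>\<in>space M. W \<omega> \<le> w}"] by linarith
      qed
      moreover have "cdf \<theta> w \<le> measure M {\<omega>\<in>space M. W \<omega> \<le> w}"
      proof (cases "0 < cdf \<theta> w")
        case True
        show ?thesis by (rule dense_le_bounded[OF True]) (rule above)
      next
        case False
        then show ?thesis using measure_nonneg[of M "{\<omega>\<in>space M. W \<omega> \<le> w}"] by linarith
      qed
      ultimately show "cdf (distr M borel W) w = cdf \<theta> w" using eq by simp
    qed
  qed
  show ?thesis
    unfolding embeds_def
  proof (intro conjI Vm)
    show "stopping_time (usual_augmentation M F) (T_bar \<theta> X A)"
      by (rule E.optional_imp_stopping_usual_augmentation[OF E.optional_\<sigma> T])
    show "AE \<omega> in M. T_bar \<theta> X A \<omega> < \<infinity>"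
      using T fin by eventually_elim simp
    have "distr (completion M) borel (value_at X (T_bar \<theta> X A)) = distr (completion M) borel W"
      using V Vm by (intro distr_cong_AE) (auto intro: AE_completion measurable_completion)
    also have "\<dots> = distr M borel W" by (rule distr_completion) measurable
    finally show "distr (completion M) borel (value_at X (T_bar \<theta> X A)) = \<theta>" using law by simp
  qed
qed

end
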